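(* Let $r\ge2$ and $0\le a_2,a_3\le r-1$ be integers, and let $G\subset\mathrm{SL}(3,\mathbb{C})$ be the cyclic group of type $\frac1r(1,a_2,a_3)$, i.e. generated by $\mathrm{diag}(\varepsilon,\varepsilon^{a_2},\varepsilon^{a_3})$ with $\varepsilon$ a primitive $r$-th root of unity (so $r$ divides $1+a_2+a_3$, and $\mathbb{C}^3/G$ is a three-dimensional Gorenstein cyclic quotient singularity). Then the Fujiki-Oka resolution $f:Y\to\mathbb{C}^3/G$ is crepant, and $\chi(Y)=|G|$, where $\chi(Y)$ is the topological Euler characteristic of $Y$.
   Context: **Proper fractions and remainder maps.** A $3$-dimensional proper fraction is a symbol $\frac{(c_1,c_2,c_3)}{s}$ with $s$ a positive integer and integers $0\le c_i\le s-1$ (a formal symbol: no cancellation). For $1\le i\le 3$ with $c_i\neq0$, the $i$-th remainder map $R_i$ sends $\frac{(c_1,c_2,c_3)}{s}$ to the proper fraction with denominator $c_i$ whose $i$-th numerator is $\overline{-s}^{c_i}$ and whose $j$-th numerator, $j\neq i$, is $\overline{c_j}^{c_i}$; here $\overline{b}^{m}$ is the integer with $0\le\overline{b}^{m}<m$ and $\overline{b}^{m}\equiv b\pmod m$. **Fujiki-Oka resolution.** Let $e_1,e_2,e_3$ be the standard basis of $\mathbb{R}^3$, $N_G=\mathbb{Z}^3+\mathbb{Z}\cdot\frac1r(1,a_2,a_3)\subset\mathbb{R}^3$, and $\sigma_0=\mathrm{Cone}(e_1,e_2,e_3)$, so that the affine toric variety $X(N_G,\sigma_0)$ is $\mathbb{C}^3/G$.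 Start with the cone $\sigma_0$, with ordered generators $(e_1,e_2,e_3)$, labelled by $\frac{(1,a_2,a_3)}{r}$. Given a cone with ordered generators $(u_1,u_2,u_3)$ labelled by $\frac{(c_1,c_2,c_3)}{s}\neq\frac{(0,0,0)}{1}$, where $N_G=\sum_i\mathbb{Z}u_i+\mathbb{Z}w$ with $w=\frac1s\sum_i c_iu_i$, replace it by its star subdivision at $w$: for each $i$ with $c_i\neq0$, take the $3$-dimensional cone whose ordered generators are obtained from $(u_1,u_2,u_3)$ by replacing $u_i$ with $w$, labelled by $R_i\left(\frac{(c_1,c_2,c_3)}{s}\right)$ (which again describes $N_G$ relative to the new generators in the same way). Cones labelled by $\frac{(0,0,0)}{1}$ (those whose generators form a $\mathbb{Z}$-basis of $N_G$) are left unchanged. The process terminates, and the final cones and their faces form a smooth fan $\Sigma$ subdividing $\sigma_0$; the induced toric morphism $f:Y=X(N_G,\Sigma)\to X(N_G,\sigma_0)=\mathbb{C}^3/G$ is the Fujiki-Oka resolution. **Crepant.** One has $K_Y=f^*K_{\mathbb{C}^3/G}+\sum_{\tau\in\Sigma(1)}a_\tau D_\tau$, where $\Sigma(1)$ is the set of rays of $\Sigma$, $D_\tau$ is the torus-invariant divisor of $\tau$, and the discrepancy is $a_\tau=\frac1r\left(b_1+b_2+b_3-r\right)$ if $\frac1r(b_1,b_2,b_3)$ is the primitive element of $N_G$ on $\tau$. The resolution $f$ is crepant if all discrepancies $a_\tau$ are $0$, i.e. $K_Y=f^*K_{\mathbb{C}^3/G}$. *)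

theory Defs
  imports "HOL-Analysis.Analysis" "HOL-Algebra.Generated_Groups" "HOL-Homology.Homology"
begin

section \<open>Cyclic groups of type \<open>1/r (1, a\<^sub>2, a\<^sub>3)\<close>\<close>

definition GL3 :: "(complex ^ 3 ^ 3) monoid" where
  "GL3 = \<lparr>carrier = {A. invertible A}, mult = (**), one = mat 1\<rparr>"

definition SL3 :: "(complex ^ 3 ^ 3) set" where
  "SL3 = {A. det A = 1}"

definition primitive_root_of_unity :: "nat \<Rightarrow> complex \<Rightarrow> bool" where
  "primitive_root_of_unity r \<epsilon> \<longleftrightarrow> \<epsilon> ^ r = 1 \<and> (\<forall>k. 0 < k \<and> k < r \<longrightarrow> \<epsilon> ^ k \<noteq> 1)"

definition diag3 :: "complex \<Rightarrow> complex \<Rightarrow> complex \<Rightarrow> complex ^ 3 ^ 3" where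
  "diag3 x y z = (\<chi> i j. if i = j then vector [x, y, z] $ i else (0 :: complex))"

definition cyclic_group_type :: "complex \<Rightarrow> nat \<Rightarrow> nat \<Rightarrow> (complex ^ 3 ^ 3) set" where
  "cyclic_group_type \<epsilon> a2 a3 = generate GL3 {diag3 \<epsilon> (\<epsilon> ^ a2) (\<epsilon> ^ a3)}"

section \<open>Proper fractions, remainder maps and the Fujiki-Oka fan\<close>

text \<open>The proper fraction with numerators \<open>c\<close> and denominator \<open>s\<close> is the pair \<open>(c, s)\<close>.\<close>

type_synonym fraction3 = "(int ^ 3) \<times> int"

definition initial_fraction :: "nat \<Rightarrow> nat \<Rightarrow> nat \<Rightarrow> fraction3" where
  "initial_fraction r a2 a3 = (vector [1, int a2, int a3], int r)"

definition remainder_map :: "3 \<Rightarrow> fraction3 \<Rightarrow> fraction3" where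
  "remainder_map i = (\<lambda>(c, s). ((\<chi> j. if j = i then (- s) mod (c $ i) else (c $ j) mod (c $ i)), c $ i))"

definition fraction_point :: "(3 \<Rightarrow> real ^ 3) \<Rightarrow> fraction3 \<Rightarrow> real ^ 3" where
  "fraction_point u = (\<lambda>(c, s). \<Sum>i\<in>UNIV. (of_int (c $ i) / of_int s) *\<^sub>R u i)"

definition N_lattice :: "nat \<Rightarrow> nat \<Rightarrow> nat \<Rightarrow> (real ^ 3) set" where
  "N_lattice r a2 a3 =
     {z + of_int k *\<^sub>R fraction_point (\<lambda>i. axis i 1) (initial_fraction r a2 a3) | z (k :: int).
        \<forall>i. z $ i \<in> \<int>}"

text \<open>All labelled cones (ordered generators together with their label) that occur in the
  subdivision process, the intermediate ones included.\<close>

inductive_set fujiki_oka_cones :: "nat \<Rightarrow> nat \<Rightarrow> nat \<Rightarrow> ((3 \<Rightarrow> real ^ 3) \<times> fraction3) set"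
  for r a2 a3 :: nat where
  start: "(\<lambda>i. axis i 1, initial_fraction r a2 a3) \<in> fujiki_oka_cones r a2 a3"
| subdivide: "\<lbrakk>(u, F) \<in> fujiki_oka_cones r a2 a3; F \<noteq> (0, 1); fst F $ i \<noteq> 0\<rbrakk> \<Longrightarrow>
    (u(i := fraction_point u F), remainder_map i F) \<in> fujiki_oka_cones r a2 a3"

definition cone_gen :: "(3 \<Rightarrow> real ^ 3) \<Rightarrow> (real ^ 3) set" where
  "cone_gen u = convex_cone hull (range u)"

text \<open>The library's \<open>face_of\<close> also admits the empty set, which is not a face of a cone.\<close>

definition fujiki_oka_fan :: "nat \<Rightarrow> nat \<Rightarrow> nat \<Rightarrow> (real ^ 3) set set" where
  "fujiki_oka_fan r a2 a3 =
     {\<tau>. \<tau> \<noteq> {} \<and> (\<exists>u. (u, (0, 1)) \<in> fujiki_oka_cones r a2 a3 \<and> \<tau> face_of cone_gen u)}"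

section \<open>Discrepancies\<close>

definition rays :: "(real ^ 3) set set \<Rightarrow> (real ^ 3) set set" where
  "rays \<Sigma> = {\<tau> \<in> \<Sigma>. dim \<tau> = 1}"

definition primitive_element :: "(real ^ 3) set \<Rightarrow> (real ^ 3) set \<Rightarrow> real ^ 3" where
  "primitive_element N \<tau> = (THE v. v \<noteq> 0 \<and> N \<inter> \<tau> = {real k *\<^sub>R v | k :: nat. True})"

text \<open>With \<open>b = r v\<close>, i.e. \<open>v = 1/r (b\<^sub>1, b\<^sub>2, b\<^sub>3)\<close>, this is \<open>1/r (b\<^sub>1 + b\<^sub>2 + b\<^sub>3 - r)\<close>: the
  coefficient of \<open>D\<^sub>\<tau>\<close> in the relative canonical divisor of the toric morphism to
  \<open>X(N, Cone(e\<^sub>1, e\<^sub>2, e\<^sub>3))\<close>.\<close>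

definition discrepancy :: "nat \<Rightarrow> (real ^ 3) set \<Rightarrow> (real ^ 3) set \<Rightarrow> real" where
  "discrepancy r N \<tau> =
     (let b = real r *\<^sub>R primitive_element N \<tau> in (1 / real r) * (b $ 1 + b $ 2 + b $ 3 - real r))"

definition crepant :: "nat \<Rightarrow> (real ^ 3) set \<Rightarrow> (real ^ 3) set set \<Rightarrow> bool" where
  "crepant r N \<Sigma> \<longleftrightarrow> (\<forall>\<tau>\<in>rays \<Sigma>. discrepancy r N \<tau> = 0)"

section \<open>Toric varieties with the classical topology\<close>

definition dual_lattice :: "(real ^ 3) set \<Rightarrow> (real ^ 3) set" where
  "dual_lattice N = {m. \<forall>n\<in>N. m \<bullet> n \<in> \<int>}"

definition cone_semigroup :: "(real ^ 3) set \<Rightarrow> (real ^ 3) set \<Rightarrow> (real ^ 3) set" where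
  "cone_semigroup N \<sigma> = {m \<in> dual_lattice N. \<forall>u\<in>\<sigma>. 0 \<le> m \<bullet> u}"

text \<open>The complex points of \<open>Spec \<complex>[S]\<close>, for the semigroup \<open>S = \<sigma>\<^sup>\<or> \<inter> M\<close>, are the monoid
  homomorphisms \<open>S \<rightarrow> (\<complex>, \<cdot>)\<close>. The classical topology is that of pointwise convergence: it is
  induced by the evaluations at finitely many generators of \<open>S\<close>, and evaluation at any other
  element is a monomial in these.\<close>

definition affine_toric :: "(real ^ 3) set \<Rightarrow> (real ^ 3) set \<Rightarrow> (real ^ 3 \<Rightarrow> complex) topology" where
  "affine_toric N \<sigma> =
     (let S = cone_semigroup N \<sigma> in
      subtopology (product_topology (\<lambda>_. euclidean) S)
        {x. x 0 = 1 \<and> (\<forall>m\<in>S. \<forall>m'\<in>S. x (m + m') = x m * x m')})"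

definition quotient_topology :: "'a topology \<Rightarrow> ('a \<Rightarrow> 'b) \<Rightarrow> 'b topology" where
  "quotient_topology X f =
     topology (\<lambda>W. W \<subseteq> f ` topspace X \<and> openin X {x \<in> topspace X. f x \<in> W})"

lemma openin_quotient_topology:
  "openin (quotient_topology X f) W \<longleftrightarrow>
     W \<subseteq> f ` topspace X \<and> openin X {x \<in> topspace X. f x \<in> W}"
proof -
  have "istopology (\<lambda>W. W \<subseteq> f ` topspace X \<and> openin X {x \<in> topspace X. f x \<in> W})"
    unfolding istopology_def
  proof (intro conjI allI impI)
    fix S T
    assume S: "S \<subseteq> f ` topspace X \<and> openin X {x \<in> topspace X. f x \<in> S}"
      and T: "T \<subseteq> f ` topspace X \<and> openin X {x \<in> topspace X. f x \<in> T}"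
    show "S \<inter> T \<subseteq> f ` topspace X" using S by blast
    have "{x \<in> topspace X. f x \<in> S \<inter> T} = {x \<in> topspace X. f x \<in> S} \<inter> {x \<in> topspace X. f x \<in> T}"
      by blast
    then show "openin X {x \<in> topspace X. f x \<in> S \<inter> T}"
      using S T by (simp add: openin_Int)
  next
    fix K
    assume K: "\<forall>W\<in>K. W \<subseteq> f ` topspace X \<and> openin X {x \<in> topspace X. f x \<in> W}"
    show "\<Union> K \<subseteq> f ` topspace X" using K by blast
    have "{x \<in> topspace X. f x \<in> \<Union> K} = (\<Union>W\<in>K. {x \<in> topspace X. f x \<in> W})"
      by blast
    then show "openin X {x \<in> topspace X. f x \<in> \<Union> K}"
      using K by (simp only:) (rule openin_Union, blast)
  qed
  then show ?thesis
    by (simp add: quotient_topology_def)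
qed

text \<open>For cones \<open>\<sigma>\<close>, \<open>\<sigma>'\<close> of a fan, the charts \<open>U\<^sub>\<sigma>\<close> and \<open>U\<^sub>\<sigma>\<^sub>'\<close> are glued along \<open>U\<^sub>\<sigma>\<^sub>\<inter>\<^sub>\<sigma>\<^sub>'\<close>, which is
  included into them by restriction of homomorphisms.\<close>

definition toric_glue ::
    "(real ^ 3) set \<Rightarrow> (((real ^ 3) set \<times> (real ^ 3 \<Rightarrow> complex)) \<times>
                       ((real ^ 3) set \<times> (real ^ 3 \<Rightarrow> complex))) set" where
  "toric_glue N =
     {((\<sigma>, restrict z (cone_semigroup N \<sigma>)), (\<sigma>', restrict z (cone_semigroup N \<sigma>'))) | \<sigma> \<sigma>' z.
        z \<in> topspace (affine_toric N (\<sigma> \<inter> \<sigma>'))}"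

definition toric_variety ::
    "(real ^ 3) set \<Rightarrow> (real ^ 3) set set \<Rightarrow>
     ((real ^ 3) set \<times> (real ^ 3 \<Rightarrow> complex)) set topology" where
  "toric_variety N \<Sigma> =
     quotient_topology (sum_topology (affine_toric N) \<Sigma>)
       (\<lambda>p. (toric_glue N `` {p}) \<inter> (\<Sigma> \<times> UNIV))"

section \<open>Topological Euler characteristic\<close>

definition int_independent :: "('a, 'b) monoid_scheme \<Rightarrow> 'a set \<Rightarrow> bool" where
  "int_independent G S \<longleftrightarrow> finite S \<and> S \<subseteq> carrier G \<and>
     (\<forall>c :: 'a \<Rightarrow> int. finprod G (\<lambda>x. x [^]\<^bsub>G\<^esub> c x) S = \<one>\<^bsub>G\<^esub> \<longrightarrow> (\<forall>x\<in>S. c x = 0))"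

definition ab_rank :: "('a, 'b) monoid_scheme \<Rightarrow> enat" where
  "ab_rank G = (SUP S\<in>{S. int_independent G S}. enat (card S))"

definition betti :: "nat \<Rightarrow> 'a topology \<Rightarrow> enat" where
  "betti p X = ab_rank (homology_group (int p) X)"

text \<open>A relation rather than a function, so that it includes the finiteness of the Betti numbers.\<close>

definition has_euler_characteristic :: "'a topology \<Rightarrow> int \<Rightarrow> bool" where
  "has_euler_characteristic X k \<longleftrightarrow>
     (\<forall>p. betti p X \<noteq> \<infinity>) \<and> finite {p. betti p X \<noteq> 0} \<and>
     k = (\<Sum>p | betti p X \<noteq> 0. (-1) ^ p * int (the_enat (betti p X)))"

section \<open>The Fujiki-Oka resolution\<close>

definition fujiki_oka_resolution ::
    "nat \<Rightarrow> nat \<Rightarrow> nat \<Rightarrow> ((real ^ 3) set \<times> (real ^ 3 \<Rightarrow> complex)) set topology" where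
  "fujiki_oka_resolution r a2 a3 = toric_variety (N_lattice r a2 a3) (fujiki_oka_fan r a2 a3)"

end

theory Submission
  imports Defs
begin

text \<open>
  If \<open>1 + a\<^sub>2 + a\<^sub>3 = r\<close>, then every label of the subdivision process is \<open>(0, 0, 0) / 1\<close> or again of
  the form \<open>(1, a, b) / s\<close> with \<open>1 + a + b = s\<close>. Hence each inserted point has coordinate sum \<open>1\<close>,
  which makes the resolution crepant, and the number of final cones below a cone with denominator
  \<open>s\<close> satisfies \<open>f(s) = 1 + f(a) + f(b)\<close>, so that \<open>f(s) = s\<close>. Two final cones in different parts
  of a star subdivision are separated by a plane; in it, their generators are lattice points of a
  line that bound segments without further lattice points, so the cones meet in a common face.

  The Euler characteristic is additive on open sets: this follows from the long exact sequences of
  the pairs, excision and the rank-nullity formula for abelian groups. A cone of dimension \<open>k\<close> of a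
  smooth fan has the chart \<open>\<complex>\<^sup>k \<times> (\<complex>\<^sup>*)\<^sup>3\<^sup>-\<^sup>k\<close>, with Euler characteristic \<open>1\<close> for \<open>k = 3\<close> and \<open>0\<close>
  otherwise. Since the charts intersect as the cones do, the Euler characteristic of the toric
  variety is the number of its three-dimensional cones, which is \<open>r\<close>.
\<close>

section \<open>Ranks of abelian groups\<close>

text \<open>The two sides of a star subdivision are subdivided independently, so a separating plane
  by itself leaves open whether both sides cut it in the same way. Unimodularity settles this
  directly, without following the recursion inside the plane: with respect to a final cone, every
  lattice point has integer coordinates, and since all generators have height 1, a lattice point of
  height 1 on an edge can only be one of its ends. The homology groups of the spaces involved are
  not known in advance to have finite rank. Ranks therefore live in \<open>enat\<close>, and
  finiteness is part of the relation that is propagated through the exact sequences. A factor that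
  is a punctured plane annihilates the Euler characteristic for a purely combinatorial reason: two
  slit planes cover it and meet in two half planes, so the count k + k - (k + k) is 0 for every
  other factor. Charts of proper faces have such a factor and are closed under intersection, so all
  their finite unions also have Euler characteristic 0. Adding the maximal charts one at a time thus
  adds exactly 1 for each.\<close>

definition int_rank :: "('a, 'b) monoid_scheme \<Rightarrow> 'a set \<Rightarrow> enat" where
  "int_rank G S = (SUP T\<in>{T. int_independent G T \<and> T \<subseteq> S}. enat (card T))"

text \<open>Indexing admits families built from lifts, whose distinctness is not known in advance;
  independence itself forces it.\<close>

definition int_independent_family :: "('a, 'b) monoid_scheme \<Rightarrow> 'i set \<Rightarrow> ('i \<Rightarrow> 'a) \<Rightarrow> bool" where
  "int_independent_family G I x \<longleftrightarrow> finite I \<and> x \<in> I \<rightarrow> carrier G \<and>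
     (\<forall>c :: 'i \<Rightarrow> int. finprod G (\<lambda>i. x i [^]\<^bsub>G\<^esub> c i) I = \<one>\<^bsub>G\<^esub> \<longrightarrow> (\<forall>i\<in>I. c i = 0))"

text \<open>Kernels and images are measured as subsets of the ambient group, so that no subgroup
  structure has to be formed; the full rank is the case of the whole carrier.\<close>

lemma ab_rank_eq_int_rank: "ab_rank G = int_rank G (carrier G)"
proof -
  have "{S. int_independent G S} = {T. int_independent G T \<and> T \<subseteq> carrier G}"
    by (auto simp: int_independent_def)
  then show ?thesis by (simp add: ab_rank_def int_rank_def)
qed

lemma int_independentD:
  assumes "int_independent G S" "finprod G (\<lambda>x. x [^]\<^bsub>G\<^esub> (c x :: int)) S = \<one>\<^bsub>G\<^esub>" "x \<in> S"
  shows "c x = 0"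
  using assms by (auto simp: int_independent_def)

context comm_group
begin

lemma int_independent_familyD:
  assumes "int_independent_family G I x" "finprod G (\<lambda>i. x i [^] (c i :: int)) I = \<one>" "i \<in> I"
  shows "c i = 0"
  using assms by (auto simp: int_independent_family_def)

lemma int_independent_family_inj:
  assumes "int_independent_family G I x"
  shows "inj_on x I"
proof (rule inj_onI, rule ccontr)
  fix i j assume ij: "i \<in> I" "j \<in> I" "x i = x j" "i \<noteq> j"
  have fin: "finite I" and x: "\<And>k. k \<in> I \<Longrightarrow> x k \<in> carrier G"
    using assms by (auto simp: int_independent_family_def)
  define c :: "_ \<Rightarrow> int" where "c k = (if k = i then 1 else if k = j then -1 else 0)" for k
  have "finprod G (\<lambda>k. x k [^] c k) I = finprod G (\<lambda>k. x k [^] c k) {i, j}"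
    using ij x fin by (intro finprod_mono_neutral_cong_right) (auto simp: c_def)
  also have "\<dots> = x i [^] c i \<otimes> x j [^] c j"
    using ij x by (subst finprod_insert) auto
  also have "\<dots> = \<one>"
    using ij x by (simp add: c_def int_pow_neg)
  finally have "c i = 0" by (rule int_independent_familyD[OF assms]) (use ij in auto)
  then show False by (simp add: c_def)
qed

lemma int_independent_family_image:
  assumes "int_independent_family G I x"
  shows "int_independent G (x ` I)"
  unfolding int_independent_def
proof (intro conjI allI impI ballI)
  have fin: "finite I" and x: "\<And>k. k \<in> I \<Longrightarrow> x k \<in> carrier G"
    using assms by (auto simp: int_independent_family_def)
  show "finite (x ` I)" "x ` I \<subseteq> carrier G" using fin x by auto
  fix c :: "'a \<Rightarrow> int" and y
  assume "finprod G (\<lambda>y. y [^] c y) (x ` I) = \<one>" and y: "y \<in> x ` I"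
  then have "finprod G (\<lambda>i. x i [^] c (x i)) I = \<one>"
    using int_independent_family_inj[OF assms] x by (subst (asm) finprod_reindex) auto
  then show "c y = 0"
    using int_independent_familyD[OF assms, of "\<lambda>i. c (x i)"] y by auto
qed

lemma enat_card_le_int_rank:
  assumes "int_independent_family G I x" "x ` I \<subseteq> S"
  shows "enat (card I) \<le> int_rank G S"
proof -
  have "card I = card (x ` I)"
    by (simp add: card_image int_independent_family_inj[OF assms(1)])
  then show ?thesis
    unfolding int_rank_def using int_independent_family_image[OF assms(1)] assms(2)
    by (auto intro!: SUP_upper2[of "x ` I"])
qed

lemma finprod_int_pow:
  assumes "finite I" "x \<in> I \<rightarrow> carrier G"
  shows "finprod G x I [^] (e :: int) = finprod G (\<lambda>i. x i [^] e) I"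
  using assms
proof (induction I)
  case (insert i I)
  have p: "(\<lambda>i. x i [^] e) \<in> I \<rightarrow> carrier G" using insert.prems by (auto intro!: int_pow_closed)
  have q: "x \<in> I \<rightarrow> carrier G" "x i \<in> carrier G" using insert.prems by auto
  show ?case
    using insert p q by (simp add: int_pow_distrib)
qed auto

lemma finprod_int_pow_swap:
  assumes "finite J" "finite I" "x \<in> I \<rightarrow> carrier G"
  shows "finprod G (\<lambda>j. finprod G (\<lambda>i. x i [^] (a j i :: int)) I) J =
         finprod G (\<lambda>i. x i [^] (\<Sum>j\<in>J. a j i)) I"
  using assms(1)
proof (induction J)
  case empty
  then show ?case by simp
next
  case (insert j J)
  have c: "(\<lambda>i. x i [^] (c i :: int)) \<in> I \<rightarrow> carrier G" for c
    using assms(3) by (auto intro!: int_pow_closed)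
  have "finprod G (\<lambda>i. x i [^] (\<Sum>j\<in>insert j J. a j i)) I =
        finprod G (\<lambda>i. x i [^] a j i \<otimes> x i [^] (\<Sum>j\<in>J. a j i)) I"
    using assms(3) insert.hyps
    by (intro finprod_cong') (auto simp: int_pow_mult Pi_iff)
  also have "\<dots> = finprod G (\<lambda>i. x i [^] a j i) I \<otimes> finprod G (\<lambda>i. x i [^] (\<Sum>j\<in>J. a j i)) I"
    by (intro finprod_multf c)
  finally show ?case
    using insert c by simp
qed

end

lemma hom_finprod:
  assumes "comm_group G" "comm_group H" "f \<in> hom G H" "finite I" "x \<in> I \<rightarrow> carrier G"
  shows "f (finprod G x I) = finprod H (\<lambda>i. f (x i)) I"
proof -
  interpret G: comm_group G by fact
  interpret H: comm_group H by fact
  interpret group_hom G H f using assms by unfold_locales auto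
  show ?thesis using assms(4,5)
  proof (induction I)
    case (insert i I)
    then have "x \<in> I \<rightarrow> carrier G" "x i \<in> carrier G" by auto
    moreover from this have "(\<lambda>i. f (x i)) \<in> I \<rightarrow> carrier H" by (auto intro!: hom_closed)
    ultimately
    show ?case using insert by simp
  qed auto
qed

text \<open>The supremum runs over natural numbers, so a finite lower bound \<open>Suc m\<close> is
  reached by a set with more than \<open>m\<close> elements; for \<open>n = 0\<close> the empty set
  serves. The rank itself may be infinite.\<close>

lemma enat_le_int_rankD:
  assumes "enat n \<le> int_rank G S"
  obtains T where "int_independent G T" "T \<subseteq> S" "n \<le> card T"
proof (cases n)
  case 0
  have "int_independent G {}" by (simp add: int_independent_def)
  then show ?thesis using that[of "{}"] 0 by auto
next
  case (Suc m)
  then have "enat m < int_rank G S" using assms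
    by (metis enat_ord_simps(2) lessI order_less_le_trans)
  then obtain T where "int_independent G T" "T \<subseteq> S" "m < card T"
    unfolding int_rank_def less_SUP_iff by auto
  then show ?thesis using that[of T] Suc by auto
qed

text \<open>An independent set in the kernel and lifts of an independent set in the image are
  jointly independent: \<open>f\<close> kills the kernel part of a relation, so the coefficients of
  the lifts vanish, and then those of the kernel part.\<close>

lemma ab_rank_ge_kernel_plus_image:
  assumes "comm_group G" "comm_group H" and f: "f \<in> hom G H"
  shows "int_rank G (kernel G H f) + int_rank H (f ` carrier G) \<le> ab_rank G"
proof -
  interpret G: comm_group G by fact
  interpret H: comm_group H by fact
  interpret group_hom G H f using assms by unfold_locales auto
  have key: "enat (n + m) \<le> ab_rank G"
    if n: "enat n \<le> int_rank G (kernel G H f)" and m: "enat m \<le> int_rank H (f ` carrier G)" for n m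
  proof -
    obtain S where S: "int_independent G S" "S \<subseteq> kernel G H f" "n \<le> card S"
      using n by (rule enat_le_int_rankD)
    obtain T where T: "int_independent H T" "T \<subseteq> f ` carrier G" "m \<le> card T"
      using m by (rule enat_le_int_rankD)
    have fin: "finite S" "finite T" using S T by (auto simp: int_independent_def)
    have "\<forall>t\<in>T. \<exists>x. x \<in> carrier G \<and> f x = t" using T(2) by auto
    then obtain g where g: "\<And>t. t \<in> T \<Longrightarrow> g t \<in> carrier G \<and> f (g t) = t"
      using bchoice by metis
    have Sc: "S \<subseteq> carrier G" using S by (auto simp: int_independent_def)
    let ?x = "case_sum (\<lambda>x. x) g"
    have "int_independent_family G (S <+> T) ?x"
      unfolding int_independent_family_def
    proof (intro conjI allI impI)
      show "finite (S <+> T)" using fin by simp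
      show "?x \<in> S <+> T \<rightarrow> carrier G" using g Sc by auto
      fix c :: "_ \<Rightarrow> int"
      assume eq: "finprod G (\<lambda>i. ?x i [^]\<^bsub>G\<^esub> c i) (S <+> T) = \<one>\<^bsub>G\<^esub>"
      let ?A = "finprod G (\<lambda>s. s [^]\<^bsub>G\<^esub> c (Inl s)) S"
      let ?B = "finprod G (\<lambda>t. g t [^]\<^bsub>G\<^esub> c (Inr t)) T"
      have A: "(\<lambda>s. s [^]\<^bsub>G\<^esub> c (Inl s)) \<in> S \<rightarrow> carrier G" using Sc by auto
      have B: "(\<lambda>t. g t [^]\<^bsub>G\<^esub> c (Inr t)) \<in> T \<rightarrow> carrier G" using g by auto
      have cl: "(\<lambda>i. ?x i [^]\<^bsub>G\<^esub> c i) \<in> Inl ` S \<rightarrow> carrier G"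
        "(\<lambda>i. ?x i [^]\<^bsub>G\<^esub> c i) \<in> Inr ` T \<rightarrow> carrier G" using Sc g by auto
      have "finprod G (\<lambda>i. ?x i [^]\<^bsub>G\<^esub> c i) (S <+> T) = ?A \<otimes>\<^bsub>G\<^esub> ?B"
        unfolding Plus_def using fin cl
        by (subst G.finprod_Un_disjoint) (auto simp: G.finprod_reindex)
      with eq have AB: "?A \<otimes>\<^bsub>G\<^esub> ?B = \<one>\<^bsub>G\<^esub>" by simp
      have "f ?A = finprod H (\<lambda>s. f (s [^]\<^bsub>G\<^esub> c (Inl s))) S"
        by (rule hom_finprod) (use assms fin A in auto)
      also have "\<dots> = \<one>\<^bsub>H\<^esub>"
        using Sc S(2) by (intro H.finprod_one_eqI) (auto simp: kernel_def hom_int_pow)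
      finally have fA: "f ?A = \<one>\<^bsub>H\<^esub>" .
      have "f ?B = finprod H (\<lambda>t. f (g t [^]\<^bsub>G\<^esub> c (Inr t))) T"
        by (rule hom_finprod) (use assms fin B in auto)
      also have "\<dots> = finprod H (\<lambda>t. t [^]\<^bsub>H\<^esub> c (Inr t)) T"
        using g T(1) by (intro H.finprod_cong') (auto simp: hom_int_pow int_independent_def)
      finally have fB: "f ?B = finprod H (\<lambda>t. t [^]\<^bsub>H\<^esub> c (Inr t)) T" .
      have "f ?A \<otimes>\<^bsub>H\<^esub> f ?B = \<one>\<^bsub>H\<^esub>"
        using AB A B by (metis G.finprod_closed hom_mult hom_one)
      then have "f ?B = \<one>\<^bsub>H\<^esub>"
        using B fA by (simp add: G.finprod_closed)
      then have cT: "c (Inr t) = 0" if "t \<in> T" for t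
        using int_independentD[OF T(1), of "\<lambda>t. c (Inr t)" t] that unfolding fB by simp
      have "?B = \<one>\<^bsub>G\<^esub>"
        using cT by (intro G.finprod_one_eqI) auto
      then have "?A = \<one>\<^bsub>G\<^esub>"
        using AB A by (simp add: G.finprod_closed)
      then have cS: "c (Inl s) = 0" if "s \<in> S" for s
        using int_independentD[OF S(1), of "\<lambda>s. c (Inl s)" s] that by simp
      show "\<forall>i\<in>S <+> T. c i = 0" using cS cT by auto
    qed
    then have "enat (card (S <+> T)) \<le> ab_rank G"
      unfolding ab_rank_eq_int_rank
      by (rule G.enat_card_le_int_rank) (use Sc g in auto)
    then show ?thesis
      using S(3) T(3) fin by (simp add: card_Plus) (meson add_mono enat_ord_simps(1) order_trans)
  qed
  \<comment> \<open>A finite rank of \<open>G\<close> bounds both summands, so they are natural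
    numbers and \<open>key\<close> applies to their exact values; an infinite rank leaves nothing to
    show.\<close>
  show ?thesis
  proof (cases "ab_rank G")
    case (enat R)
    have "\<exists>n. a = enat n" if "\<And>n. enat n \<le> a \<Longrightarrow> n \<le> R" for a
      using that[of "Suc R"] by (cases a) auto
    moreover have "n \<le> R" if "enat n \<le> int_rank G (kernel G H f)" for n
      using key[of n 0] that enat by (simp add: zero_enat_def[symmetric])
    moreover have "n \<le> R" if "enat n \<le> int_rank H (f ` carrier G)" for n
      using key[of 0 n] that enat by (simp add: zero_enat_def[symmetric])
    ultimately obtain n m where "int_rank G (kernel G H f) = enat n"
      "int_rank H (f ` carrier G) = enat m" by meson
    then show ?thesis using key[of n m] by simp
  qed simp
qed

text \<open>Inside an independent set \<open>W\<close>, choose \<open>A\<close> maximal with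
  independent images. Each \<open>w\<close> outside \<open>A\<close> then satisfies a relation in
  \<open>H\<close> together with \<open>A\<close>, and the same exponents in \<open>G\<close> give
  an element of the kernel. So \<open>card W\<close> splits into a kernel part and an image
  part.\<close>

lemma ab_rank_le_kernel_plus_image:
  assumes "comm_group G" "comm_group H" and f: "f \<in> hom G H"
  shows "ab_rank G \<le> int_rank G (kernel G H f) + int_rank H (f ` carrier G)"
  unfolding ab_rank_def
proof (rule SUP_least)
  interpret G: comm_group G by fact
  interpret H: comm_group H by fact
  interpret group_hom G H f using assms by unfold_locales auto
  fix W assume "W \<in> {S. int_independent G S}"
  then have W: "int_independent G W" by simp
  then have fin: "finite W" and Wc: "W \<subseteq> carrier G" by (auto simp: int_independent_def)
  define P where "P = (\<lambda>A. A \<subseteq> W \<and> int_independent_family H A f)"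
  have "P {}" by (simp add: P_def int_independent_family_def)
  moreover have "\<forall>A. P A \<longrightarrow> card A < Suc (card W)"
    using fin by (auto simp: P_def card_mono less_Suc_eq_le)
  ultimately have "\<exists>A. P A \<and> (\<forall>B. P B \<longrightarrow> card B \<le> card A)"
    by (rule ex_has_greatest_nat)
  then obtain A where A: "P A" and max: "\<And>B. P B \<Longrightarrow> card B \<le> card A"
    by (elim exE conjE) simp
  have AW: "A \<subseteq> W" and Af: "int_independent_family H A f" using A by (auto simp: P_def)
  have finA: "finite A" using AW fin finite_subset by blast
  have "\<exists>c :: 'a \<Rightarrow> int. finprod H (\<lambda>x. f x [^]\<^bsub>H\<^esub> c x) W = \<one>\<^bsub>H\<^esub> \<and> c w \<noteq> 0 \<and>
          (\<forall>x\<in>W - A. x \<noteq> w \<longrightarrow> c x = 0)" if w: "w \<in> W - A" for w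
  proof -
    have "card (insert w A) > card A" using w finA by simp
    then have "\<not> P (insert w A)" using max by (meson not_less)
    then have "\<not> int_independent_family H (insert w A) f" using w AW by (auto simp: P_def)
    moreover have "f \<in> insert w A \<rightarrow> carrier H" using w AW Wc by auto
    ultimately obtain c :: "'a \<Rightarrow> int" where
      c: "finprod H (\<lambda>x. f x [^]\<^bsub>H\<^esub> c x) (insert w A) = \<one>\<^bsub>H\<^esub>" "\<exists>x\<in>insert w A. c x \<noteq> 0"
      using finA unfolding int_independent_family_def by auto
    \<comment> \<open>A relation without \<open>w\<close> would be one among the images of
      \<open>A\<close>, which are independent.\<close>
    have cw: "c w \<noteq> 0"
    proof
      assume cw: "c w = 0"
      have "(\<lambda>x. f x [^]\<^bsub>H\<^esub> c x) \<in> A \<rightarrow> carrier H" using AW Wc by auto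
      then have "finprod H (\<lambda>x. f x [^]\<^bsub>H\<^esub> c x) A = \<one>\<^bsub>H\<^esub>"
        using c(1) w finA Wc cw by simp
      then have "\<forall>x\<in>A. c x = 0" using Af by (simp add: int_independent_family_def)
      then show False using c(2) cw by auto
    qed
    define c' where "c' x = (if x \<in> insert w A then c x else 0)" for x
    have "finprod H (\<lambda>x. f x [^]\<^bsub>H\<^esub> c' x) W = finprod H (\<lambda>x. f x [^]\<^bsub>H\<^esub> c x) (insert w A)"
      using w AW Wc fin by (intro H.finprod_mono_neutral_cong_right) (auto simp: c'_def)
    then show ?thesis using c(1) cw w by (intro exI[of _ c']) (auto simp: c'_def)
  qed
  then have "\<forall>w\<in>W - A. \<exists>c :: 'a \<Rightarrow> int. finprod H (\<lambda>x. f x [^]\<^bsub>H\<^esub> c x) W = \<one>\<^bsub>H\<^esub> \<and> c w \<noteq> 0 \<and>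
          (\<forall>x\<in>W - A. x \<noteq> w \<longrightarrow> c x = 0)"
    by (rule ballI)
  then obtain c :: "'a \<Rightarrow> 'a \<Rightarrow> int" where
    c': "\<forall>w\<in>W - A. finprod H (\<lambda>x. f x [^]\<^bsub>H\<^esub> c w x) W = \<one>\<^bsub>H\<^esub> \<and> c w w \<noteq> 0 \<and>
          (\<forall>x\<in>W - A. x \<noteq> w \<longrightarrow> c w x = 0)"
    by (elim bchoice[THEN exE])
  then have c: "\<And>w. w \<in> W - A \<Longrightarrow> finprod H (\<lambda>x. f x [^]\<^bsub>H\<^esub> c w x) W = \<one>\<^bsub>H\<^esub>"
       "\<And>w. w \<in> W - A \<Longrightarrow> c w w \<noteq> 0"
       "\<And>w x. w \<in> W - A \<Longrightarrow> x \<in> W - A \<Longrightarrow> x \<noteq> w \<Longrightarrow> c w x = 0"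
    by simp_all
  define y where "y w = finprod G (\<lambda>x. x [^]\<^bsub>G\<^esub> c w x) W" for w
  have cl: "(\<lambda>x. x [^]\<^bsub>G\<^esub> (e x :: int)) \<in> W \<rightarrow> carrier G" for e using Wc by auto
  have yc: "y w \<in> carrier G" for w unfolding y_def using cl by (rule G.finprod_closed)
  have yk: "y w \<in> kernel G H f" if "w \<in> W - A" for w
  proof -
    have "f (y w) = finprod H (\<lambda>x. f (x [^]\<^bsub>G\<^esub> c w x)) W"
      unfolding y_def by (rule hom_finprod) (use assms fin cl in auto)
    also have "\<dots> = finprod H (\<lambda>x. f x [^]\<^bsub>H\<^esub> c w x) W"
      using Wc by (intro H.finprod_cong') (auto simp: hom_int_pow)
    also have "\<dots> = \<one>\<^bsub>H\<^esub>" using c(1) that by simp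
    finally show ?thesis using yc by (simp add: kernel_def)
  qed
  have "int_independent_family G (W - A) y"
    unfolding int_independent_family_def
  proof (intro conjI allI impI ballI)
    show "finite (W - A)" using fin by simp
    show "y \<in> W - A \<rightarrow> carrier G" using yc by auto
    fix e :: "'a \<Rightarrow> int" and w
    assume e: "finprod G (\<lambda>i. y i [^]\<^bsub>G\<^esub> e i) (W - A) = \<one>\<^bsub>G\<^esub>" and w: "w \<in> W - A"
    have "finprod G (\<lambda>i. y i [^]\<^bsub>G\<^esub> e i) (W - A) =
          finprod G (\<lambda>i. finprod G (\<lambda>x. x [^]\<^bsub>G\<^esub> (c i x * e i)) W) (W - A)"
    proof (rule G.finprod_cong')
      fix i assume "i \<in> W - A"
      have "y i [^]\<^bsub>G\<^esub> e i = finprod G (\<lambda>x. (x [^]\<^bsub>G\<^esub> c i x) [^]\<^bsub>G\<^esub> e i) W"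
        unfolding y_def by (rule G.finprod_int_pow) (use fin cl in auto)
      also have "\<dots> = finprod G (\<lambda>x. x [^]\<^bsub>G\<^esub> (c i x * e i)) W"
        using Wc by (intro G.finprod_cong') (auto simp: G.int_pow_pow)
      finally show "y i [^]\<^bsub>G\<^esub> e i = finprod G (\<lambda>x. x [^]\<^bsub>G\<^esub> (c i x * e i)) W" .
    qed (use cl in \<open>auto intro!: G.finprod_closed\<close>)
    also have "\<dots> = finprod G (\<lambda>x. x [^]\<^bsub>G\<^esub> (\<Sum>i\<in>W - A. c i x * e i)) W"
      by (rule G.finprod_int_pow_swap) (use fin Wc in auto)
    finally have "(\<Sum>i\<in>W - A. c i w * e i) = 0"
      using int_independentD[OF W, of "\<lambda>x. \<Sum>i\<in>W - A. c i x * e i" w] w e by simp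
    \<comment> \<open>On \<open>W - A\<close> the exponents \<open>c\<close> form a diagonal matrix
      with nonzero diagonal, so only \<open>i = w\<close> remains.\<close>
    also have "(\<Sum>i\<in>W - A. c i w * e i) = (\<Sum>i\<in>{w}. c i w * e i)"
      using w fin c(3) by (intro sum.mono_neutral_right) auto
    finally show "e w = 0" using c(2)[OF w] by simp
  qed
  then have 1: "enat (card (W - A)) \<le> int_rank G (kernel G H f)"
    using yk by (intro G.enat_card_le_int_rank) auto
  have 2: "enat (card A) \<le> int_rank H (f ` carrier G)"
    using Af AW Wc by (intro H.enat_card_le_int_rank) auto
  have "card W = card (W - A) + card A"
    using AW fin finA by (simp add: card_Diff_subset card_mono)
  then have "enat (card W) = enat (card (W - A)) + enat (card A)" by simp
  then show "enat (card W) \<le> int_rank G (kernel G H f) + int_rank H (f ` carrier G)"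
    using add_mono[OF 1 2] by metis
qed

lemma ab_rank_eq_kernel_plus_image:
  assumes "comm_group G" "comm_group H" "f \<in> hom G H"
  shows "ab_rank G = int_rank G (kernel G H f) + int_rank H (f ` carrier G)"
  using ab_rank_ge_kernel_plus_image[OF assms] ab_rank_le_kernel_plus_image[OF assms]
  by (rule antisym[rotated])

lemma int_rank_one:
  assumes "comm_group G"
  shows "int_rank G {\<one>\<^bsub>G\<^esub>} = 0"
proof -
  interpret comm_group G by fact
  have "T = {}" if "int_independent G T" "T \<subseteq> {\<one>\<^bsub>G\<^esub>}" for T
  proof (rule ccontr)
    assume "T \<noteq> {}"
    then have "T = {\<one>\<^bsub>G\<^esub>}" using that by auto
    moreover have "finprod G (\<lambda>x. x [^]\<^bsub>G\<^esub> (1::int)) {\<one>\<^bsub>G\<^esub>} = \<one>\<^bsub>G\<^esub>" by simp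
    ultimately show False
      using int_independentD[OF that(1), of "\<lambda>_. 1" "\<one>\<^bsub>G\<^esub>"] by simp
  qed
  then have "int_rank G {\<one>\<^bsub>G\<^esub>} \<le> 0"
    unfolding int_rank_def
  proof (intro SUP_least)
    fix T assume "T \<in> {T. int_independent G T \<and> T \<subseteq> {\<one>\<^bsub>G\<^esub>}}"
    then have "T = {}" using \<open>\<And>T. int_independent G T \<Longrightarrow> T \<subseteq> {\<one>\<^bsub>G\<^esub>} \<Longrightarrow> T = {}\<close> by simp
    then show "enat (card T) \<le> 0" by (simp add: zero_enat_def)
  qed
  then show ?thesis by simp
qed

lemma ab_rank_trivial_group:
  assumes "comm_group G" "trivial_group G"
  shows "ab_rank G = 0"
  using assms int_rank_one[of G] by (simp add: ab_rank_eq_int_rank trivial_group_def)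

lemma ab_rank_iso:
  assumes "comm_group G" "comm_group H" "f \<in> iso G H"
  shows "ab_rank G = ab_rank H"
proof -
  interpret G: comm_group G by fact
  interpret H: comm_group H by fact
  have f: "f \<in> hom G H" "f ` carrier G = carrier H" "inj_on f (carrier G)"
    using assms(3) by (auto simp: iso_def bij_betw_def)
  interpret group_hom G H f using f by unfold_locales auto
  have "kernel G H f = {\<one>\<^bsub>G\<^esub>}"
    using f(3) inj_iff_trivial_ker by blast
  then show ?thesis
    using ab_rank_eq_kernel_plus_image[OF assms(1,2) f(1)] f(2) int_rank_one[OF assms(1)]
    by (simp add: ab_rank_eq_int_rank)
qed

lemma ab_rank_is_iso:
  assumes "comm_group G" "comm_group H" "G \<cong> H"
  shows "ab_rank G = ab_rank H"
  using assms ab_rank_iso unfolding is_iso_def by blast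

lemma ab_rank_integer_group: "ab_rank integer_group = 1"
proof -
  interpret comm_group integer_group by (rule abelian_integer_group)
  have "card T \<le> 1" if T: "int_independent integer_group T" for T
  proof (rule ccontr)
    assume "\<not> card T \<le> 1"
    moreover have fin: "finite T" using T by (auto simp: int_independent_def)
    ultimately obtain a b where ab: "a \<in> T" "b \<in> T" "a \<noteq> b"
      by (auto simp: card_le_Suc0_iff_eq)
    have rel: "c a = 0 \<and> c b = 0" if "c a * a + c b * b = 0" "\<And>x. x \<noteq> a \<Longrightarrow> x \<noteq> b \<Longrightarrow> c x = 0" for c
    proof -
      have "finprod integer_group (\<lambda>x. x [^]\<^bsub>integer_group\<^esub> c x) T =
            finprod integer_group (\<lambda>x. x [^]\<^bsub>integer_group\<^esub> c x) {a, b}"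
        using ab fin that by (intro finprod_mono_neutral_cong_right) auto
      also have "\<dots> = c a * a + c b * b"
        using ab by (subst finprod_insert) auto
      also have "\<dots> = \<one>\<^bsub>integer_group\<^esub>" using that by simp
      finally show ?thesis using int_independentD[OF T, of c] ab by blast
    qed
    \<comment> \<open>The relation b * a - a * b = 0 forces \<open>b = 0\<close>, after which the
      coefficient 1 at \<open>b\<close> gives a nontrivial relation.\<close>
    have "b = 0" using rel[of "\<lambda>x. if x = a then b else if x = b then -a else 0"] ab by auto
    then show False using rel[of "\<lambda>x. if x = b then 1 else 0"] ab by auto
  qed
  then have "ab_rank integer_group \<le> 1"
    unfolding ab_rank_def by (intro SUP_least) (auto simp: one_enat_def)
  moreover have "int_independent_family integer_group {()} (\<lambda>_. 1)"
    unfolding int_independent_family_def by auto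
  then have "enat (card {()}) \<le> ab_rank integer_group"
    unfolding ab_rank_eq_int_rank by (rule enat_card_le_int_rank) auto
  ultimately show ?thesis by (simp add: one_enat_def)
qed

section \<open>Additivity of the Euler characteristic\<close>

text \<open>The arithmetic of \<open>has_euler_characteristic\<close> detached from the space, so
  that it applies to relative homology as well.\<close>

definition finite_alternating_sum :: "(nat \<Rightarrow> enat) \<Rightarrow> int \<Rightarrow> bool" where
  "finite_alternating_sum b k \<longleftrightarrow>
     (\<forall>p. b p \<noteq> \<infinity>) \<and> finite {p. b p \<noteq> 0} \<and> k = (\<Sum>p | b p \<noteq> 0. (-1) ^ p * int (the_enat (b p)))"

lemma has_euler_characteristic_iff:
  "has_euler_characteristic X k \<longleftrightarrow> finite_alternating_sum (\<lambda>p. ab_rank (homology_group (int p) X)) k"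
  by (simp add: has_euler_characteristic_def finite_alternating_sum_def betti_def)

lemma finite_alternating_sum_iff:
  "finite_alternating_sum b k \<longleftrightarrow>
     (\<exists>n B. (\<forall>p. b p = enat (n p)) \<and> (\<forall>p\<ge>B. n p = 0) \<and> k = (\<Sum>p<B. (-1) ^ p * int (n p)))"
proof
  assume b: "finite_alternating_sum b k"
  define n where "n p = the_enat (b p)" for p
  have bn: "b p = enat (n p)" for p 
  proof -
    have "b p \<noteq> \<infinity>" using b by (simp add: finite_alternating_sum_def del: not_infinity_eq)
    then show ?thesis by (auto simp: n_def)
  qed
  have fin: "finite {p. b p \<noteq> 0}" using b by (auto simp: finite_alternating_sum_def)
  then obtain B where B: "\<And>p. b p \<noteq> 0 \<Longrightarrow> p < B"
    using finite_nat_bounded[OF fin] by auto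
  have nB: "\<forall>p\<ge>B. n p = 0" using B bn by (metis enat_0_iff(1) not_less)
  have "k = (\<Sum>p | b p \<noteq> 0. (-1) ^ p * int (n p))" using b by (simp add: finite_alternating_sum_def n_def)
  also have "\<dots> = (\<Sum>p<B. (-1) ^ p * int (n p))"
    using B bn by (intro sum.mono_neutral_left) (auto simp: enat_0_iff)
  finally show "\<exists>n B. (\<forall>p. b p = enat (n p)) \<and> (\<forall>p\<ge>B. n p = 0) \<and> k = (\<Sum>p<B. (-1) ^ p * int (n p))"
    using bn nB by blast
next
  assume "\<exists>n B. (\<forall>p. b p = enat (n p)) \<and> (\<forall>p\<ge>B. n p = 0) \<and> k = (\<Sum>p<B. (-1) ^ p * int (n p))"
  then obtain n B where bn: "\<And>p. b p = enat (n p)" and nB: "\<And>p. p \<ge> B \<Longrightarrow> n p = 0"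
    and k: "k = (\<Sum>p<B. (-1) ^ p * int (n p))" by auto
  have sub: "{p. b p \<noteq> 0} \<subseteq> {..<B}"
  proof
    fix p assume "p \<in> {p. b p \<noteq> 0}"
    then have "n p \<noteq> 0" using bn[of p] by (simp add: enat_0_iff)
    then show "p \<in> {..<B}" using nB[of p] by (meson lessThan_iff not_le)
  qed
  have "(\<Sum>p | b p \<noteq> 0. (-1) ^ p * int (the_enat (b p))) = (\<Sum>p<B. (-1) ^ p * int (n p))"
    using sub bn by (intro sum.mono_neutral_cong_left) (auto simp: enat_0_iff)
  then show "finite_alternating_sum b k"
    using bn k sub finite_subset[OF sub] by (auto simp: finite_alternating_sum_def)
qed

lemma alternating_sum_telescope:
  fixes g :: "nat \<Rightarrow> int"
  shows "(\<Sum>p<B. (-1) ^ p * (g p + g (Suc p))) = g 0 - (-1) ^ B * g B"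
  by (induction B) (auto simp: algebra_simps)

text \<open>Rank bookkeeping for the long exact sequence of a pair: \<open>a\<close>,
  \<open>x\<close>, \<open>r\<close> are the ranks for subspace, space and pair, and \<alpha>,
  \<beta>, \<gamma> are those of the images of the maps induced by the two inclusions and of the
  boundary map. Exactness makes each kernel the preceding image; the boundary map from degree 0 has
  a trivial target.\<close>

locale long_exact_ranks =
  fixes a x r \<alpha> \<beta> \<gamma> :: "nat \<Rightarrow> enat"
  assumes a: "a p = \<alpha> p + \<gamma> (Suc p)" and x: "x p = \<alpha> p + \<beta> p" and r: "r p = \<beta> p + \<gamma> p"
    and \<gamma>0: "\<gamma> 0 = 0"
begin

lemma finite_alternating_sum_of_images:
  assumes "\<And>p. \<alpha> p \<noteq> \<infinity>" "\<And>p. \<beta> p \<noteq> \<infinity>" "\<And>p. \<gamma> p \<noteq> \<infinity>"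
    and "\<And>p. p \<ge> B \<Longrightarrow> \<alpha> p = 0 \<and> \<beta> p = 0 \<and> \<gamma> p = 0"
  shows "\<exists>i j. finite_alternating_sum a i \<and> finite_alternating_sum r j \<and> finite_alternating_sum x (i + j)"
proof -
  define \<alpha>' \<beta>' \<gamma>' where "\<alpha>' p = the_enat (\<alpha> p)" and "\<beta>' p = the_enat (\<beta> p)"
    and "\<gamma>' p = the_enat (\<gamma> p)" for p
  have e: "\<alpha> p = enat (\<alpha>' p)" "\<beta> p = enat (\<beta>' p)" "\<gamma> p = enat (\<gamma>' p)" for p
    using assms(1-3)[of p] by (auto simp: \<alpha>'_def \<beta>'_def \<gamma>'_def)
  have z: "\<alpha>' p = 0 \<and> \<beta>' p = 0 \<and> \<gamma>' p = 0" if "p \<ge> B" for p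
    using assms(4)[OF that] e by (simp add: enat_0_iff)
  have g0: "\<gamma>' 0 = 0" using \<gamma>0 e by (simp add: enat_0_iff)
  define i where "i = (\<Sum>p<B. (-1) ^ p * int (\<alpha>' p + \<gamma>' (Suc p)))"
  define j where "j = (\<Sum>p<B. (-1) ^ p * int (\<beta>' p + \<gamma>' p))"
  have 1: "finite_alternating_sum a i"
    unfolding finite_alternating_sum_iff i_def
    by (intro exI[of _ "\<lambda>p. \<alpha>' p + \<gamma>' (Suc p)"] exI[of _ B]) (use z a e in auto)
  have 2: "finite_alternating_sum r j"
    unfolding finite_alternating_sum_iff j_def
    by (intro exI[of _ "\<lambda>p. \<beta>' p + \<gamma>' p"] exI[of _ B]) (use z r e in auto)
  \<comment> \<open>\<gamma> enters \<open>a\<close> shifted by one degree and \<open>r\<close>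
    unshifted, so its contributions cancel in the alternating sum.\<close>
  have "(\<Sum>p<B. (-1) ^ p * (int (\<gamma>' p) + int (\<gamma>' (Suc p)))) = 0"
    using alternating_sum_telescope[of "\<lambda>p. int (\<gamma>' p)" B] g0 z[of B] by simp
  then have "i + j = (\<Sum>p<B. (-1) ^ p * int (\<alpha>' p + \<beta>' p))"
    unfolding i_def j_def sum.distrib[symmetric]
    by (simp add: algebra_simps sum.distrib)
  then have 3: "finite_alternating_sum x (i + j)"
    unfolding finite_alternating_sum_iff
    by (intro exI[of _ "\<lambda>p. \<alpha>' p + \<beta>' p"] exI[of _ B]) (use z x e in auto)
  show ?thesis using 1 2 3 by blast
qed

end

lemma finite_alternating_sum_unique:
  "finite_alternating_sum b k \<Longrightarrow> finite_alternating_sum b l \<Longrightarrow> k = l"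
  by (simp add: finite_alternating_sum_def)

lemma finite_alternating_sum_bound:
  assumes "finite_alternating_sum b k"
  obtains B where "\<And>p. p \<ge> B \<Longrightarrow> b p = 0"
proof -
  obtain n B where "\<forall>p. b p = enat (n p)" "\<forall>p\<ge>B. n p = 0"
    using assms unfolding finite_alternating_sum_iff by blast
  then show thesis using that[of B] by (simp add: zero_enat_def)
qed

lemma finite_alternating_sum_not_infinity:
  "finite_alternating_sum b k \<Longrightarrow> b p \<noteq> \<infinity>"
  by (simp add: finite_alternating_sum_def)

context long_exact_ranks
begin

lemma third_from_sub_and_whole:
  assumes "finite_alternating_sum a i" "finite_alternating_sum x k"
  shows "finite_alternating_sum r (k - i)"
proof -
  obtain B1 where B1: "\<And>p. p \<ge> B1 \<Longrightarrow> a p = 0" using assms(1) by (rule finite_alternating_sum_bound) blast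
  obtain B2 where B2: "\<And>p. p \<ge> B2 \<Longrightarrow> x p = 0" using assms(2) by (rule finite_alternating_sum_bound) blast
  have fa: "a p \<noteq> \<infinity>" "x p \<noteq> \<infinity>" for p using assms finite_alternating_sum_not_infinity by metis+
  have fin: "\<alpha> p \<noteq> \<infinity>" "\<beta> p \<noteq> \<infinity>" for p using fa[of p] unfolding x[of p] plus_eq_infty_iff_enat by simp_all
  \<comment> \<open>In degree \<open>p\<close>, \<gamma> is a summand of \<open>a\<close> in degree
    \<open>p - 1\<close>; this shift is also the reason for the \<open>Suc\<close> in the bound
    below.\<close>
  have fin': "\<gamma> p \<noteq> \<infinity>" for p using fa(1)[of "p - 1"] \<gamma>0 unfolding a[of "p - 1"] plus_eq_infty_iff_enat by (cases p) simp_all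
  have "\<alpha> p = 0 \<and> \<beta> p = 0 \<and> \<gamma> p = 0" if p: "p \<ge> Suc (max B1 B2)" for p
    using B2[of p] B1[of "p - 1"] a[of "p - 1"] x[of p] p by (cases p) auto
  then obtain i' j where s: "finite_alternating_sum a i'" "finite_alternating_sum r j" "finite_alternating_sum x (i' + j)"
    using finite_alternating_sum_of_images[OF fin fin'] by blast
  have "i' = i" "i' + j = k"
    using finite_alternating_sum_unique[OF s(1) assms(1)] finite_alternating_sum_unique[OF s(3) assms(2)] by auto
  then have "k - i = j" by simp
  then show ?thesis using s(2) by (simp only:)
qed

lemma whole_from_sub_and_third:
  assumes "finite_alternating_sum a i" "finite_alternating_sum r j"
  shows "finite_alternating_sum x (i + j)"
proof -
  obtain B1 where B1: "\<And>p. p \<ge> B1 \<Longrightarrow> a p = 0" using assms(1) by (rule finite_alternating_sum_bound) blast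
  obtain B2 where B2: "\<And>p. p \<ge> B2 \<Longrightarrow> r p = 0" using assms(2) by (rule finite_alternating_sum_bound) blast
  have fa: "a p \<noteq> \<infinity>" "r p \<noteq> \<infinity>" for p using assms finite_alternating_sum_not_infinity by metis+
  have fin: "\<alpha> p \<noteq> \<infinity>" "\<beta> p \<noteq> \<infinity>" "\<gamma> p \<noteq> \<infinity>" for p using fa[of p] unfolding a[of p] r[of p] plus_eq_infty_iff_enat by simp_all
  have "\<alpha> p = 0 \<and> \<beta> p = 0 \<and> \<gamma> p = 0" if p: "p \<ge> max B1 B2" for p
    using B2[of p] B1[of p] a[of p] r[of p] p by auto
  then obtain i' j' where s: "finite_alternating_sum a i'" "finite_alternating_sum r j'" "finite_alternating_sum x (i' + j')"
    using finite_alternating_sum_of_images[OF fin] by blast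
  have "i' = i" "j' = j"
    using finite_alternating_sum_unique[OF s(1) assms(1)] finite_alternating_sum_unique[OF s(2) assms(2)] by auto
  then show ?thesis using s(3) by (simp only:)
qed

end

lemma long_exact_ranks_pair:
  "long_exact_ranks (\<lambda>p. ab_rank (homology_group (int p) (subtopology X S)))
     (\<lambda>p. ab_rank (homology_group (int p) X))
     (\<lambda>p. ab_rank (relative_homology_group (int p) X S))
     (\<lambda>p. int_rank (homology_group (int p) X)
        (hom_induced (int p) (subtopology X S) {} X {} id ` carrier (homology_group (int p) (subtopology X S))))
     (\<lambda>p. int_rank (relative_homology_group (int p) X S)
        (hom_induced (int p) X {} X S id ` carrier (homology_group (int p) X)))
     (\<lambda>p. int_rank (homology_group (int p - 1) (subtopology X S))
        (hom_boundary (int p) X S ` carrier (relative_homology_group (int p) X S)))"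
proof
  fix p
  note ex = homology_exactness_axiom_1[of "int p" X S] homology_exactness_axiom_2[of "int (Suc p)" X S]
    homology_exactness_axiom_3[of "int p" X S]
  let ?A = "homology_group (int p) (subtopology X S)"
  let ?X = "homology_group (int p) X"
  let ?R = "relative_homology_group (int p) X S"
  let ?f = "hom_induced (int p) (subtopology X S) {} X {} id"
  let ?g = "hom_induced (int p) X {} X S id"
  let ?h = "hom_boundary (int p) X S"
  have f: "?f \<in> hom ?A ?X" and g: "?g \<in> hom ?X ?R" and h: "?h \<in> hom ?R (homology_group (int p - 1) (subtopology X S))"
    by (auto simp: hom_induced_hom hom_boundary_hom)
  have "kernel ?A ?X ?f = hom_boundary (int (Suc p)) X S ` carrier (relative_homology_group (int (Suc p)) X S)"
    using ex(2) by simp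
  then show "ab_rank ?A = int_rank ?X (?f ` carrier ?A) +
      int_rank (homology_group (int (Suc p) - 1) (subtopology X S))
        (hom_boundary (int (Suc p)) X S ` carrier (relative_homology_group (int (Suc p)) X S))"
    using ab_rank_eq_kernel_plus_image[OF abelian_relative_homology_group abelian_relative_homology_group f]
    by (simp add: add.commute)
  have "kernel ?X ?R ?g = ?f ` carrier ?A" using ex(3) by simp
  then show "ab_rank ?X = int_rank ?X (?f ` carrier ?A) + int_rank ?R (?g ` carrier ?X)"
    using ab_rank_eq_kernel_plus_image[OF abelian_relative_homology_group abelian_relative_homology_group g] by simp
  have "kernel ?R (homology_group (int p - 1) (subtopology X S)) ?h = ?g ` carrier ?X" using ex(1) by simp
  then show "ab_rank ?R = int_rank ?R (?g ` carrier ?X) +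
      int_rank (homology_group (int p - 1) (subtopology X S)) (?h ` carrier ?R)"
    using ab_rank_eq_kernel_plus_image[OF abelian_relative_homology_group abelian_relative_homology_group h] by simp
next
  let ?B = "homology_group (int 0 - 1) (subtopology X S)"
  let ?h = "hom_boundary (int 0) X S"
  let ?R = "relative_homology_group (int 0) X S"
  have t: "carrier ?B = {\<one>\<^bsub>?B\<^esub>}" using trivial_homology_group[of "int 0 - 1" "subtopology X S"]
    by (simp add: trivial_group_def)
  have "?h \<in> hom ?R ?B" by (rule hom_boundary_hom)
  moreover have "carrier ?R \<noteq> {}" 
    using group.is_monoid[OF group_relative_homology_group, THEN monoid.one_closed] by blast
  ultimately have "?h ` carrier ?R = {\<one>\<^bsub>?B\<^esub>}" using t by (auto simp: hom_def Pi_iff)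
  then show "int_rank ?B (?h ` carrier ?R) = 0"
    using int_rank_one[of ?B] by simp
qed

text \<open>The complement of \<open>B\<close> is closed and contained in the open set
  \<open>A\<close>, so it can be excised.\<close>

lemma excision_open_iso:
  assumes "openin X A" "openin X B" "A \<union> B = topspace X"
  shows "hom_induced p (subtopology X B) (A \<inter> B) X A id
    \<in> iso (relative_homology_group p (subtopology X B) (A \<inter> B)) (relative_homology_group p X A)"
proof -
  have sub: "A \<subseteq> topspace X" "B \<subseteq> topspace X" using assms openin_subset by auto
  have "closedin X (topspace X - B)" using assms(2) by blast
  then have "X closure_of (topspace X - B) \<subseteq> X interior_of A"
    using assms sub by (auto simp: closure_of_closedin interior_of_openin)
  from homology_excision_axiom[OF this sub(1), of p]
  have "hom_induced p (subtopology X (topspace X - (topspace X - B))) (A - (topspace X - B)) (subtopology X (topspace X)) A id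
    \<in> iso (relative_homology_group p (subtopology X (topspace X - (topspace X - B))) (A - (topspace X - B)))
      (relative_homology_group p (subtopology X (topspace X)) A)" .
  moreover have "topspace X - (topspace X - B) = B" "A - (topspace X - B) = A \<inter> B" using sub by auto
  ultimately show ?thesis by simp
qed

text \<open>By excision the pair of \<open>X\<close> and \<open>A\<close> contributes the same as
  the pair of \<open>B\<close> and \<open>A \<inter> B\<close>, namely \<open>b - c\<close>, and
  \<open>A\<close> contributes \<open>a\<close>.\<close>

lemma has_euler_characteristic_union_topspace:
  assumes "openin X A" "openin X B" "A \<union> B = topspace X"
    and A: "has_euler_characteristic (subtopology X A) a"
    and B: "has_euler_characteristic (subtopology X B) b"
    and AB: "has_euler_characteristic (subtopology X (A \<inter> B)) c"
  shows "has_euler_characteristic X (a + b - c)"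
proof -
  have s: "subtopology (subtopology X B) (A \<inter> B) = subtopology X (A \<inter> B)"
    by (simp add: subtopology_subtopology inf.absorb2)
  have "finite_alternating_sum (\<lambda>p. ab_rank (relative_homology_group (int p) (subtopology X B) (A \<inter> B))) (b - c)"
    using long_exact_ranks.third_from_sub_and_whole[OF long_exact_ranks_pair[of "subtopology X B" "A \<inter> B"]] B AB
    unfolding s has_euler_characteristic_iff by blast
  moreover have "ab_rank (relative_homology_group p (subtopology X B) (A \<inter> B)) = ab_rank (relative_homology_group p X A)" for p
    by (rule ab_rank_iso[OF abelian_relative_homology_group abelian_relative_homology_group
          excision_open_iso[OF assms(1-3)]])
  ultimately have "finite_alternating_sum (\<lambda>p. ab_rank (relative_homology_group (int p) X A)) (b - c)" by simp
  then have "finite_alternating_sum (\<lambda>p. ab_rank (homology_group (int p) X)) (a + (b - c))"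
    using long_exact_ranks.whole_from_sub_and_third[OF long_exact_ranks_pair[of X A]] A
    unfolding has_euler_characteristic_iff by blast
  then show ?thesis by (simp add: has_euler_characteristic_iff algebra_simps)
qed

lemma has_euler_characteristic_union:
  assumes "openin X A" "openin X B"
    and A: "has_euler_characteristic (subtopology X A) a"
    and B: "has_euler_characteristic (subtopology X B) b"
    and AB: "has_euler_characteristic (subtopology X (A \<inter> B)) c"
  shows "has_euler_characteristic (subtopology X (A \<union> B)) (a + b - c)"
proof (rule has_euler_characteristic_union_topspace[of _ A B])
  have "A \<union> B \<subseteq> topspace X" using assms openin_subset by blast
  then show "A \<union> B = topspace (subtopology X (A \<union> B))" by auto
  show "openin (subtopology X (A \<union> B)) A" "openin (subtopology X (A \<union> B)) B"
    using assms by (auto intro!: openin_subset_topspace_eq simp: openin_subtopology)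
  show "has_euler_characteristic (subtopology (subtopology X (A \<union> B)) A) a"
    "has_euler_characteristic (subtopology (subtopology X (A \<union> B)) B) b"
    "has_euler_characteristic (subtopology (subtopology X (A \<union> B)) (A \<inter> B)) c"
    using A B AB by (simp_all add: subtopology_subtopology inf.absorb2 Int_absorb1 le_supI1 Un_Int_distrib2)
qed

lemma has_euler_characteristic_homotopy_equivalent:
  assumes "X homotopy_equivalent_space Y" "has_euler_characteristic Y k"
  shows "has_euler_characteristic X k"
proof -
  have "ab_rank (homology_group p X) = ab_rank (homology_group p Y)" for p
    using homotopy_equivalent_space_imp_isomorphic_homology_groups[OF assms(1)]
    by (intro ab_rank_is_iso) (auto simp: abelian_homology_group)
  then show ?thesis using assms(2) by (simp add: has_euler_characteristic_iff)
qed

lemma has_euler_characteristic_homeomorphic: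
  assumes "X homeomorphic_space Y" "has_euler_characteristic Y k"
  shows "has_euler_characteristic X k"
  using assms has_euler_characteristic_homotopy_equivalent homeomorphic_imp_homotopy_equivalent_space by blast

lemma has_euler_characteristic_empty:
  assumes "topspace X = {}"
  shows "has_euler_characteristic X 0"
proof -
  have "ab_rank (homology_group p X) = 0" for p
    by (intro ab_rank_trivial_group trivial_homology_group_empty assms abelian_homology_group)
  then show ?thesis by (simp add: has_euler_characteristic_iff finite_alternating_sum_def)
qed

lemma has_euler_characteristic_singleton:
  assumes "topspace X = {a}"
  shows "has_euler_characteristic X 1"
proof -
  have 0: "ab_rank (homology_group 0 X) = 1"
  proof -
    have "path_connected_space X"
      using path_connectedin_singleton[of X a] path_connectedin_topspace[of X] assms by simp
    then have "homology_group 0 X \<cong> integer_group"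
      using assms by (intro isomorphic_integer_zeroth_homology_group) auto
    then show ?thesis
      using ab_rank_is_iso[OF abelian_homology_group abelian_integer_group] ab_rank_integer_group by simp
  qed
  have "ab_rank (homology_group p X) = 0" if "p \<noteq> 0" for p
    using homology_dimension_axiom[OF assms that] by (intro ab_rank_trivial_group) (auto simp: abelian_homology_group)
  then have b: "ab_rank (homology_group (int p) X) = (if p = 0 then 1 else 0)" for p using 0 by simp
  show ?thesis unfolding has_euler_characteristic_iff finite_alternating_sum_iff
    by (intro exI[of _ "\<lambda>p. if p = 0 then 1 else 0"] exI[of _ 1]) (simp add: b one_enat_def zero_enat_def)
qed

section \<open>Products with punctured planes and open covers\<close>

lemma homotopy_equivalent_space_prod_contractible:
  assumes "contractible_space Z" "topspace Z \<noteq> {}"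
  shows "prod_topology X Z homotopy_equivalent_space X"
proof -
  obtain a where a: "homotopic_with (\<lambda>x. True) Z Z id (\<lambda>x. a)"
    using assms(1) by (auto simp: contractible_space_def)
  then have "continuous_map Z Z (\<lambda>x. a)" using homotopic_with_imp_continuous_maps by blast
  then have aZ: "a \<in> topspace Z" using assms(2) by (auto simp: continuous_map_def)
  have "homotopic_with (\<lambda>x. True) (prod_topology X Z) (prod_topology X Z)
      (\<lambda>z. (id (fst z), id (snd z))) (\<lambda>z. (id (fst z), a))"
    by (rule homotopic_with_prod_topology[where p = "\<lambda>x. True" and q = "\<lambda>x. True"])
      (use a in \<open>simp_all add: id_def\<close>)
  then have h: "homotopic_with (\<lambda>x. True) (prod_topology X Z) (prod_topology X Z) id (\<lambda>z. (fst z, a))"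
    by (simp add: id_def)
  show ?thesis
    unfolding homotopy_equivalent_space_def
  proof (intro exI conjI)
    show "continuous_map (prod_topology X Z) X fst" by (rule continuous_map_fst)
    show "continuous_map X (prod_topology X Z) (\<lambda>x. (x, a))"
      using aZ by (auto simp: continuous_map_pairwise o_def)
    show "homotopic_with (\<lambda>x. True) (prod_topology X Z) (prod_topology X Z) ((\<lambda>x. (x, a)) \<circ> fst) id"
      using h by (simp add: o_def homotopic_with_sym)
    show "homotopic_with (\<lambda>x. True) X X (fst \<circ> (\<lambda>x. (x, a))) id"
      by (simp add: o_def id_def)
  qed
qed

lemma has_euler_characteristic_prod_contractible:
  assumes "contractible S" "S \<noteq> {}" "has_euler_characteristic X k"
  shows "has_euler_characteristic (prod_topology X (top_of_set S)) k"
  using assms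
  by (intro has_euler_characteristic_homotopy_equivalent[OF homotopy_equivalent_space_prod_contractible]) auto

text \<open>Seen from the centre 1, a segment towards \<open>z\<close> can meet the real axis again
  only if \<open>z\<close> is itself real, hence positive.\<close>

lemma starlike_slit_plane: "starlike (- \<real>\<^sub>\<le>\<^sub>0 :: complex set)"
  unfolding starlike_def
proof (intro bexI[of _ 1] ballI)
  fix z :: complex assume z: "z \<in> - \<real>\<^sub>\<le>\<^sub>0"
  show "closed_segment 1 z \<subseteq> - \<real>\<^sub>\<le>\<^sub>0"
  proof
    fix w assume "w \<in> closed_segment 1 z"
    then obtain t where t: "0 \<le> t" "t \<le> 1" and w: "w = (1 - t) *\<^sub>R 1 + t *\<^sub>R z"
      by (auto simp: in_segment)
    have re: "Re w = (1 - t) + t * Re z" "Im w = t * Im z" using w by auto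
    have "Re w > 0" if "Im w = 0"
    proof (cases "t = 0")
      case False
      then have "Im z = 0" using that re by simp
      then have "Re z > 0" using z by (auto simp: complex_nonpos_Reals_iff)
      then show ?thesis using re t False by (simp add: add_nonneg_pos)
    qed (use re in auto)
    then show "w \<in> - \<real>\<^sub>\<le>\<^sub>0" by (force simp: complex_nonpos_Reals_iff)
  qed
qed (simp add: complex_nonpos_Reals_iff)

text \<open>The punctured plane is covered by two slit planes \<open>A\<close> and \<open>B\<close>
  that overlap in the two open half planes \<open>C\<close> and \<open>D\<close>. All four are
  contractible, so the product yields k + k - (k + k), whatever \<open>X\<close> is.\<close>

lemma has_euler_characteristic_prod_punctured_plane:
  assumes X: "has_euler_characteristic X k"
  shows "has_euler_characteristic (prod_topology X (top_of_set (- {0 :: complex}))) 0"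
proof -
  let ?P = "prod_topology X (euclidean :: complex topology)"
  let ?S = "\<lambda>U :: complex set. topspace X \<times> U"
  have sub: "subtopology ?P (?S U) = prod_topology X (top_of_set U)" for U
    by (simp add: prod_topology_subtopology)
  have op: "openin ?P (?S U)" if "open U" for U
    using that by (simp add: openin_prod_Times_iff)
  define A B C D :: "complex set" where "A = - \<real>\<^sub>\<le>\<^sub>0" and "B = - \<real>\<^sub>\<ge>\<^sub>0"
    and "C = {z. Im z > 0}" and "D = {z. Im z < 0}"
  have opens: "open A" "open B" "open C" "open D"
    unfolding A_def B_def C_def D_def
    by (auto simp: open_halfspace_Im_gt open_halfspace_Im_lt closed_nonneg_Reals_complex closed_nonpos_Reals_complex)
  have "starlike A" unfolding A_def by (rule starlike_slit_plane)
  then have A: "contractible A" "A \<noteq> {}" using starlike_imp_contractible by (auto simp: A_def)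
  have "B = uminus ` A" unfolding A_def B_def
    by (auto simp: complex_nonpos_Reals_iff complex_nonneg_Reals_iff image_iff intro!: bexI[of _ "- _"])
  then have "A homeomorphic B"
    using linear_homeomorphic_image[of uminus A] by (simp add: linear_uminus)
  then have B: "contractible B" "B \<noteq> {}"
    using A homeomorphic_contractible_eq \<open>B = uminus ` A\<close> by auto
  have "convex C" "convex D" unfolding C_def D_def
    by (auto simp: convex_halfspace_Im_gt convex_halfspace_Im_lt)
  moreover have "\<i> \<in> C" "-\<i> \<in> D" by (auto simp: C_def D_def)
  ultimately have CD: "contractible C" "contractible D" "C \<noteq> {}" "D \<noteq> {}" using convex_imp_contractible by auto
  have e: "has_euler_characteristic (subtopology ?P (?S U)) k" if "contractible U" "U \<noteq> {}" for U
    unfolding sub by (rule has_euler_characteristic_prod_contractible[OF that X])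
  have CD0: "has_euler_characteristic (subtopology ?P (?S C \<inter> ?S D)) 0"
    by (rule has_euler_characteristic_empty) (auto simp: C_def D_def)
  have "has_euler_characteristic (subtopology ?P (?S C \<union> ?S D)) (k + k - 0)"
    by (intro has_euler_characteristic_union op opens e CD CD0)
  moreover have "?S C \<union> ?S D = ?S A \<inter> ?S B"
    by (force simp: A_def B_def C_def D_def complex_nonpos_Reals_iff complex_nonneg_Reals_iff)
  ultimately have "has_euler_characteristic (subtopology ?P (?S A \<inter> ?S B)) (2 * k)" by simp
  then have "has_euler_characteristic (subtopology ?P (?S A \<union> ?S B)) (k + k - 2 * k)"
    by (intro has_euler_characteristic_union op opens e A B)
  moreover have "?S A \<union> ?S B = ?S (- {0})"
    by (auto simp: A_def B_def complex_nonpos_Reals_iff complex_nonneg_Reals_iff complex_eq_iff)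
  ultimately show ?thesis by (simp add: sub)
qed

definition torus_factor :: "bool \<Rightarrow> complex topology" where
  "torus_factor b = top_of_set (if b then UNIV else - {0})"

lemma has_euler_characteristic_prod_factor:
  assumes "has_euler_characteristic X k"
  shows "has_euler_characteristic (prod_topology X (torus_factor b)) (if b then k else 0)"
  using has_euler_characteristic_prod_contractible[of "UNIV :: complex set" X k]
    has_euler_characteristic_prod_punctured_plane[OF assms] assms
  by (auto simp: torus_factor_def convex_imp_contractible)

text \<open>A one-point first factor makes the product lemma applicable to a single factor.\<close>

lemma has_euler_characteristic_factor:
  "has_euler_characteristic (torus_factor b) (if b then 1 else 0)"
proof -
  let ?pt = "subtopology (euclidean :: complex topology) {0}"
  have "has_euler_characteristic (prod_topology ?pt (torus_factor b)) (if b then 1 else 0)"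
    by (intro has_euler_characteristic_prod_factor has_euler_characteristic_singleton) simp
  moreover have "torus_factor b homeomorphic_space prod_topology ?pt (torus_factor b)"
    by (rule homeomorphic_space_prod_topology_sing2) simp
  ultimately show ?thesis using has_euler_characteristic_homeomorphic by blast
qed

lemma has_euler_characteristic_factors3:
  "has_euler_characteristic (prod_topology (prod_topology (torus_factor a) (torus_factor b)) (torus_factor c))
     (if a \<and> b \<and> c then 1 else 0)"
proof -
  have "has_euler_characteristic (prod_topology (prod_topology (torus_factor a) (torus_factor b)) (torus_factor c))
     (if c then (if b then (if a then 1 else 0) else 0) else 0)"
    by (intro has_euler_characteristic_prod_factor has_euler_characteristic_factor)
  then show ?thesis by (auto split: if_splits)
qed

text \<open>The overlap of \<open>U\<close> with the remaining sets is the union of the sets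
  \<open>U \<inter> V\<close>, again members of \<G> and listed with the same length. Induction on
  the length of a list absorbs coincidences among these intersections.\<close>

lemma has_euler_characteristic_Union_zero:
  assumes "\<And>U. U \<in> \<G> \<Longrightarrow> openin X U \<and> has_euler_characteristic (subtopology X U) 0"
    and "\<And>U V. U \<in> \<G> \<Longrightarrow> V \<in> \<G> \<Longrightarrow> U \<inter> V \<in> \<G>"
    and "set Us \<subseteq> \<G>"
  shows "has_euler_characteristic (subtopology X (\<Union>(set Us))) 0"
  using assms(3)
proof (induction "length Us" arbitrary: Us)
  case 0
  then show ?case by (auto intro!: has_euler_characteristic_empty)
next
  case (Suc n)
  then obtain U Vs where Us: "Us = U # Vs" "length Vs = n" by (cases Us) auto
  have 1: "has_euler_characteristic (subtopology X (\<Union>(set Vs))) 0"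
    using Suc Us by auto
  have "\<Union>(set (map (\<lambda>V. U \<inter> V) Vs)) = U \<inter> \<Union>(set Vs)" by auto
  moreover have "has_euler_characteristic (subtopology X (\<Union>(set (map (\<lambda>V. U \<inter> V) Vs)))) 0"
    using Suc.prems Us assms(2) by (intro Suc.hyps(1)) auto
  ultimately have 2: "has_euler_characteristic (subtopology X (U \<inter> \<Union>(set Vs))) 0" by simp
  have "openin X (\<Union>(set Vs))" using Suc.prems Us assms(1) by (intro openin_Union) auto
  then have "has_euler_characteristic (subtopology X (U \<union> \<Union>(set Vs))) (0 + 0 - 0)"
    using Suc.prems Us assms(1) by (intro has_euler_characteristic_union 1 2) auto
  then show ?case using Us by simp
qed

text \<open>Each new piece meets the union of the earlier ones in a union of members of \<G>, which
  has Euler characteristic 0, and so it adds 1.\<close>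

lemma has_euler_characteristic_cover:
  assumes "\<And>U. U \<in> \<G> \<Longrightarrow> openin X U \<and> has_euler_characteristic (subtopology X U) 0"
    and "\<And>U V. U \<in> \<G> \<Longrightarrow> V \<in> \<G> \<Longrightarrow> U \<inter> V \<in> \<G>"
    and "finite K"
    and "\<And>k. k \<in> K \<Longrightarrow> openin X (V k) \<and> has_euler_characteristic (subtopology X (V k)) 1"
    and "\<And>k l. k \<in> K \<Longrightarrow> l \<in> K \<Longrightarrow> k \<noteq> l \<Longrightarrow> V k \<inter> V l \<in> \<G>"
  shows "has_euler_characteristic (subtopology X (\<Union>k\<in>K. V k)) (int (card K))"
  using assms(3-5)
proof (induction K)
  case empty
  then show ?case by (auto intro!: has_euler_characteristic_empty)
next
  case (insert k K)
  have 1: "has_euler_characteristic (subtopology X (\<Union>k\<in>K. V k)) (int (card K))"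
    using insert by auto
  obtain ks where ks: "set ks = K" using insert.hyps(1) finite_list by blast
  have "V k \<inter> V l \<in> \<G>" if "l \<in> K" for l
    using insert.prems(2)[of k l] insert.hyps(2) that by auto
  then have "set (map (\<lambda>l. V k \<inter> V l) ks) \<subseteq> \<G>" using ks by auto
  then have "has_euler_characteristic (subtopology X (\<Union>(set (map (\<lambda>l. V k \<inter> V l) ks)))) 0"
    by (rule has_euler_characteristic_Union_zero[rotated 2]) (use assms(1,2) in auto)
  moreover have "\<Union>(set (map (\<lambda>l. V k \<inter> V l) ks)) = V k \<inter> (\<Union>k\<in>K. V k)" using ks by auto
  ultimately have 2: "has_euler_characteristic (subtopology X (V k \<inter> (\<Union>k\<in>K. V k))) 0" by simp
  have "openin X (\<Union>k\<in>K. V k)" using insert.prems(1) by (intro openin_Union) auto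
  then have "has_euler_characteristic (subtopology X (V k \<union> (\<Union>k\<in>K. V k))) (1 + int (card K) - 0)"
    using insert.prems(1) by (intro has_euler_characteristic_union 1 2) auto
  then show ?case using insert.hyps by simp
qed

section \<open>Toric varieties of smooth fans\<close>

definition dual_bases :: "(3 \<Rightarrow> real ^ 3) \<Rightarrow> (3 \<Rightarrow> real ^ 3) \<Rightarrow> bool" where
  "dual_bases u d \<longleftrightarrow> (\<forall>i j. d i \<bullet> u j = (if i = j then 1 else 0)) \<and> (\<forall>x. x = (\<Sum>i\<in>UNIV. (d i \<bullet> x) *\<^sub>R u i))"

definition face_cone :: "(3 \<Rightarrow> real ^ 3) \<Rightarrow> 3 set \<Rightarrow> (real ^ 3) set" where
  "face_cone u I = {\<Sum>i\<in>UNIV. t i *\<^sub>R u i | t. (\<forall>i. 0 \<le> t i) \<and> (\<forall>i. i \<notin> I \<longrightarrow> t i = 0)}"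

definition smooth_basis :: "(real ^ 3) set \<Rightarrow> (3 \<Rightarrow> real ^ 3) \<Rightarrow> (3 \<Rightarrow> real ^ 3) \<Rightarrow> bool" where
  "smooth_basis N u d \<longleftrightarrow> dual_bases u d \<and> N = {\<Sum>i\<in>UNIV. of_int (k i) *\<^sub>R u i | k :: 3 \<Rightarrow> int. True}"

lemma dual_bases_coord:
  assumes "dual_bases u d"
  shows "d j \<bullet> (\<Sum>i\<in>UNIV. t i *\<^sub>R u i) = t j"
proof -
  have "d j \<bullet> (\<Sum>i\<in>UNIV. t i *\<^sub>R u i) = (\<Sum>i\<in>UNIV. if j = i then t i else 0)"
    unfolding inner_sum_right using assms by (intro sum.cong) (auto simp: dual_bases_def)
  then show ?thesis by simp
qed

lemma dual_bases_expand:
  assumes "dual_bases u d"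
  shows "x = (\<Sum>i\<in>UNIV. (d i \<bullet> x) *\<^sub>R u i)"
  using assms by (simp add: dual_bases_def)

lemma dual_bases_sym:
  assumes "dual_bases u d"
  shows "dual_bases d u"
proof -
  have "m = (\<Sum>i\<in>UNIV. (u i \<bullet> m) *\<^sub>R d i)" for m
  proof (rule vector_eq_rdot[THEN iffD1], rule allI)
    fix x
    have "m \<bullet> x = m \<bullet> (\<Sum>i\<in>UNIV. (d i \<bullet> x) *\<^sub>R u i)" using dual_bases_expand[OF assms, of x] by simp
    also have "\<dots> = (\<Sum>i\<in>UNIV. (u i \<bullet> m) *\<^sub>R d i) \<bullet> x"
      by (simp add: inner_sum_right inner_sum_left inner_commute mult.commute)
    finally show "m \<bullet> x = (\<Sum>i\<in>UNIV. (u i \<bullet> m) *\<^sub>R d i) \<bullet> x" .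
  qed
  moreover have "u i \<bullet> d j = (if i = j then 1 else 0)" for i j
    using assms by (auto simp: dual_bases_def inner_commute)
  ultimately show ?thesis unfolding dual_bases_def by blast
qed

lemma face_cone_iff:
  assumes "dual_bases u d"
  shows "x \<in> face_cone u I \<longleftrightarrow> (\<forall>i. 0 \<le> d i \<bullet> x) \<and> (\<forall>i. i \<notin> I \<longrightarrow> d i \<bullet> x = 0)"
proof
  assume "x \<in> face_cone u I"
  then show "(\<forall>i. 0 \<le> d i \<bullet> x) \<and> (\<forall>i. i \<notin> I \<longrightarrow> d i \<bullet> x = 0)"
    using dual_bases_coord[OF assms] by (auto simp: face_cone_def)
next
  assume "(\<forall>i. 0 \<le> d i \<bullet> x) \<and> (\<forall>i. i \<notin> I \<longrightarrow> d i \<bullet> x = 0)"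
  then show "x \<in> face_cone u I"
    unfolding face_cone_def using dual_bases_expand[OF assms, of x] by (intro CollectI exI[of _ "\<lambda>i. d i \<bullet> x"]) auto
qed

lemma generator_in_face_cone:
  assumes "i \<in> I"
  shows "u i \<in> face_cone u I"
proof -
  have "(\<Sum>j\<in>UNIV. (if j = i then 1 else 0 :: real) *\<^sub>R u j) = (\<Sum>j\<in>UNIV. if j = i then u j else 0)"
    by (intro sum.cong) auto
  then have "u i = (\<Sum>j\<in>UNIV. (if j = i then 1 else 0 :: real) *\<^sub>R u j)" by simp
  then show ?thesis
    unfolding face_cone_def using assms
    by (intro CollectI exI[of _ "\<lambda>j. if j = i then 1 else 0"]) auto
qed

lemma smooth_basis_iff:
  assumes "smooth_basis N u d"
  shows "n \<in> N \<longleftrightarrow> (\<forall>i. d i \<bullet> n \<in> \<int>)"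
proof
  assume "n \<in> N"
  then show "\<forall>i. d i \<bullet> n \<in> \<int>"
    using assms dual_bases_coord[of u d] by (auto simp: smooth_basis_def)
next
  assume "\<forall>i. d i \<bullet> n \<in> \<int>"
  then have "d i \<bullet> n = of_int \<lfloor>d i \<bullet> n\<rfloor>" for i by (metis Ints_cases floor_of_int)
  then have "n = (\<Sum>i\<in>UNIV. of_int \<lfloor>d i \<bullet> n\<rfloor> *\<^sub>R u i)"
    using dual_bases_expand[of u d n] assms by (simp add: smooth_basis_def)
  then show "n \<in> N" using assms by (auto simp: smooth_basis_def)
qed

text \<open>Pairings with the lattice basis \<open>u\<close> determine those with all of
  \<open>N\<close>, and only the generators in \<open>I\<close> impose a sign.\<close>

lemma cone_semigroup_face_cone:
  assumes "smooth_basis N u d"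
  shows "cone_semigroup N (face_cone u I) = {m. (\<forall>i. m \<bullet> u i \<in> \<int>) \<and> (\<forall>i\<in>I. 0 \<le> m \<bullet> u i)}" (is "?L = ?R")
proof (intro equalityI subsetI)
  have db: "dual_bases u d" using assms by (simp add: smooth_basis_def)
  fix m
  {
    assume m: "m \<in> ?L"
    have "u i \<in> N" for i unfolding smooth_basis_iff[OF assms] using db by (auto simp: dual_bases_def)
    then show "m \<in> ?R"
      using m generator_in_face_cone[of _ I u] by (auto simp: cone_semigroup_def dual_lattice_def)
  next
    assume m: "m \<in> ?R"
    have "m \<bullet> n \<in> \<int>" if "n \<in> N" for n
    proof -
      obtain k :: "3 \<Rightarrow> int" where "n = (\<Sum>i\<in>UNIV. of_int (k i) *\<^sub>R u i)"
        using \<open>n \<in> N\<close> assms by (auto simp: smooth_basis_def)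
      then have "m \<bullet> n = (\<Sum>i\<in>UNIV. of_int (k i) * (m \<bullet> u i))" by (simp add: inner_sum_right)
      then show ?thesis using m by (auto intro!: Ints_sum Ints_mult)
    qed
    moreover have "0 \<le> m \<bullet> x" if "x \<in> face_cone u I" for x
    proof -
      obtain t where t: "x = (\<Sum>i\<in>UNIV. t i *\<^sub>R u i)" "\<And>i. 0 \<le> t i" "\<And>i. i \<notin> I \<Longrightarrow> t i = 0"
        using \<open>x \<in> face_cone u I\<close> by (auto simp: face_cone_def)
      have "m \<bullet> x = (\<Sum>i\<in>UNIV. t i * (m \<bullet> u i))" using t(1) by (simp add: inner_sum_right)
      moreover have "0 \<le> t i * (m \<bullet> u i)" for i using t m by (cases "i \<in> I") auto
      ultimately show ?thesis by (simp add: sum_nonneg)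
    qed
    ultimately show "m \<in> ?L" by (simp add: cone_semigroup_def dual_lattice_def)
  }
qed

lemma cone_semigroup_zero: "0 \<in> cone_semigroup N \<sigma>"
  by (simp add: cone_semigroup_def dual_lattice_def)

lemma cone_semigroup_add: "m \<in> cone_semigroup N \<sigma> \<Longrightarrow> m' \<in> cone_semigroup N \<sigma> \<Longrightarrow> m + m' \<in> cone_semigroup N \<sigma>"
  by (simp add: cone_semigroup_def dual_lattice_def inner_add_left)

lemma cone_semigroup_antimono: "\<tau> \<subseteq> \<sigma> \<Longrightarrow> cone_semigroup N \<sigma> \<subseteq> cone_semigroup N \<tau>"
  by (auto simp: cone_semigroup_def)

lemma topspace_affine_toric:
  "x \<in> topspace (affine_toric N \<sigma>) \<longleftrightarrow> x \<in> extensional (cone_semigroup N \<sigma>) \<and> x 0 = 1 \<and>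
     (\<forall>m\<in>cone_semigroup N \<sigma>. \<forall>m'\<in>cone_semigroup N \<sigma>. x (m + m') = x m * x m')"
  by (auto simp: affine_toric_def Let_def PiE_def)

lemma restrict_affine_toric:
  assumes "x \<in> topspace (affine_toric N \<tau>)" "\<tau> \<subseteq> \<sigma>"
  shows "restrict x (cone_semigroup N \<sigma>) \<in> topspace (affine_toric N \<sigma>)"
  using assms cone_semigroup_antimono[OF assms(2), of N]
  by (auto simp: topspace_affine_toric cone_semigroup_zero cone_semigroup_add subset_iff)

lemma continuous_map_restrict_affine_toric:
  assumes "\<tau> \<subseteq> \<sigma>"
  shows "continuous_map (affine_toric N \<tau>) (affine_toric N \<sigma>) (\<lambda>x. restrict x (cone_semigroup N \<sigma>))"
proof -
  have 1: "continuous_map (affine_toric N \<tau>) (product_topology (\<lambda>_. euclidean) (cone_semigroup N \<sigma>))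
     (\<lambda>x. restrict x (cone_semigroup N \<sigma>))"
    unfolding continuous_map_componentwise affine_toric_def Let_def
    using cone_semigroup_antimono[OF assms, of N]
    by (auto intro!: continuous_map_from_subtopology continuous_map_product_projection)
  show ?thesis
    unfolding affine_toric_def[of N \<sigma>] Let_def continuous_map_in_subtopology
    using 1 restrict_affine_toric[OF _ assms, of _ N] by (auto simp: topspace_affine_toric)
qed

section \<open>Coordinates on the chart of a smooth cone\<close>

definition torus_chart_domain :: "3 set \<Rightarrow> (3 \<Rightarrow> complex) set" where
  "torus_chart_domain I = {z. \<forall>i. i \<notin> I \<longrightarrow> z i \<noteq> 0}"

definition chart_coords :: "(3 \<Rightarrow> real ^ 3) \<Rightarrow> (real ^ 3 \<Rightarrow> complex) \<Rightarrow> 3 \<Rightarrow> complex" where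
  "chart_coords d x = (\<lambda>i. x (d i))"

text \<open>The monomial map inverse to \<open>chart_coords\<close>. On the semigroup the pairings
  are integers, so the floor only changes the type; negative exponents occur only at coordinates
  that do not vanish on \<open>torus_chart_domain I\<close>.\<close>

definition chart_point :: "(real ^ 3) set \<Rightarrow> (3 \<Rightarrow> real ^ 3) \<Rightarrow> 3 set \<Rightarrow> (3 \<Rightarrow> complex) \<Rightarrow> real ^ 3 \<Rightarrow> complex" where
  "chart_point N u I z = (\<lambda>m\<in>cone_semigroup N (face_cone u I). \<Prod>i\<in>UNIV. z i powi \<lfloor>m \<bullet> u i\<rfloor>)"

lemma open_torus_chart_domain: "open (torus_chart_domain I)"
proof -
  have "open {z :: 3 \<Rightarrow> complex. z i \<noteq> 0}" for i
    by (intro open_Collect_neq continuous_on_product_coordinates continuous_on_const)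
  moreover have "torus_chart_domain I = (\<Inter>i\<in>-I. {z. z i \<noteq> 0})"
    by (auto simp: torus_chart_domain_def)
  ultimately show ?thesis by auto
qed

lemma torus_chart_domain_Int: "torus_chart_domain I \<inter> torus_chart_domain J = torus_chart_domain (I \<inter> J)"
  by (auto simp: torus_chart_domain_def)

lemma torus_chart_domain_mono: "I \<subseteq> J \<Longrightarrow> torus_chart_domain I \<subseteq> torus_chart_domain J"
  by (auto simp: torus_chart_domain_def)

text \<open>At base 0 the exponent law fails for nonzero exponents that cancel, since
  \<open>0 powi 0\<close> is 1; nonnegative exponents exclude this.\<close>

lemma powi_add_nonneg:
  fixes z :: complex
  assumes "z \<noteq> 0 \<or> (0 \<le> m \<and> 0 \<le> n)"
  shows "z powi (m + n) = z powi m * z powi n"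
proof (cases "z \<noteq> 0 \<or> m + n \<noteq> 0")
  case False
  then have "m = 0" "n = 0" using assms by auto
  then show ?thesis by simp
qed (rule power_int_add)

context
  fixes N u d
  assumes sb: "smooth_basis N u d"
begin

lemma dual_vector_in_semigroup: "d i \<in> cone_semigroup N (face_cone u I)"
  using sb unfolding cone_semigroup_face_cone[OF sb] by (auto simp: smooth_basis_def dual_bases_def)

lemma chart_point_in_topspace:
  assumes z: "z \<in> torus_chart_domain I"
  shows "chart_point N u I z \<in> topspace (affine_toric N (face_cone u I))"
proof -
  let ?S = "cone_semigroup N (face_cone u I)"
  have "chart_point N u I z (m + m') = chart_point N u I z m * chart_point N u I z m'"
    if m: "m \<in> ?S" "m' \<in> ?S" for m m'
  proof -
    have "z i powi \<lfloor>(m + m') \<bullet> u i\<rfloor> = z i powi \<lfloor>m \<bullet> u i\<rfloor> * z i powi \<lfloor>m' \<bullet> u i\<rfloor>" for i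
    proof -
      have "\<lfloor>(m + m') \<bullet> u i\<rfloor> = \<lfloor>m \<bullet> u i\<rfloor> + \<lfloor>m' \<bullet> u i\<rfloor>"
        using m unfolding cone_semigroup_face_cone[OF sb]
        by (auto simp: inner_add_left elim!: Ints_cases dest!: spec[of _ i])
      moreover have "z i \<noteq> 0 \<or> (0 \<le> \<lfloor>m \<bullet> u i\<rfloor> \<and> 0 \<le> \<lfloor>m' \<bullet> u i\<rfloor>)"
        using m z unfolding cone_semigroup_face_cone[OF sb] by (auto simp: torus_chart_domain_def)
      ultimately show ?thesis by (simp add: powi_add_nonneg)
    qed
    then show ?thesis using m by (simp add: chart_point_def cone_semigroup_add prod.distrib)
  qed
  then show ?thesis
    by (auto simp: topspace_affine_toric chart_point_def cone_semigroup_zero)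
qed

text \<open>For \<open>i\<close> outside \<open>I\<close> the negative multiples of
  \<open>d i\<close> belong to the semigroup as well, and \<open>x 0 = 1\<close> makes their values
  the inverses; for \<open>i\<close> in \<open>I\<close> only natural exponents arise.\<close>

lemma toric_point_multiple:
  assumes x: "x \<in> topspace (affine_toric N (face_cone u I))"
    and k: "i \<in> I \<Longrightarrow> 0 \<le> k"
  shows "(of_int k *\<^sub>R d i) \<in> cone_semigroup N (face_cone u I) \<and> x (of_int k *\<^sub>R d i) = x (d i) powi k"
proof -
  let ?S = "cone_semigroup N (face_cone u I)"
  have mult: "\<And>m m'. m \<in> ?S \<Longrightarrow> m' \<in> ?S \<Longrightarrow> x (m + m') = x m * x m'" and one: "x 0 = 1"
    using x by (auto simp: topspace_affine_toric)
  have db: "dual_bases u d" using sb by (simp add: smooth_basis_def)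
  have inS: "of_int k *\<^sub>R d i \<in> ?S" if "i \<in> I \<longrightarrow> 0 \<le> k" for k
    using that db unfolding cone_semigroup_face_cone[OF sb] by (auto simp: dual_bases_def)
  have nat: "x (of_int (int n) *\<^sub>R d i) = x (d i) ^ n" for n
  proof (induction n)
    case (Suc n)
    have "of_int (int (Suc n)) *\<^sub>R d i = d i + of_int (int n) *\<^sub>R d i" by (simp add: algebra_simps)
    then show ?case using mult[OF dual_vector_in_semigroup[of i] inS[of "int n"]] Suc by simp
  qed (simp add: one)
  show ?thesis
  proof (cases "0 \<le> k")
    case True
    then show ?thesis using nat[of "nat k"] inS[of k] by (simp add: power_int_def)
  next
    case False
    then have i: "i \<notin> I" using k by auto
    define n where "n = nat (- k)"
    have kn: "k = - int n" using False by (simp add: n_def)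
    have "x (of_int (int n) *\<^sub>R d i + of_int k *\<^sub>R d i) = x (of_int (int n) *\<^sub>R d i) * x (of_int k *\<^sub>R d i)"
      using i by (intro mult inS) auto
    moreover have "of_int (int n) *\<^sub>R d i + of_int k *\<^sub>R d i = 0" by (simp add: kn)
    ultimately have "x (d i) ^ n * x (of_int k *\<^sub>R d i) = 1" by (simp add: nat one del: of_int_of_nat_eq)
    then have "x (of_int k *\<^sub>R d i) = inverse (x (d i) ^ n)" by (metis inverse_unique)
    moreover have "x (d i) powi k = inverse (x (d i) ^ n)"
      using False by (simp add: power_int_def n_def power_inverse)
    ultimately show ?thesis using inS[of k] i by simp
  qed
qed

lemma chart_coords_in_domain:
  assumes x: "x \<in> topspace (affine_toric N (face_cone u I))"
  shows "chart_coords d x \<in> torus_chart_domain I"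
  unfolding torus_chart_domain_def chart_coords_def
proof (intro CollectI allI impI)
  fix i assume i: "i \<notin> I"
  let ?S = "cone_semigroup N (face_cone u I)"
  have mult: "\<And>m m'. m \<in> ?S \<Longrightarrow> m' \<in> ?S \<Longrightarrow> x (m + m') = x m * x m'" and one: "x 0 = 1"
    using x by (auto simp: topspace_affine_toric)
  have "of_int (-1) *\<^sub>R d i \<in> ?S" using toric_point_multiple[OF x, of i "-1"] i by simp
  then have "x (d i + of_int (-1) *\<^sub>R d i) = x (d i) * x (of_int (-1) *\<^sub>R d i)"
    by (intro mult dual_vector_in_semigroup)
  then show "x (d i) \<noteq> 0" using one by auto
qed

lemma chart_point_chart_coords:
  assumes x: "x \<in> topspace (affine_toric N (face_cone u I))"
  shows "chart_point N u I (chart_coords d x) = x"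
proof
  fix m
  let ?S = "cone_semigroup N (face_cone u I)"
  have mult: "\<And>m m'. m \<in> ?S \<Longrightarrow> m' \<in> ?S \<Longrightarrow> x (m + m') = x m * x m'" and one: "x 0 = 1"
    using x by (auto simp: topspace_affine_toric)
  have db: "dual_bases u d" using sb by (simp add: smooth_basis_def)
  show "chart_point N u I (chart_coords d x) m = x m"
  proof (cases "m \<in> ?S")
    case False
    then show ?thesis using x by (auto simp: chart_point_def topspace_affine_toric extensional_def)
  next
    case True
    define k where "k i = \<lfloor>m \<bullet> u i\<rfloor>" for i
    have k: "m \<bullet> u i = of_int (k i)" "i \<in> I \<Longrightarrow> 0 \<le> k i" for i
      using True unfolding cone_semigroup_face_cone[OF sb] k_def by auto
    have m: "m = (\<Sum>i\<in>UNIV. of_int (k i) *\<^sub>R d i)"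
      using dual_bases_expand[OF dual_bases_sym[OF db], of m] by (simp add: k(1)[symmetric] inner_commute)
    \<comment> \<open>The induction carries membership along, because the homomorphism law applies
      only to partial sums known to lie in the semigroup.\<close>
    have "(\<Sum>i\<in>A. of_int (k i) *\<^sub>R d i) \<in> ?S \<and>
          x (\<Sum>i\<in>A. of_int (k i) *\<^sub>R d i) = (\<Prod>i\<in>A. x (d i) powi k i)" for A
      using finite[of A]
    proof (induction A)
      case empty
      then show ?case by (simp add: one cone_semigroup_zero)
    next
      case (insert i A)
      then show ?case
        using toric_point_multiple[OF x k(2), of i] mult cone_semigroup_add by simp
    qed
    from this[of UNIV] have "x m = (\<Prod>i\<in>UNIV. x (d i) powi k i)" using m by simp
    then show ?thesis using True by (simp add: chart_point_def chart_coords_def k_def)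
  qed
qed

lemma chart_coords_chart_point:
  assumes "z \<in> torus_chart_domain I"
  shows "chart_coords d (chart_point N u I z) = z"
proof
  fix i
  have db: "dual_bases u d" using sb by (simp add: smooth_basis_def)
  have "chart_coords d (chart_point N u I z) i = (\<Prod>j\<in>UNIV. z j powi \<lfloor>d i \<bullet> u j\<rfloor>)"
    by (simp add: chart_coords_def chart_point_def dual_vector_in_semigroup)
  also have "\<dots> = (\<Prod>j\<in>UNIV. if i = j then z j else 1)"
    using db by (intro prod.cong) (auto simp: dual_bases_def)
  finally show "chart_coords d (chart_point N u I z) i = z i" by simp
qed

lemma homeomorphic_maps_chart:
  "homeomorphic_maps (affine_toric N (face_cone u I)) (top_of_set (torus_chart_domain I))
     (chart_coords d) (chart_point N u I)"
  unfolding homeomorphic_maps_def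
proof (intro conjI ballI)
  let ?S = "cone_semigroup N (face_cone u I)"
  have "continuous_map (affine_toric N (face_cone u I)) (product_topology (\<lambda>_. euclidean) UNIV) (chart_coords d)"
    unfolding continuous_map_componentwise_UNIV chart_coords_def affine_toric_def Let_def
    by (auto intro!: continuous_map_from_subtopology continuous_map_product_projection dual_vector_in_semigroup)
  then show "continuous_map (affine_toric N (face_cone u I)) (top_of_set (torus_chart_domain I)) (chart_coords d)"
    using chart_coords_in_domain by (auto simp: continuous_map_in_subtopology euclidean_product_topology)
  have "continuous_on (torus_chart_domain I) (\<lambda>z. \<Prod>i\<in>UNIV. z i powi \<lfloor>m \<bullet> u i\<rfloor>)" if m: "m \<in> ?S" for m
  proof (rule continuous_on_prod)
    fix i
    have "0 \<le> \<lfloor>m \<bullet> u i\<rfloor> \<or> (\<forall>z\<in>torus_chart_domain I. z i \<noteq> 0)"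
      using m unfolding cone_semigroup_face_cone[OF sb] by (auto simp: torus_chart_domain_def)
    then show "continuous_on (torus_chart_domain I) (\<lambda>z. z i powi \<lfloor>m \<bullet> u i\<rfloor>)"
      by (intro continuous_on_power_int continuous_on_subset[OF continuous_on_product_coordinates subset_UNIV])
  qed
  then have "continuous_map (top_of_set (torus_chart_domain I)) (product_topology (\<lambda>_. euclidean) ?S) (chart_point N u I)"
    unfolding continuous_map_componentwise by (auto simp: chart_point_def)
  then show "continuous_map (top_of_set (torus_chart_domain I)) (affine_toric N (face_cone u I)) (chart_point N u I)"
    using chart_point_in_topspace unfolding affine_toric_def Let_def continuous_map_in_subtopology
    by (auto simp: topspace_affine_toric[unfolded affine_toric_def Let_def])
qed (auto simp: chart_point_chart_coords chart_coords_chart_point)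

text \<open>The vectors \<open>d\<close> lie in the semigroup of every face of \<open>u\<close>, so
  restriction to a larger face keeps the coordinates: it is the inclusion of chart domains.\<close>

lemma restrict_eq_chart_point:
  assumes "I \<subseteq> J" "x \<in> topspace (affine_toric N (face_cone u I))"
  shows "restrict x (cone_semigroup N (face_cone u J)) = chart_point N u J (chart_coords d x)"
proof -
  have "face_cone u I \<subseteq> face_cone u J" using assms(1) by (auto simp: face_cone_def)
  then have "restrict x (cone_semigroup N (face_cone u J)) \<in> topspace (affine_toric N (face_cone u J))"
    by (rule restrict_affine_toric[OF assms(2)])
  from chart_point_chart_coords[OF this] show ?thesis
    by (simp add: chart_coords_def dual_vector_in_semigroup)
qed

text \<open>In coordinates this is an inclusion of open sets; it is the source of openness in the
  gluing.\<close>

lemma open_map_restrict_face: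
  assumes "I \<subseteq> J"
  shows "open_map (affine_toric N (face_cone u I)) (affine_toric N (face_cone u J))
           (\<lambda>x. restrict x (cone_semigroup N (face_cone u J)))"
  unfolding open_map_def
proof (intro allI impI)
  fix W assume W: "openin (affine_toric N (face_cone u I)) W"
  have hI: "homeomorphic_map (affine_toric N (face_cone u I)) (top_of_set (torus_chart_domain I)) (chart_coords d)"
    and hJ: "homeomorphic_map (top_of_set (torus_chart_domain J)) (affine_toric N (face_cone u J)) (chart_point N u J)"
    using homeomorphic_maps_chart homeomorphic_maps_map by blast+
  have "openin (top_of_set (torus_chart_domain I)) (chart_coords d ` W)"
    using hI W homeomorphic_imp_open_map open_map_def by blast
  then have "open (chart_coords d ` W)" "chart_coords d ` W \<subseteq> torus_chart_domain J"
    using openin_open_trans[OF _ open_torus_chart_domain] torus_chart_domain_mono[OF assms] openin_imp_subset[of euclidean "torus_chart_domain I" "chart_coords d ` W"]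
    by auto
  then have "openin (top_of_set (torus_chart_domain J)) (chart_coords d ` W)"
    by (simp add: open_torus_chart_domain openin_open_eq)
  then have "openin (affine_toric N (face_cone u J)) (chart_point N u J ` chart_coords d ` W)"
    using hJ homeomorphic_imp_open_map open_map_def by blast
  moreover have "chart_point N u J ` chart_coords d ` W = (\<lambda>x. restrict x (cone_semigroup N (face_cone u J))) ` W"
    using restrict_eq_chart_point[OF assms] openin_subset[OF W] by (auto simp: image_image subset_iff intro!: image_cong)
  ultimately show "openin (affine_toric N (face_cone u J)) ((\<lambda>x. restrict x (cone_semigroup N (face_cone u J))) ` W)"
    by simp
qed

text \<open>Equal restrictions mean equal coordinates; these are nonzero outside \<open>I1\<close>
  and outside \<open>I2\<close>, hence outside the intersection. Transitivity of the gluing rests on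
  this.\<close>

lemma common_extension:
  assumes "I1 \<subseteq> J" "I2 \<subseteq> J"
    and z1: "z1 \<in> topspace (affine_toric N (face_cone u I1))"
    and z2: "z2 \<in> topspace (affine_toric N (face_cone u I2))"
    and eq: "restrict z1 (cone_semigroup N (face_cone u J)) = restrict z2 (cone_semigroup N (face_cone u J))"
  shows "\<exists>y \<in> topspace (affine_toric N (face_cone u (I1 \<inter> I2))).
           restrict y (cone_semigroup N (face_cone u I1)) = z1 \<and> restrict y (cone_semigroup N (face_cone u I2)) = z2"
proof -
  have "chart_coords d z1 = chart_coords d (restrict z1 (cone_semigroup N (face_cone u J)))"
    "chart_coords d z2 = chart_coords d (restrict z2 (cone_semigroup N (face_cone u J)))"
    by (simp_all add: chart_coords_def dual_vector_in_semigroup)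
  then have c: "chart_coords d z1 = chart_coords d z2" using eq by simp
  then have dom: "chart_coords d z1 \<in> torus_chart_domain (I1 \<inter> I2)"
    using chart_coords_in_domain[OF z1] chart_coords_in_domain[OF z2] torus_chart_domain_Int by auto
  define y where "y = chart_point N u (I1 \<inter> I2) (chart_coords d z1)"
  have y: "y \<in> topspace (affine_toric N (face_cone u (I1 \<inter> I2)))" "chart_coords d y = chart_coords d z1"
    unfolding y_def using chart_point_in_topspace[OF dom] chart_coords_chart_point[OF dom] by auto
  have "restrict y (cone_semigroup N (face_cone u I1)) = z1" "restrict y (cone_semigroup N (face_cone u I2)) = z2"
    using restrict_eq_chart_point[OF _ y(1)] y(2) c chart_point_chart_coords[OF z1] chart_point_chart_coords[OF z2] by auto
  then show ?thesis using y(1) by blast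
qed

end

lemma face_cone_Int:
  assumes "dual_bases u d"
  shows "face_cone u I \<inter> face_cone u J = face_cone u (I \<inter> J)"
  unfolding set_eq_iff Int_iff face_cone_iff[OF assms] by auto

section \<open>Gluing the charts of a smooth fan\<close>

lemma topspace_quotient_topology: "topspace (quotient_topology X f) = f ` topspace X"
proof -
  have "{x \<in> topspace X. f x \<in> f ` topspace X} = topspace X" by auto
  then have "openin (quotient_topology X f) (f ` topspace X)" by (simp add: openin_quotient_topology)
  then have "f ` topspace X \<subseteq> topspace (quotient_topology X f)" by (rule openin_subset)
  moreover have "topspace (quotient_topology X f) \<subseteq> f ` topspace X"
    using openin_topspace[of "quotient_topology X f"] unfolding openin_quotient_topology by simp
  ultimately show ?thesis by simp
qed

text \<open>What the gluing uses of a fan: a single lattice basis adapted to \<sigma> exhibits its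
  intersections with all cones of the fan as faces, and intersections stay in the fan.\<close>

locale smooth_fan =
  fixes N :: "(real ^ 3) set" and \<Sigma> :: "(real ^ 3) set set"
  assumes charts: "\<sigma> \<in> \<Sigma> \<Longrightarrow> \<exists>u d J. smooth_basis N u d \<and> \<sigma> = face_cone u J \<and>
                     (\<forall>\<sigma>'\<in>\<Sigma>. \<exists>I\<subseteq>J. \<sigma> \<inter> \<sigma>' = face_cone u I)"
    and Int_closed: "\<sigma> \<in> \<Sigma> \<Longrightarrow> \<sigma>' \<in> \<Sigma> \<Longrightarrow> \<sigma> \<inter> \<sigma>' \<in> \<Sigma>"
begin

abbreviation res :: "(real ^ 3) set \<Rightarrow> (real ^ 3 \<Rightarrow> complex) \<Rightarrow> real ^ 3 \<Rightarrow> complex" where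
  "res \<sigma> z \<equiv> restrict z (cone_semigroup N \<sigma>)"

definition glued :: "(real ^ 3) set \<Rightarrow> (real ^ 3 \<Rightarrow> complex) \<Rightarrow> (real ^ 3) set \<Rightarrow> (real ^ 3 \<Rightarrow> complex) \<Rightarrow> bool" where
  "glued \<sigma> x \<sigma>' x' \<longleftrightarrow> (\<exists>z \<in> topspace (affine_toric N (\<sigma> \<inter> \<sigma>')). x = res \<sigma> z \<and> x' = res \<sigma>' z)"

lemma res_self: "x \<in> topspace (affine_toric N \<sigma>) \<Longrightarrow> res \<sigma> x = x"
  by (simp add: topspace_affine_toric extensional_restrict)

lemma res_res: "\<tau> \<subseteq> \<sigma> \<Longrightarrow> res \<sigma> (res \<tau> z) = res \<sigma> z"
  using cone_semigroup_antimono[of \<tau> \<sigma> N] by (auto simp: restrict_def fun_eq_iff)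

lemma glued_refl: "x \<in> topspace (affine_toric N \<sigma>) \<Longrightarrow> glued \<sigma> x \<sigma> x"
  unfolding glued_def using res_self by force

lemma glued_sym: "glued \<sigma> x \<sigma>' x' \<Longrightarrow> glued \<sigma>' x' \<sigma> x"
  unfolding glued_def by (metis Int_commute)

text \<open>The middle chart decides: \<open>z1\<close> and \<open>z2\<close> both restrict to
  \<open>x'\<close> there, so they have a common extension \<open>y\<close> over the triple
  intersection, and the restriction of \<open>y\<close> to the outer intersection relates
  \<open>x\<close> and \<open>x''\<close>.\<close>

lemma glued_trans:
  assumes "\<sigma> \<in> \<Sigma>" "\<sigma>' \<in> \<Sigma>" "\<sigma>'' \<in> \<Sigma>" "glued \<sigma> x \<sigma>' x'" "glued \<sigma>' x' \<sigma>'' x''"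
  shows "glued \<sigma> x \<sigma>'' x''"
proof -
  obtain u d J where sb: "smooth_basis N u d" and J: "\<sigma>' = face_cone u J"
    and faces: "\<And>\<tau>. \<tau> \<in> \<Sigma> \<Longrightarrow> \<exists>I\<subseteq>J. \<sigma>' \<inter> \<tau> = face_cone u I"
    using charts[OF assms(2)] by blast
  obtain I1 where I1: "I1 \<subseteq> J" "\<sigma> \<inter> \<sigma>' = face_cone u I1" using faces[OF assms(1)] by (auto simp: Int_commute)
  obtain I2 where I2: "I2 \<subseteq> J" "\<sigma>' \<inter> \<sigma>'' = face_cone u I2" using faces[OF assms(3)] by auto
  have I12: "\<sigma> \<inter> \<sigma>' \<inter> \<sigma>'' = face_cone u (I1 \<inter> I2)"
    using face_cone_Int[of u d I1 I2] sb I1(2)[symmetric] I2(2)[symmetric] by (auto simp: smooth_basis_def)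
  obtain z1 where z1: "z1 \<in> topspace (affine_toric N (\<sigma> \<inter> \<sigma>'))" "x = res \<sigma> z1" "x' = res \<sigma>' z1"
    using assms(4) by (auto simp: glued_def)
  obtain z2 where z2: "z2 \<in> topspace (affine_toric N (\<sigma>' \<inter> \<sigma>''))" "x' = res \<sigma>' z2" "x'' = res \<sigma>'' z2"
    using assms(5) by (auto simp: glued_def)
  obtain y where y: "y \<in> topspace (affine_toric N (\<sigma> \<inter> \<sigma>' \<inter> \<sigma>''))" "res (\<sigma> \<inter> \<sigma>') y = z1" "res (\<sigma>' \<inter> \<sigma>'') y = z2"
    using common_extension[OF sb I1(1) I2(1), of z1 z2] z1 z2 I1(2) I2(2) I12 J by metis
  define z where "z = res (\<sigma> \<inter> \<sigma>'') y"
  have "z \<in> topspace (affine_toric N (\<sigma> \<inter> \<sigma>''))"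
    unfolding z_def by (rule restrict_affine_toric[OF y(1)]) auto
  moreover have "res \<sigma> z = x" unfolding z_def z1(2) y(2)[symmetric] by (simp only: res_res Int_lower1)
  moreover have "res \<sigma>'' z = x''" unfolding z_def z2(3) y(3)[symmetric] by (simp only: res_res Int_lower2)
  ultimately show ?thesis unfolding glued_def by metis
qed

abbreviation point_class :: "(real ^ 3) set \<times> (real ^ 3 \<Rightarrow> complex) \<Rightarrow> ((real ^ 3) set \<times> (real ^ 3 \<Rightarrow> complex)) set" where
  "point_class p \<equiv> (toric_glue N `` {p}) \<inter> (\<Sigma> \<times> UNIV)"

lemma mem_point_class: "(\<sigma>', x') \<in> point_class (\<sigma>, x) \<longleftrightarrow> \<sigma>' \<in> \<Sigma> \<and> glued \<sigma> x \<sigma>' x'"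
  unfolding toric_glue_def glued_def by auto

lemma point_class_eq_iff:
  assumes "\<sigma> \<in> \<Sigma>" "\<sigma>' \<in> \<Sigma>" "x' \<in> topspace (affine_toric N \<sigma>')"
  shows "point_class (\<sigma>, x) = point_class (\<sigma>', x') \<longleftrightarrow> glued \<sigma> x \<sigma>' x'"
proof
  assume "point_class (\<sigma>, x) = point_class (\<sigma>', x')"
  moreover have "(\<sigma>', x') \<in> point_class (\<sigma>', x')" using assms mem_point_class glued_refl by blast
  ultimately show "glued \<sigma> x \<sigma>' x'" using mem_point_class by blast
next
  assume g: "glued \<sigma> x \<sigma>' x'"
  have e: "(\<tau>, y) \<in> point_class (\<sigma>, x) \<longleftrightarrow> (\<tau>, y) \<in> point_class (\<sigma>', x')" for \<tau> y
    unfolding mem_point_class using g assms glued_trans glued_sym by blast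
  show "point_class (\<sigma>, x) = point_class (\<sigma>', x')"
  proof (rule Set.set_eqI)
    fix p
    show "p \<in> point_class (\<sigma>, x) \<longleftrightarrow> p \<in> point_class (\<sigma>', x')"
      using e[of "fst p" "snd p"] by simp
  qed
qed

definition chart_image :: "(real ^ 3) set \<Rightarrow> ((real ^ 3) set \<times> (real ^ 3 \<Rightarrow> complex)) set set" where
  "chart_image \<sigma> = (\<lambda>x. point_class (\<sigma>, x)) ` topspace (affine_toric N \<sigma>)"

lemma topspace_toric_variety: "topspace (toric_variety N \<Sigma>) = (\<Union>\<sigma>\<in>\<Sigma>. chart_image \<sigma>)"
  unfolding toric_variety_def topspace_quotient_topology by (auto simp: chart_image_def)

lemma continuous_map_chart:
  assumes "\<sigma> \<in> \<Sigma>"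
  shows "continuous_map (affine_toric N \<sigma>) (toric_variety N \<Sigma>) (\<lambda>x. point_class (\<sigma>, x))"
  unfolding continuous_map_def
proof (intro conjI allI impI)
  show "(\<lambda>x. point_class (\<sigma>, x)) \<in> topspace (affine_toric N \<sigma>) \<rightarrow> topspace (toric_variety N \<Sigma>)"
    using assms unfolding topspace_toric_variety by (auto simp: chart_image_def)
  fix O' assume "openin (toric_variety N \<Sigma>) O'"
  then have "openin (sum_topology (affine_toric N) \<Sigma>)
      {p \<in> topspace (sum_topology (affine_toric N) \<Sigma>). point_class p \<in> O'}"
    by (simp add: toric_variety_def openin_quotient_topology)
  then have "openin (affine_toric N \<sigma>) {x. (\<sigma>, x) \<in> {p \<in> topspace (sum_topology (affine_toric N) \<Sigma>). point_class p \<in> O'}}"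
    using assms unfolding openin_sum_topology by blast
  then show "openin (affine_toric N \<sigma>) {x \<in> topspace (affine_toric N \<sigma>). point_class (\<sigma>, x) \<in> O'}"
    using assms by simp
qed

text \<open>Seen in another chart, the image of \<open>W\<close> is the restriction of the part of
  the overlap that lies over \<open>W\<close>. Restrictions along faces are open, hence so is the
  full preimage in the disjoint sum.\<close>

lemma open_map_chart:
  assumes \<sigma>: "\<sigma> \<in> \<Sigma>"
  shows "open_map (affine_toric N \<sigma>) (toric_variety N \<Sigma>) (\<lambda>x. point_class (\<sigma>, x))"
  unfolding open_map_def
proof (intro allI impI)
  fix W assume W: "openin (affine_toric N \<sigma>) W"
  let ?V = "(\<lambda>x. point_class (\<sigma>, x)) ` W"
  let ?T = "sum_topology (affine_toric N) \<Sigma>"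
  have Wsub: "W \<subseteq> topspace (affine_toric N \<sigma>)" using W openin_subset by blast
  have "openin (affine_toric N \<sigma>') {x'. (\<sigma>', x') \<in> {p \<in> topspace ?T. point_class p \<in> ?V}}" if \<sigma>': "\<sigma>' \<in> \<Sigma>" for \<sigma>'
  proof -
    obtain u d J I where sb: "smooth_basis N u d" and J: "\<sigma>' = face_cone u J" and I: "I \<subseteq> J" "\<sigma>' \<inter> \<sigma> = face_cone u I"
      using charts[OF \<sigma>'] \<sigma> by blast
    let ?Z = "{z \<in> topspace (affine_toric N (\<sigma> \<inter> \<sigma>')). res \<sigma> z \<in> W}"
    have "openin (affine_toric N (\<sigma> \<inter> \<sigma>')) ?Z"
      using continuous_map_restrict_affine_toric[of "\<sigma> \<inter> \<sigma>'" \<sigma> N] W by (auto simp: continuous_map_def)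
    then have "openin (affine_toric N \<sigma>') (res \<sigma>' ` ?Z)"
      using open_map_restrict_face[OF sb I(1)] I(2) J by (simp add: open_map_def Int_commute)
    moreover have "{x'. (\<sigma>', x') \<in> {p \<in> topspace ?T. point_class p \<in> ?V}} = res \<sigma>' ` ?Z"
    proof (intro equalityI subsetI)
      fix x' assume "x' \<in> {x'. (\<sigma>', x') \<in> {p \<in> topspace ?T. point_class p \<in> ?V}}"
      then obtain x where x: "x' \<in> topspace (affine_toric N \<sigma>')" "x \<in> W" "point_class (\<sigma>', x') = point_class (\<sigma>, x)"
        by auto
      then have "glued \<sigma> x \<sigma>' x'" using point_class_eq_iff[OF \<sigma> \<sigma>' x(1), of x] by simp
      then show "x' \<in> res \<sigma>' ` ?Z" using x(2) by (auto simp: glued_def)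
    next
      fix x' assume "x' \<in> res \<sigma>' ` ?Z"
      then obtain z where z: "z \<in> topspace (affine_toric N (\<sigma> \<inter> \<sigma>'))" "res \<sigma> z \<in> W" "x' = res \<sigma>' z" by auto
      have x': "x' \<in> topspace (affine_toric N \<sigma>')" unfolding z(3) by (rule restrict_affine_toric[OF z(1)]) auto
      have "glued \<sigma> (res \<sigma> z) \<sigma>' x'" using z by (auto simp: glued_def)
      then have "point_class (\<sigma>', x') = point_class (\<sigma>, res \<sigma> z)" using point_class_eq_iff[OF \<sigma> \<sigma>' x', of "res \<sigma> z"] by simp
      then show "x' \<in> {x'. (\<sigma>', x') \<in> {p \<in> topspace ?T. point_class p \<in> ?V}}"
        using x' z(2) \<sigma>' by auto
    qed
    ultimately show ?thesis by simp
  qed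
  then have "openin ?T {p \<in> topspace ?T. point_class p \<in> ?V}"
    unfolding openin_sum_topology by auto
  moreover have "?V \<subseteq> point_class ` topspace ?T" using Wsub \<sigma> by auto
  ultimately show "openin (toric_variety N \<Sigma>) ?V"
    unfolding toric_variety_def openin_quotient_topology by simp
qed

lemma inj_on_chart:
  assumes "\<sigma> \<in> \<Sigma>"
  shows "inj_on (\<lambda>x. point_class (\<sigma>, x)) (topspace (affine_toric N \<sigma>))"
proof (rule inj_onI)
  fix x y assume x: "x \<in> topspace (affine_toric N \<sigma>)" and y: "y \<in> topspace (affine_toric N \<sigma>)"
    and eq: "point_class (\<sigma>, x) = point_class (\<sigma>, y)"
  then have "glued \<sigma> x \<sigma> y" using point_class_eq_iff[OF assms assms y] by simp
  then show "x = y" by (auto simp: glued_def)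
qed

lemma openin_chart_image: "\<sigma> \<in> \<Sigma> \<Longrightarrow> openin (toric_variety N \<Sigma>) (chart_image \<sigma>)"
  using open_map_chart[of \<sigma>] unfolding open_map_def chart_image_def by blast

lemma chart_image_homeomorphic:
  assumes "\<sigma> \<in> \<Sigma>"
  shows "subtopology (toric_variety N \<Sigma>) (chart_image \<sigma>) homeomorphic_space affine_toric N \<sigma>"
proof -
  have "embedding_map (affine_toric N \<sigma>) (toric_variety N \<Sigma>) (\<lambda>x. point_class (\<sigma>, x))"
    using assms by (intro injective_open_imp_embedding_map continuous_map_chart open_map_chart inj_on_chart)
  then show ?thesis
    unfolding embedding_map_def chart_image_def[symmetric]
    using homeomorphic_map_imp_homeomorphic_space homeomorphic_space_sym by blast
qed

text \<open>A class with representatives in both charts is, by gluing, represented over the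
  intersection of the cones; conversely, restriction carries such a point into both charts.\<close>

lemma chart_image_Int:
  assumes \<sigma>: "\<sigma> \<in> \<Sigma>" and \<sigma>': "\<sigma>' \<in> \<Sigma>"
  shows "chart_image \<sigma> \<inter> chart_image \<sigma>' = chart_image (\<sigma> \<inter> \<sigma>')"
proof (intro equalityI subsetI)
  note \<tau> = Int_closed[OF \<sigma> \<sigma>']
  fix P assume "P \<in> chart_image \<sigma> \<inter> chart_image \<sigma>'"
  then obtain x x' where x: "x \<in> topspace (affine_toric N \<sigma>)" "x' \<in> topspace (affine_toric N \<sigma>')"
    "P = point_class (\<sigma>, x)" "P = point_class (\<sigma>', x')" by (auto simp: chart_image_def)
  then have "glued \<sigma> x \<sigma>' x'" using point_class_eq_iff[OF \<sigma> \<sigma>' x(2), of x] by simp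
  then obtain z where z: "z \<in> topspace (affine_toric N (\<sigma> \<inter> \<sigma>'))" "x = res \<sigma> z" by (auto simp: glued_def)
  have e: "\<sigma> \<inter> (\<sigma> \<inter> \<sigma>') = \<sigma> \<inter> \<sigma>'" by auto
  have "glued \<sigma> x (\<sigma> \<inter> \<sigma>') z" unfolding glued_def e using z res_self[OF z(1)] by (intro bexI[of _ z]) auto
  then have "P = point_class (\<sigma> \<inter> \<sigma>', z)" using point_class_eq_iff[OF \<sigma> \<tau> z(1)] x(3) by simp
  then show "P \<in> chart_image (\<sigma> \<inter> \<sigma>')" using z(1) by (auto simp: chart_image_def)
next
  note \<tau> = Int_closed[OF \<sigma> \<sigma>']
  fix P assume "P \<in> chart_image (\<sigma> \<inter> \<sigma>')"
  then obtain z where z: "z \<in> topspace (affine_toric N (\<sigma> \<inter> \<sigma>'))" "P = point_class (\<sigma> \<inter> \<sigma>', z)"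
    by (auto simp: chart_image_def)
  have "P \<in> chart_image \<rho>" if \<rho>: "\<rho> \<in> \<Sigma>" "\<sigma> \<inter> \<sigma>' \<subseteq> \<rho>" for \<rho>
  proof -
    have e: "\<sigma> \<inter> \<sigma>' \<inter> \<rho> = \<sigma> \<inter> \<sigma>'" using \<rho> by auto
    have r: "res \<rho> z \<in> topspace (affine_toric N \<rho>)" by (rule restrict_affine_toric[OF z(1) \<rho>(2)])
    have "glued (\<sigma> \<inter> \<sigma>') z \<rho> (res \<rho> z)" unfolding glued_def e using z(1) res_self[OF z(1)] by (intro bexI[of _ z]) auto
    then have "P = point_class (\<rho>, res \<rho> z)" using point_class_eq_iff[OF \<tau> \<rho>(1) r] z(2) by simp
    then show ?thesis using r by (auto simp: chart_image_def)
  qed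
  then show "P \<in> chart_image \<sigma> \<inter> chart_image \<sigma>'" using \<sigma> \<sigma>' by auto
qed

end

section \<open>The Fujiki-Oka subdivision in the Gorenstein case\<close>

text \<open>The discrepancy of a ray is the height of its primitive element minus 1, so crepancy
  amounts to height 1.\<close>

definition height :: "real ^ 3 \<Rightarrow> real" where
  "height x = x $ 1 + x $ 2 + x $ 3"

lemma height_eq_inner: "height x = 1 \<bullet> x"
  by (simp add: height_def inner_vec_def sum_3)

lemma height_sum: "height (\<Sum>i\<in>A. t i *\<^sub>R u i) = (\<Sum>i\<in>A. t i * height (u i))"
  by (simp add: height_eq_inner inner_sum_right)

text \<open>For square matrices a left inverse is a right inverse, so the duality relations alone
  give the expansion.\<close>

lemma dual_basesI:
  assumes "\<And>i j. d i \<bullet> u j = (if i = j then 1 else 0)"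
  shows "dual_bases u d"
proof -
  define D :: "real ^ 3 ^ 3" where "D = (\<chi> i. d i)"
  define U :: "real ^ 3 ^ 3" where "U = (\<chi> k j. u j $ k)"
  have "D ** U = mat 1"
    using assms by (simp add: vec_eq_iff matrix_matrix_mult_def D_def U_def mat_def inner_vec_def)
  then have UD: "U ** D = mat 1" using matrix_left_right_inverse by blast
  have "x = (\<Sum>i\<in>UNIV. (d i \<bullet> x) *\<^sub>R u i)" for x
  proof -
    have "x = U *v (D *v x)" by (simp add: matrix_vector_mul_assoc UD)
    also have "\<dots> = (\<Sum>i\<in>UNIV. (D *v x) $ i *s column i U)" by (rule matrix_mult_sum)
    also have "\<dots> = (\<Sum>i\<in>UNIV. (d i \<bullet> x) *\<^sub>R u i)"
      by (intro sum.cong) (auto simp: matrix_vector_mult_def D_def U_def column_def inner_vec_def vec_eq_iff)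
    finally show ?thesis .
  qed
  then show ?thesis using assms unfolding dual_bases_def by blast
qed

lemma dual_bases_axis: "dual_bases (\<lambda>i. axis i 1) (\<lambda>i. axis i 1)"
  by (intro dual_basesI) (simp add: inner_axis_axis)

section \<open>The lattice of a cone under star subdivision\<close>

definition lattice_span :: "(3 \<Rightarrow> real ^ 3) \<Rightarrow> real ^ 3 \<Rightarrow> (real ^ 3) set" where
  "lattice_span u w = {(\<Sum>i\<in>UNIV. of_int (k i) *\<^sub>R u i) + of_int l *\<^sub>R w | (k :: 3 \<Rightarrow> int) (l :: int). True}"

definition additive_subgroup :: "'a::ab_group_add set \<Rightarrow> bool" where
  "additive_subgroup G \<longleftrightarrow> 0 \<in> G \<and> (\<forall>x\<in>G. \<forall>y\<in>G. x - y \<in> G)"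

lemma additive_subgroup_uminus: "additive_subgroup G \<Longrightarrow> x \<in> G \<Longrightarrow> - x \<in> G"
  unfolding additive_subgroup_def by (metis diff_0)

lemma additive_subgroup_add: "additive_subgroup G \<Longrightarrow> x \<in> G \<Longrightarrow> y \<in> G \<Longrightarrow> x + y \<in> G"
  using additive_subgroup_uminus[of G y] unfolding additive_subgroup_def by (metis diff_minus_eq_add)

lemma additive_subgroup_of_int:
  fixes G :: "'a::real_vector set"
  assumes G: "additive_subgroup G" and x: "x \<in> G"
  shows "of_int k *\<^sub>R x \<in> G"
proof -
  have nat: "of_nat n *\<^sub>R x \<in> G" for n
  proof (induction n)
    case 0
    then show ?case using G by (simp add: additive_subgroup_def)
  next
    case (Suc n)
    then show ?case using additive_subgroup_add[OF G x Suc] by (simp add: algebra_simps)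
  qed
  show ?thesis
  proof (cases "0 \<le> k")
    case True
    then show ?thesis using nat[of "nat k"] by simp
  next
    case False
    then show ?thesis using additive_subgroup_uminus[OF G nat[of "nat (- k)"]] by simp
  qed
qed

lemma additive_subgroup_sum:
  assumes "additive_subgroup G" "\<And>i. i \<in> A \<Longrightarrow> f i \<in> G"
  shows "sum f A \<in> G"
proof (cases "finite A")
  case True
  then show ?thesis using assms(2)
    by (induction A) (use assms(1) additive_subgroup_add[OF assms(1)] in \<open>auto simp: additive_subgroup_def\<close>)
qed (use assms in \<open>simp add: additive_subgroup_def\<close>)

lemma additive_subgroup_lattice_span: "additive_subgroup (lattice_span u w)"
  unfolding additive_subgroup_def
proof (intro conjI ballI)
  show "0 \<in> lattice_span u w"
    unfolding lattice_span_def by (intro CollectI exI[of _ "\<lambda>_. 0"] exI[of _ 0]) simp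
  fix x y assume "x \<in> lattice_span u w" "y \<in> lattice_span u w"
  then obtain k l k' l' where "x = (\<Sum>i\<in>UNIV. of_int (k i) *\<^sub>R u i) + of_int l *\<^sub>R w"
    "y = (\<Sum>i\<in>UNIV. of_int (k' i) *\<^sub>R u i) + of_int l' *\<^sub>R w"
    unfolding lattice_span_def by blast
  then have "x - y = (\<Sum>i\<in>UNIV. of_int (k i - k' i) *\<^sub>R u i) + of_int (l - l') *\<^sub>R w"
    by (simp add: algebra_simps sum_subtractf)
  then show "x - y \<in> lattice_span u w"
    unfolding lattice_span_def by (intro CollectI exI[of _ "\<lambda>i. k i - k' i"] exI[of _ "l - l'"]) simp
qed

lemma lattice_span_generators: "u i \<in> lattice_span u w" "w \<in> lattice_span u w"
proof -
  have "(\<Sum>j\<in>UNIV. of_int (if j = i then 1 else 0) *\<^sub>R u j) = (\<Sum>j\<in>UNIV. if j = i then u j else 0)"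
    by (intro sum.cong) auto
  then show "u i \<in> lattice_span u w"
    unfolding lattice_span_def by (intro CollectI exI[of _ "\<lambda>j. if j = i then 1 else 0"] exI[of _ 0]) simp
  show "w \<in> lattice_span u w"
    unfolding lattice_span_def by (intro CollectI exI[of _ "\<lambda>_. 0"] exI[of _ 1]) simp
qed

lemma lattice_span_subset:
  assumes "additive_subgroup G" "\<And>i. u i \<in> G" "w \<in> G"
  shows "lattice_span u w \<subseteq> G"
  unfolding lattice_span_def using assms
  by (auto intro!: additive_subgroup_add additive_subgroup_sum additive_subgroup_of_int)

lemma fraction_point_inner:
  assumes "dual_bases u d"
  shows "d j \<bullet> fraction_point u (c, s) = of_int (c $ j) / of_int s"
  unfolding fraction_point_def by (simp add: dual_bases_coord[OF assms])

text \<open>Solving w = (1/s) sum c_j u_j for \<open>u i\<close> rewrites a point in terms of the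
  new generators; these functionals are its new coordinates.\<close>

definition subdivided_dual :: "(3 \<Rightarrow> real ^ 3) \<Rightarrow> int ^ 3 \<Rightarrow> int \<Rightarrow> 3 \<Rightarrow> 3 \<Rightarrow> real ^ 3" where
  "subdivided_dual d c s i j =
     (if j = i then (of_int s / of_int (c $ i)) *\<^sub>R d i else d j - (of_int (c $ j) / of_int (c $ i)) *\<^sub>R d i)"

lemma dual_bases_subdivide:
  assumes db: "dual_bases u d" and "c $ i \<noteq> 0" "s \<noteq> 0"
  shows "dual_bases (u(i := fraction_point u (c, s))) (subdivided_dual d c s i)"
proof (rule dual_basesI)
  fix j k
  have du: "d a \<bullet> u b = (if a = b then 1 else 0)" for a b using db by (simp add: dual_bases_def)
  show "subdivided_dual d c s i j \<bullet> (u(i := fraction_point u (c, s))) k = (if j = k then 1 else 0)"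
    using assms(2,3)
    by (auto simp: subdivided_dual_def inner_diff_left fraction_point_inner[OF db] du)
qed

text \<open>The remainder map is made so that the new fraction point equals the negative of
  \<open>u i\<close> modulo integer combinations of the new generators. Hence old and new data
  generate the same group.\<close>

lemma lattice_span_subdivide:
  fixes u :: "3 \<Rightarrow> real ^ 3"
  assumes "c $ i \<noteq> 0" "s \<noteq> 0"
  defines "w \<equiv> fraction_point u (c, s)"
  shows "lattice_span (u(i := w)) (fraction_point (u(i := w)) (remainder_map i (c, s))) = lattice_span u w"
proof -
  define c' where "c' = fst (remainder_map i (c, s))"
  define w' where "w' = fraction_point (u(i := w)) (remainder_map i (c, s))"
  \<comment> \<open>Quotients of the divisions whose remainders form the new label; they are the
    coefficients of that integer combination.\<close>
  define q where "q j = (if j = i then (- s) div (c $ i) else (c $ j) div (c $ i))" for j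
  have snd: "snd (remainder_map i (c, s)) = c $ i" by (simp add: remainder_map_def)
  have c': "of_int (c' $ j) = of_int (if j = i then - s else c $ j) - of_int (q j) * (of_int (c $ i) :: real)" for j
    unfolding of_int_mult[symmetric] of_int_diff[symmetric] of_int_eq_iff
    by (simp add: c'_def remainder_map_def q_def minus_div_mult_eq_mod)
  have sw: "of_int s *\<^sub>R w = (\<Sum>j\<in>UNIV. of_int (c $ j) *\<^sub>R u j)"
    using assms(2) by (simp add: w_def fraction_point_def scaleR_sum_right)
  have ci: "of_int (c $ i) \<noteq> (0 :: real)" using assms(1) by simp
  have "of_int (c $ i) *\<^sub>R w' = (\<Sum>j\<in>UNIV. of_int (c' $ j) *\<^sub>R (u(i := w)) j)"
    unfolding w'_def fraction_point_def using snd ci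
    by (simp add: scaleR_sum_right c'_def case_prod_beta)
  also have "\<dots> = (\<Sum>j\<in>UNIV. of_int (if j = i then - s else c $ j) *\<^sub>R (u(i := w)) j) -
      of_int (c $ i) *\<^sub>R (\<Sum>j\<in>UNIV. of_int (q j) *\<^sub>R (u(i := w)) j)"
    unfolding c' by (simp add: scaleR_diff_left sum_subtractf scaleR_sum_right mult.commute)
  also have "(\<Sum>j\<in>UNIV. of_int (if j = i then - s else c $ j) *\<^sub>R (u(i := w)) j) =
      - (of_int s *\<^sub>R w) + (\<Sum>j\<in>UNIV - {i}. of_int (c $ j) *\<^sub>R u j)"
    by (subst sum.remove[of _ i]) (auto intro!: sum.cong)
  \<comment> \<open>Because s w is the sum of all c_j u_j, only the term of \<open>u i\<close>
    survives.\<close>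
  also have "\<dots> = - (of_int (c $ i) *\<^sub>R u i)"
    unfolding sw by (subst sum.remove[of UNIV i]) auto
  finally have "of_int (c $ i) *\<^sub>R w' = of_int (c $ i) *\<^sub>R (- u i - (\<Sum>j\<in>UNIV. of_int (q j) *\<^sub>R (u(i := w)) j))"
    by (simp add: scaleR_diff_right)
  then have w': "w' = - u i - (\<Sum>j\<in>UNIV. of_int (q j) *\<^sub>R (u(i := w)) j)"
    using ci by (metis scaleR_cancel_left)
  have "lattice_span (u(i := w)) w' = lattice_span u w"
  proof
    let ?L = "lattice_span u w"
    have G: "additive_subgroup ?L" by (rule additive_subgroup_lattice_span)
    have g: "(u(i := w)) j \<in> ?L" for j using lattice_span_generators(1)[of u j w] lattice_span_generators(2)[of w u] by simp
    have "w' \<in> ?L"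
      unfolding w' using G additive_subgroup_uminus[OF G] lattice_span_generators(1)[of u i w]
        additive_subgroup_sum[OF G, of UNIV "\<lambda>j. of_int (q j) *\<^sub>R (u(i := w)) j"] additive_subgroup_of_int[OF G g]
      by (auto simp: additive_subgroup_def)
    then show "lattice_span (u(i := w)) w' \<subseteq> ?L" using G g by (intro lattice_span_subset) auto
  next
    let ?L = "lattice_span (u(i := w)) w'"
    have G: "additive_subgroup ?L" by (rule additive_subgroup_lattice_span)
    have g: "(u(i := w)) j \<in> ?L" for j by (rule lattice_span_generators)
    have "u i = - w' - (\<Sum>j\<in>UNIV. of_int (q j) *\<^sub>R (u(i := w)) j)" unfolding w' by simp
    moreover have "- w' \<in> ?L" using additive_subgroup_uminus[OF G] lattice_span_generators(2) by blast
    moreover have "(\<Sum>j\<in>UNIV. of_int (q j) *\<^sub>R (u(i := w)) j) \<in> ?L"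
      by (intro additive_subgroup_sum[OF G] additive_subgroup_of_int[OF G] g)
    ultimately have ui: "u i \<in> ?L" using G by (auto simp: additive_subgroup_def)
    have "u j \<in> ?L" for j using ui g[of j] by (cases "j = i") auto
    moreover have "w \<in> ?L" using g[of i] by simp
    ultimately show "lattice_span u w \<subseteq> ?L" using G by (intro lattice_span_subset) auto
  qed
  then show ?thesis by (simp add: w'_def)
qed

text \<open>In the Gorenstein case every label that occurs is smooth or of the form \<open>(1, a, b) / (1 + a + b)\<close>.\<close>

definition gorenstein_label :: "fraction3 \<Rightarrow> bool" where
  "gorenstein_label F \<longleftrightarrow> fst F $ 1 = 1 \<and> 0 \<le> fst F $ 2 \<and> 0 \<le> fst F $ 3 \<and>
     snd F = 1 + fst F $ 2 + fst F $ 3 \<and> 2 \<le> snd F"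

text \<open>The numerators of the new label are 1, \<open>a - 1 - b mod a\<close> and
  \<open>b mod a\<close>, whose sum is the new denominator \<open>a\<close>; this is why the
  Gorenstein shape persists.\<close>

lemma mod_neg_sum:
  fixes a b :: int
  assumes "0 < a"
  shows "(- (1 + a + b)) mod a = a - 1 - b mod a"
proof -
  have "(- (1 + a + b)) mod a = ((a - 1 - b mod a) + a * (- 2 - b div a)) mod a"
    by (rule arg_cong[where f = "\<lambda>z. z mod a"]) (simp add: algebra_simps minus_mod_eq_mult_div [symmetric])
  also have "\<dots> = (a - 1 - b mod a) mod a" by simp
  also have "\<dots> = a - 1 - b mod a" using assms pos_mod_sign[of a b] pos_mod_bound[of a b] by (intro mod_pos_pos_trivial) linarith+
  finally show ?thesis .
qed

text \<open>A numerator 1 leaves only zero remainders, so that branch is smooth at once. Otherwise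
  \<open>i\<close> is 2 or 3, and the first numerator stays 1 modulo a number that is at least 2.
  The drop of the denominator is the measure of the later inductions.\<close>

lemma remainder_map_gorenstein:
  assumes F: "gorenstein_label F" and i: "fst F $ i \<noteq> 0"
  shows "remainder_map i F = (0, 1) \<or> gorenstein_label (remainder_map i F)"
    and "snd (remainder_map i F) = fst F $ i" and "0 < fst F $ i" and "fst F $ i < snd F"
proof -
  obtain c s where Fcs: "F = (c, s)" by force
  have c: "c $ 1 = 1" "0 \<le> c $ 2" "0 \<le> c $ 3" "s = 1 + c $ 2 + c $ 3" "2 \<le> s"
    using F Fcs by (auto simp: gorenstein_label_def)
  show "snd (remainder_map i F) = fst F $ i" by (simp add: Fcs remainder_map_def)
  show pos: "0 < fst F $ i" using i c Fcs exhaust_3[of i] by auto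
  show "fst F $ i < snd F" using i c Fcs exhaust_3[of i] by auto
  show "remainder_map i F = (0, 1) \<or> gorenstein_label (remainder_map i F)"
  proof (cases "c $ i = 1")
    case True
    then show ?thesis by (simp add: Fcs remainder_map_def vec_eq_iff)
  next
    case False
    then have ci: "2 \<le> c $ i" and i23: "i = 2 \<or> i = 3" using pos Fcs c exhaust_3[of i] by auto
    from i23 have "gorenstein_label (remainder_map i F)"
    proof
      assume i: "i = 2"
      then show ?thesis
        using ci c mod_neg_sum[of "c $ 2" "c $ 3"]
        by (auto simp: gorenstein_label_def Fcs remainder_map_def)
    next
      assume i: "i = 3"
      then show ?thesis
        using ci c mod_neg_sum[of "c $ 3" "c $ 2"]
        by (auto simp: gorenstein_label_def Fcs remainder_map_def algebra_simps)
    qed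
    then show ?thesis by simp
  qed
qed

section \<open>The subdivision process and its final cones\<close>

inductive subdivision_step ::
    "(3 \<Rightarrow> real ^ 3) \<times> fraction3 \<Rightarrow> (3 \<Rightarrow> real ^ 3) \<times> fraction3 \<Rightarrow> bool" where
  "\<lbrakk>F \<noteq> (0, 1); fst F $ i \<noteq> 0\<rbrakk> \<Longrightarrow>
     subdivision_step (u, F) (u(i := fraction_point u F), remainder_map i F)"

definition final_cones :: "(3 \<Rightarrow> real ^ 3) \<times> fraction3 \<Rightarrow> (3 \<Rightarrow> real ^ 3) set" where
  "final_cones X = {v. subdivision_step\<^sup>*\<^sup>* X (v, (0, 1))}"

text \<open>As a reachability relation the process can be started at any intermediate cone, as the
  inductions on the denominator require.\<close>

lemma fujiki_oka_cones_eq: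
  "fujiki_oka_cones r a2 a3 = {X. subdivision_step\<^sup>*\<^sup>* (\<lambda>i. axis i 1, initial_fraction r a2 a3) X}" (is "_ = ?R")
proof (intro equalityI subsetI)
  fix X assume "X \<in> fujiki_oka_cones r a2 a3"
  then have "(fst X, snd X) \<in> fujiki_oka_cones r a2 a3" by simp
  then have "(fst X, snd X) \<in> ?R"
  proof (induction rule: fujiki_oka_cones.induct)
    case (subdivide u F i)
    then have "subdivision_step\<^sup>*\<^sup>* (\<lambda>i. axis i 1, initial_fraction r a2 a3) (u, F)" by simp
    moreover have "subdivision_step (u, F) (u(i := fraction_point u F), remainder_map i F)"
      using subdivide by (intro subdivision_step.intros)
    ultimately show ?case unfolding mem_Collect_eq by (rule rtranclp.rtrancl_into_rtrancl)
  qed auto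
  then show "X \<in> ?R" by simp
next
  fix X assume "X \<in> ?R"
  then have "subdivision_step\<^sup>*\<^sup>* (\<lambda>i. axis i 1, initial_fraction r a2 a3) X" by simp
  then show "X \<in> fujiki_oka_cones r a2 a3"
  proof induction
    case base
    then show ?case by (rule fujiki_oka_cones.start)
  next
    case (step Y Z)
    from step.hyps(2) step.IH show ?case
      by (cases rule: subdivision_step.cases) (auto intro: fujiki_oka_cones.subdivide)
  qed
qed

lemma final_cones_smooth: "final_cones (u, (0, 1)) = {u}"
proof -
  have "v = u" if "subdivision_step\<^sup>*\<^sup>* (u, (0, 1)) (v, (0, 1))" for v
    using that by (cases rule: converse_rtranclpE) (auto elim: subdivision_step.cases)
  then show ?thesis by (auto simp: final_cones_def)
qed

lemma final_cones_subdivide: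
  assumes "F \<noteq> (0, 1)"
  shows "final_cones (u, F) = (\<Union>i\<in>{i. fst F $ i \<noteq> 0}. final_cones (u(i := fraction_point u F), remainder_map i F))"
    (is "_ = ?R")
proof (intro equalityI subsetI)
  fix v assume "v \<in> final_cones (u, F)"
  then have "subdivision_step\<^sup>*\<^sup>* (u, F) (v, (0, 1))" by (simp add: final_cones_def)
  then show "v \<in> ?R"
  proof (cases rule: converse_rtranclpE)
    case base
    then show ?thesis using assms by simp
  next
    case (step Y)
    from step(1) obtain i where "fst F $ i \<noteq> 0" "Y = (u(i := fraction_point u F), remainder_map i F)"
      by (cases rule: subdivision_step.cases) auto
    then show ?thesis using step(2) by (auto simp: final_cones_def)
  qed
next
  fix v assume "v \<in> ?R"
  then obtain i where "fst F $ i \<noteq> 0" "subdivision_step\<^sup>*\<^sup>* (u(i := fraction_point u F), remainder_map i F) (v, (0, 1))"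
    by (auto simp: final_cones_def)
  then show "v \<in> final_cones (u, F)"
    unfolding final_cones_def using subdivision_step.intros[OF assms, of i u]
    by (auto intro: converse_rtranclp_into_rtranclp)
qed

text \<open>The invariant of the process: \<open>N\<close> stays fixed while generators and label
  change. The dual basis is carried along because it supplies the separating functionals.\<close>

definition gorenstein_node :: "(real ^ 3) set \<Rightarrow> (3 \<Rightarrow> real ^ 3) \<Rightarrow> (3 \<Rightarrow> real ^ 3) \<Rightarrow> fraction3 \<Rightarrow> bool" where
  "gorenstein_node N u d F \<longleftrightarrow> dual_bases u d \<and> (\<forall>i. height (u i) = 1) \<and>
     N = lattice_span u (fraction_point u F) \<and> (F = (0, 1) \<or> gorenstein_label F)"

text \<open>The new point is a weighted mean of the generators, since the numerators add up to the
  denominator.\<close>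

lemma height_fraction_point:
  assumes "\<And>i. height (u i) = 1" "gorenstein_label F"
  shows "height (fraction_point u F) = 1"
proof -
  obtain c s where F: "F = (c, s)" by force
  have "height (fraction_point u F) = (\<Sum>i\<in>UNIV. of_int (c $ i) / of_int s)"
    using assms(1) by (simp add: F fraction_point_def height_sum)
  also have "\<dots> = of_int (c $ 1 + c $ 2 + c $ 3) / of_int s" by (simp add: sum_3 add_divide_distrib)
  also have "\<dots> = 1" using assms(2) F by (auto simp: gorenstein_label_def)
  finally show ?thesis .
qed

lemma gorenstein_node_subdivide:
  assumes node: "gorenstein_node N u d F" and F: "F \<noteq> (0, 1)" and i: "fst F $ i \<noteq> 0"
  shows "gorenstein_node N (u(i := fraction_point u F)) (subdivided_dual d (fst F) (snd F) i) (remainder_map i F)"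
proof -
  have l: "gorenstein_label F" and db: "dual_bases u d" and h: "\<And>i. height (u i) = 1"
    and N: "N = lattice_span u (fraction_point u F)"
    using node F by (auto simp: gorenstein_node_def)
  have s: "snd F \<noteq> 0" using l by (auto simp: gorenstein_label_def)
  have "dual_bases (u(i := fraction_point u F)) (subdivided_dual d (fst F) (snd F) i)"
    using dual_bases_subdivide[OF db i s] by simp
  moreover have "height ((u(i := fraction_point u F)) j) = 1" for j
    using h height_fraction_point[OF h l] by simp
  moreover have "N = lattice_span (u(i := fraction_point u F)) (fraction_point (u(i := fraction_point u F)) (remainder_map i F))"
    using lattice_span_subdivide[OF i s, of u] N by simp
  ultimately show ?thesis
    using remainder_map_gorenstein(1)[OF l i] unfolding gorenstein_node_def by blast
qed

section \<open>Cones of the subdivision: containment, separation, counting\<close>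

lemma face_cone_convex_cone: "convex_cone (face_cone u I)"
  unfolding convex_cone_iff
proof (intro conjI ballI allI impI)
  show "0 \<in> face_cone u I" unfolding face_cone_def by (intro CollectI exI[of _ "\<lambda>_. 0"]) simp
  fix x y assume "x \<in> face_cone u I" "y \<in> face_cone u I"
  then obtain t t' where "x = (\<Sum>i\<in>UNIV. t i *\<^sub>R u i)" "\<forall>i. 0 \<le> t i" "\<forall>i. i \<notin> I \<longrightarrow> t i = 0"
    "y = (\<Sum>i\<in>UNIV. t' i *\<^sub>R u i)" "\<forall>i. 0 \<le> t' i" "\<forall>i. i \<notin> I \<longrightarrow> t' i = 0" unfolding face_cone_def by blast
  then show "x + y \<in> face_cone u I" unfolding face_cone_def
    by (intro CollectI exI[of _ "\<lambda>i. t i + t' i"]) (auto simp: scaleR_add_left sum.distrib)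
next
  fix x and c :: real assume "x \<in> face_cone u I" "0 \<le> c"
  then obtain t where "x = (\<Sum>i\<in>UNIV. t i *\<^sub>R u i)" "\<forall>i. 0 \<le> t i" "\<forall>i. i \<notin> I \<longrightarrow> t i = 0"
    unfolding face_cone_def by blast
  then show "c *\<^sub>R x \<in> face_cone u I" unfolding face_cone_def using \<open>0 \<le> c\<close>
    by (intro CollectI exI[of _ "\<lambda>i. c * t i"]) (auto simp: scaleR_sum_right)
qed

lemma convex_cone_sum:
  assumes "convex_cone S" "\<And>i. i \<in> A \<Longrightarrow> f i \<in> S"
  shows "sum f A \<in> S"
proof (cases "finite A")
  case True
  then show ?thesis using assms(2)
    by (induction A) (use assms(1) in \<open>auto simp: convex_cone_iff\<close>)
qed (use assms in \<open>simp add: convex_cone_iff\<close>)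

lemma face_cone_subset:
  assumes "convex_cone S" "\<And>i. i \<in> I \<Longrightarrow> u i \<in> S"
  shows "face_cone u I \<subseteq> S"
proof
  fix x assume "x \<in> face_cone u I"
  then obtain t where t: "x = (\<Sum>i\<in>UNIV. t i *\<^sub>R u i)" "\<And>i. 0 \<le> t i" "\<And>i. i \<notin> I \<Longrightarrow> t i = 0"
    unfolding face_cone_def by blast
  have "t i *\<^sub>R u i \<in> S" for i
    using assms t by (cases "i \<in> I") (auto simp: convex_cone_iff)
  then show "x \<in> S" unfolding t(1) by (intro convex_cone_sum[OF assms(1)])
qed

lemma cone_gen_eq_face_cone: "cone_gen u = face_cone u UNIV"
  unfolding cone_gen_def
proof (rule hull_unique)
  show "range u \<subseteq> face_cone u UNIV" using generator_in_face_cone[of _ UNIV u] by auto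
  show "convex_cone (face_cone u UNIV)" by (rule face_cone_convex_cone)
  show "face_cone u UNIV \<subseteq> T" if "range u \<subseteq> T" "convex_cone T" for T
    using that by (intro face_cone_subset) auto
qed

lemma face_cone_subdivide_subset:
  assumes "gorenstein_label F"
  shows "face_cone (u(i := fraction_point u F)) UNIV \<subseteq> face_cone u UNIV"
proof (rule face_cone_subset[OF face_cone_convex_cone])
  obtain c s where F: "F = (c, s)" by force
  have "0 \<le> c $ j" for j using assms F exhaust_3[of j] by (auto simp: gorenstein_label_def)
  moreover have "0 \<le> s" using assms F by (auto simp: gorenstein_label_def)
  ultimately have "fraction_point u F \<in> face_cone u UNIV"
    unfolding face_cone_def fraction_point_def F by (intro CollectI exI[of _ "\<lambda>j. of_int (c $ j) / of_int s"]) auto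
  then show "(u(i := fraction_point u F)) j \<in> face_cone u UNIV" for j
    using generator_in_face_cone[of j UNIV u] by simp
qed

text \<open>For \<open>j\<close> other than \<open>i\<close> this functional is
  \<open>fst F $ i\<close> times the new dual vector of \<open>u j\<close>. Exchanging
  \<open>i\<close> and \<open>j\<close> reverses its sign, so when both numerators are nonzero the
  two parts lie on opposite sides of its plane.\<close>

lemma subdivide_separation:
  assumes db: "dual_bases u d" and F: "gorenstein_label F"
    and x: "x \<in> face_cone (u(i := fraction_point u F)) UNIV" and i: "fst F $ i \<noteq> 0"
  shows "0 \<le> (of_int (fst F $ i) *\<^sub>R d j - of_int (fst F $ j) *\<^sub>R d i) \<bullet> x"
proof -
  have s: "0 < snd F" using F by (auto simp: gorenstein_label_def)
  have ci: "0 < fst F $ i" using remainder_map_gorenstein(3)[OF F i] .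
  have "dual_bases (u(i := fraction_point u F)) (subdivided_dual d (fst F) (snd F) i)"
    using dual_bases_subdivide[OF db i, of "snd F"] s by simp
  then have "0 \<le> subdivided_dual d (fst F) (snd F) i j \<bullet> x"
    using x face_cone_iff by blast
  show ?thesis
  proof (cases "j = i")
    case False
    then have "(of_int (fst F $ i) *\<^sub>R d j - of_int (fst F $ j) *\<^sub>R d i) = of_int (fst F $ i) *\<^sub>R subdivided_dual d (fst F) (snd F) i j"
      using ci by (simp add: subdivided_dual_def scaleR_diff_right)
    then show ?thesis using \<open>0 \<le> subdivided_dual d (fst F) (snd F) i j \<bullet> x\<close> ci by simp
  qed simp
qed

text \<open>At a smooth label the invariant says that the generators form a lattice basis, because
  \<open>fraction_point u (0, 1)\<close> is 0.\<close>

lemma final_cones_basis: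
  assumes "gorenstein_node N u d F" "v \<in> final_cones (u, F)"
  shows "(\<exists>e. smooth_basis N v e) \<and> (\<forall>i. height (v i) = 1) \<and> face_cone v UNIV \<subseteq> face_cone u UNIV"
  using assms
proof (induction "nat (snd F)" arbitrary: u d F rule: less_induct)
  case less
  show ?case
  proof (cases "F = (0, 1)")
    case True
    then have "v = u" using less.prems final_cones_smooth by simp
    moreover have "fraction_point u (0, 1) = 0" by (simp add: fraction_point_def)
    then have "N = {\<Sum>i\<in>UNIV. of_int (k i) *\<^sub>R u i | k :: 3 \<Rightarrow> int. True}"
      using less.prems True by (auto simp: gorenstein_node_def lattice_span_def)
    ultimately show ?thesis using less.prems by (auto simp: smooth_basis_def gorenstein_node_def)
  next
    case False
    then obtain i where i: "fst F $ i \<noteq> 0" "v \<in> final_cones (u(i := fraction_point u F), remainder_map i F)"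
      using less.prems final_cones_subdivide[OF False, of u] by auto
    have l: "gorenstein_label F" using less.prems False by (auto simp: gorenstein_node_def)
    have "nat (snd (remainder_map i F)) < nat (snd F)" using remainder_map_gorenstein[OF l i(1)] by simp
    from less.hyps[OF this gorenstein_node_subdivide[OF less.prems(1) False i(1)] i(2)]
    show ?thesis using face_cone_subdivide_subset[OF l, of u i] by blast
  qed
qed

text \<open>A cone arising in two different parts would lie in the separating plane, although its
  generators span the space. So the counts of the parts add up, and the denominators of the parts,
  which are the nonzero numerators of \<open>F\<close>, sum to \<open>snd F\<close>.\<close>

lemma card_final_cones:
  assumes "gorenstein_node N u d F"
  shows "finite (cone_gen ` final_cones (u, F)) \<and> card (cone_gen ` final_cones (u, F)) = nat (snd F)"
  using assms
proof (induction "nat (snd F)" arbitrary: u d F rule: less_induct)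
  case less
  show ?case
  proof (cases "F = (0, 1)")
    case True
    then show ?thesis by (simp add: final_cones_smooth)
  next
    case False
    have l: "gorenstein_label F" and db: "dual_bases u d" using less.prems False by (auto simp: gorenstein_node_def)
    let ?K = "{i. fst F $ i \<noteq> 0}"
    let ?C = "\<lambda>i. cone_gen ` final_cones (u(i := fraction_point u F), remainder_map i F)"
    have child: "gorenstein_node N (u(i := fraction_point u F)) (subdivided_dual d (fst F) (snd F) i) (remainder_map i F)"
      if "i \<in> ?K" for i using gorenstein_node_subdivide[OF less.prems False] that by simp
    have IH: "finite (?C i) \<and> card (?C i) = nat (fst F $ i)" if "i \<in> ?K" for i
    proof -
      have "nat (snd (remainder_map i F)) < nat (snd F)" using remainder_map_gorenstein[OF l, of i] that by simp
      from less.hyps[OF this child[OF that]] show ?thesis using remainder_map_gorenstein(2)[OF l] that by simp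
    qed
    have disj: "?C i \<inter> ?C j = {}" if ij: "i \<in> ?K" "j \<in> ?K" "i \<noteq> j" for i j
    proof (rule ccontr)
      assume "?C i \<inter> ?C j \<noteq> {}"
      then obtain v v' where v: "v \<in> final_cones (u(i := fraction_point u F), remainder_map i F)"
        and v': "v' \<in> final_cones (u(j := fraction_point u F), remainder_map j F)"
        and eq: "cone_gen v = cone_gen v'" by auto
      obtain e where "smooth_basis N v e" using final_cones_basis[OF child[OF ij(1)] v] by blast
      then have e: "dual_bases v e" by (simp add: smooth_basis_def)
      define g where "g = of_int (fst F $ i) *\<^sub>R d j - of_int (fst F $ j) *\<^sub>R d i"
      have "v k \<in> face_cone (u(i := fraction_point u F)) UNIV" "v k \<in> face_cone (u(j := fraction_point u F)) UNIV" for k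
        using final_cones_basis[OF child[OF ij(1)] v] final_cones_basis[OF child[OF ij(2)] v'] eq
          generator_in_face_cone[of k UNIV v] unfolding cone_gen_eq_face_cone by auto
      then have "0 \<le> g \<bullet> v k" "0 \<le> - g \<bullet> v k" for k
        using subdivide_separation[OF db l, of "v k" i j] subdivide_separation[OF db l, of "v k" j i] ij
        by (auto simp: g_def)
      then have "g \<bullet> v k = 0" for k by (metis inner_minus_left neg_0_le_iff_le order_antisym)
      then have "g = 0" using dual_bases_expand[OF dual_bases_sym[OF e], of g] by (simp add: inner_commute)
      then have "g \<bullet> u j = 0" by simp
      moreover have "g \<bullet> u j = of_int (fst F $ i)"
        using db ij by (simp add: g_def dual_bases_def inner_diff_left)
      ultimately show False using ij by simp
    qed
    have "cone_gen ` final_cones (u, F) = (\<Union>i\<in>?K. ?C i)"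
      unfolding final_cones_subdivide[OF False] by auto
    moreover have "card (\<Union>i\<in>?K. ?C i) = (\<Sum>i\<in>?K. card (?C i))"
      using IH disj by (intro card_UN_disjoint) auto
    moreover have "(\<Sum>i\<in>?K. card (?C i)) = (\<Sum>i\<in>?K. nat (fst F $ i))" using IH by (intro sum.cong) auto
    moreover have "\<dots> = (\<Sum>i\<in>UNIV. nat (fst F $ i))" by (intro sum.mono_neutral_left) auto
    moreover have "\<dots> = nat (snd F)" using l by (simp add: gorenstein_label_def sum_3 nat_add_distrib)
    moreover have "finite (\<Union>i\<in>?K. ?C i)" using IH by auto
    ultimately show ?thesis by simp
  qed
qed


section \<open>Common faces of final cones\<close>

lemma line_separated_by_cross:
  fixes g p q :: "real ^ 3"
  assumes "g \<noteq> 0" "g \<bullet> p = 0" "g \<bullet> q = 0" "height p = 1" "height q = 1"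
    and e: "cross3 g 1 \<bullet> p = cross3 g 1 \<bullet> q"
  shows "p = q"
proof -
  define y where "y = p - q"
  have y: "g \<bullet> y = 0" "1 \<bullet> y = 0" "cross3 g 1 \<bullet> y = 0"
    using assms by (auto simp: y_def inner_diff_right height_eq_inner)
  \<comment> \<open>\<open>cross3 g 1\<close> is the direction of the line on which \<open>g\<close>
    vanishes and the height is 1. If it were 0, then \<open>g\<close> would be a multiple of the
    all-ones vector and could not vanish at \<open>p\<close>.\<close>
  have "cross3 g 1 \<noteq> 0"
  proof
    assume z: "cross3 g 1 = 0"
    have "(1 \<bullet> (1 :: real ^ 3)) *\<^sub>R g - (1 \<bullet> g) *\<^sub>R 1 = - cross3 1 (cross3 1 g)"
      by (simp add: Lagrange)
    also have "cross3 1 g = 0" using z by (metis cross_skew neg_equal_0_iff_equal)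
    finally have g: "(1 \<bullet> (1 :: real ^ 3)) *\<^sub>R g = (1 \<bullet> g) *\<^sub>R 1" by simp
    then have "(1 \<bullet> (1 :: real ^ 3)) * (g \<bullet> p) = (1 \<bullet> g) * (1 \<bullet> p)" by (metis inner_scaleR_left)
    then have "1 \<bullet> g = 0" using assms by (simp add: height_eq_inner)
    moreover have "1 \<bullet> (1 :: real ^ 3) \<noteq> 0" by (simp add: inner_vec_def)
    ultimately show False using g assms(1) by simp
  qed
  \<comment> \<open>\<open>y\<close> is orthogonal to \<open>g\<close> and to the all-ones vector,
    hence parallel to their cross product, and it is also orthogonal to that product.\<close>
  moreover have "cross3 y (cross3 g 1) = 0" using y by (simp add: Lagrange inner_commute)
  then have "(norm y)\<^sup>2 * (norm (cross3 g 1))\<^sup>2 = 0"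
    using norm_and_cross_eq_0[of y "cross3 g 1"] y(3) by (auto simp: inner_commute)
  ultimately have "y = 0" by simp
  then show ?thesis by (simp add: y_def)
qed

text \<open>\<open>e\<close> orders the line cut out by \<open>g\<close> in the plane of height 1.
  Keeping \<open>e\<close> abstract lets the opposite direction be treated by passing to its
  negative.\<close>

definition line_order :: "real ^ 3 \<Rightarrow> real ^ 3 \<Rightarrow> bool" where
  "line_order g e \<longleftrightarrow> (\<forall>p q. g \<bullet> p = 0 \<longrightarrow> g \<bullet> q = 0 \<longrightarrow> height p = 1 \<longrightarrow> height q = 1 \<longrightarrow> e \<bullet> p = e \<bullet> q \<longrightarrow> p = q)"

lemma line_order_cross: "g \<noteq> 0 \<Longrightarrow> line_order g (cross3 g 1)"
  unfolding line_order_def using line_separated_by_cross by blast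

lemma line_order_uminus: "line_order g e \<Longrightarrow> line_order g (- e)"
  unfolding line_order_def by simp

text \<open>The coordinate of \<open>y\<close> along \<open>v b\<close> is an integer in \<open>(0, 1]\<close>.\<close>

lemma lattice_point_on_edge:
  assumes "line_order g e" and sb: "smooth_basis N v d" and h: "\<And>k. height (v k) = 1"
    and y: "y \<in> N" "height y = 1" "g \<bullet> y = 0" and ab: "g \<bullet> v a = 0" "g \<bullet> v b = 0"
    and less: "e \<bullet> v a < e \<bullet> y" "e \<bullet> y \<le> e \<bullet> v b"
  shows "y = v b"
proof -
  define t where "t = (e \<bullet> y - e \<bullet> v a) / (e \<bullet> v b - e \<bullet> v a)"
  have t: "0 < t" "t \<le> 1" using less by (auto simp: t_def)
  define z where "z = (1 - t) *\<^sub>R v a + t *\<^sub>R v b"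
  have "e \<bullet> z = e \<bullet> v a + t * (e \<bullet> v b - e \<bullet> v a)" by (simp add: z_def inner_add_right algebra_simps)
  also have "\<dots> = e \<bullet> y" using less by (simp add: t_def)
  finally have "e \<bullet> z = e \<bullet> y" .
  moreover have "g \<bullet> z = 0" "height z = 1"
    using ab h by (auto simp: z_def inner_add_right height_eq_inner)
  ultimately have yz: "y = z" using assms(1) y unfolding line_order_def by metis
  have "a \<noteq> b" using less by auto
  moreover have "d b \<bullet> v k = (if b = k then 1 else 0)" for k using sb by (auto simp: smooth_basis_def dual_bases_def)
  ultimately have "d b \<bullet> y = t" unfolding yz z_def by (simp add: inner_add_right)
  then have "t \<in> \<int>" using y(1) smooth_basis_iff[OF sb] by metis
  then have "t = 1" using t by (auto elim!: Ints_cases)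
  then show ?thesis using yz z_def by simp
qed

lemma generator_in_lattice: "smooth_basis N v d \<Longrightarrow> v k \<in> N"
  by (subst smooth_basis_iff) (auto simp: smooth_basis_def dual_bases_def)

text \<open>Suppose every generator of \<open>v'\<close> supporting the point lay above
  \<open>v a\<close>. Comparing averages, the lowest of them, \<open>v' m\<close>, is at most the
  highest supporting generator \<open>v b\<close> of \<open>v\<close>. Then
  \<open>v' m = v b\<close> because \<open>v\<close> is a lattice basis, but the positive weight at
  \<open>v a\<close> pulls the average strictly below this value.\<close>

lemma support_lower_neighbour:
  assumes ord: "line_order g e"
    and sb: "smooth_basis N v d" and h: "\<And>k. height (v k) = 1"
    and sb': "smooth_basis N v' d'" and h': "\<And>k. height (v' k) = 1"
    and t: "\<And>k. 0 \<le> t k" and t': "\<And>k. 0 \<le> t' k"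
    and g: "\<And>k. 0 < t k \<Longrightarrow> g \<bullet> v k = 0" and g': "\<And>k. 0 < t' k \<Longrightarrow> g \<bullet> v' k = 0"
    and eq: "(\<Sum>k\<in>UNIV. t k *\<^sub>R v k) = (\<Sum>k\<in>UNIV. t' k *\<^sub>R v' k)"
    and a: "0 < t a"
  shows "\<exists>k. 0 < t' k \<and> e \<bullet> v' k \<le> e \<bullet> v a"
proof (rule ccontr)
  assume neg: "\<not> ?thesis"
  \<comment> \<open>The height of the common point; as all generators have height 1, it is the total
    weight in either representation.\<close>
  define T where "T = (\<Sum>k\<in>UNIV. t k)"
  have "height (\<Sum>k\<in>UNIV. t k *\<^sub>R v k) = T" "height (\<Sum>k\<in>UNIV. t' k *\<^sub>R v' k) = (\<Sum>k\<in>UNIV. t' k)"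
    unfolding height_sum using h h' by (simp_all add: T_def)
  then have T': "(\<Sum>k\<in>UNIV. t' k) = T" using eq by simp
  have Tpos: "0 < T" unfolding T_def using t a by (intro sum_pos2[of _ a]) auto
  have ex: "(\<Sum>k\<in>UNIV. t k * (e \<bullet> v k)) = (\<Sum>k\<in>UNIV. t' k * (e \<bullet> v' k))"
    using arg_cong[OF eq, of "\<lambda>x. e \<bullet> x"] by (simp add: inner_sum_right)
  have "{k. 0 < t' k} \<noteq> {}"
  proof
    assume "{k. 0 < t' k} = {}"
    then have "sum t' UNIV \<le> 0" by (intro sum_nonpos) (auto simp: not_less)
    then show False using T' Tpos by simp
  qed
  moreover have "finite {k. 0 < t' k}" by simp
  ultimately obtain m where m: "0 < t' m" "\<And>k. 0 < t' k \<Longrightarrow> e \<bullet> v' m \<le> e \<bullet> v' k"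
    using arg_min_if_finite[of "{k. 0 < t' k}" "\<lambda>k. e \<bullet> v' k"] by (metis mem_Collect_eq not_less)
  have "{k. 0 < t k} \<noteq> {}" using a by auto
  then obtain b where b: "0 < t b" "\<And>k. 0 < t k \<Longrightarrow> e \<bullet> v k \<le> e \<bullet> v b"
    using arg_min_if_finite[of "{k. 0 < t k}" "\<lambda>k. - (e \<bullet> v k)"] by (metis (no_types, lifting) finite mem_Collect_eq neg_less_iff_less not_less)
  have am: "e \<bullet> v a < e \<bullet> v' m" using neg m by (meson not_le)
  have "(e \<bullet> v' m) * T = (\<Sum>k\<in>UNIV. t' k * (e \<bullet> v' m))" unfolding T'[symmetric] by (subst mult.commute) (rule sum_distrib_right)
  also have "\<dots> \<le> (\<Sum>k\<in>UNIV. t' k * (e \<bullet> v' k))"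
  proof (rule sum_mono)
    fix k show "t' k * (e \<bullet> v' m) \<le> t' k * (e \<bullet> v' k)"
      using m(2)[of k] t'[of k] by (cases "t' k = 0") (auto intro!: mult_left_mono)
  qed
  also have "\<dots> = (\<Sum>k\<in>UNIV. t k * (e \<bullet> v k))" using ex by simp
  finally have lower: "(e \<bullet> v' m) * T \<le> (\<Sum>k\<in>UNIV. t k * (e \<bullet> v k))" .
  have le: "t k * (e \<bullet> v k) \<le> t k * (e \<bullet> v b)" for k
    using b(2)[of k] t[of k] by (cases "t k = 0") (auto intro!: mult_left_mono)
  have sb_eq: "(\<Sum>k\<in>UNIV. t k * (e \<bullet> v b)) = (e \<bullet> v b) * T" unfolding T_def by (subst mult.commute[of "e \<bullet> v b"]) (rule sum_distrib_right[symmetric])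
  have ab: "e \<bullet> v a \<le> e \<bullet> v b" using b a by blast
  have upper: "(\<Sum>k\<in>UNIV. t k * (e \<bullet> v k)) \<le> (e \<bullet> v b) * T"
    unfolding sb_eq[symmetric] using le by (intro sum_mono)
  have "e \<bullet> v' m \<le> e \<bullet> v b" using lower upper Tpos by (meson mult_le_cancel_right_pos order_trans)
  have "v' m = v b"
    by (rule lattice_point_on_edge[OF ord sb h generator_in_lattice[OF sb'] h' g'[OF m(1)] g[OF a] g[OF b(1)] am \<open>e \<bullet> v' m \<le> e \<bullet> v b\<close>])
  then have "e \<bullet> v a < e \<bullet> v b" using am by simp
  then have "t a * (e \<bullet> v a) < t a * (e \<bullet> v b)" using a by simp
  then have "(\<Sum>k\<in>UNIV. t k * (e \<bullet> v k)) < (e \<bullet> v b) * T"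
    unfolding sb_eq[symmetric] using le by (intro sum_strict_mono_ex1) auto
  then show False using lower \<open>v' m = v b\<close> by simp
qed

text \<open>The two directions of the line give supporting generators of \<open>v'\<close> below and
  above \<open>v a\<close>. Unless the lower one equals \<open>v a\<close>, the lattice point
  \<open>v a\<close> lies on an edge of \<open>v'\<close> past its lower end and so equals the upper
  one.\<close>

lemma support_subset_on_line:
  assumes "g \<noteq> 0"
    and sb: "smooth_basis N v d" and h: "\<And>k. height (v k) = 1"
    and sb': "smooth_basis N v' d'" and h': "\<And>k. height (v' k) = 1"
    and t: "\<And>k. 0 \<le> t k" and t': "\<And>k. 0 \<le> t' k"
    and g: "\<And>k. 0 < t k \<Longrightarrow> g \<bullet> v k = 0" and g': "\<And>k. 0 < t' k \<Longrightarrow> g \<bullet> v' k = 0"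
    and eq: "(\<Sum>k\<in>UNIV. t k *\<^sub>R v k) = (\<Sum>k\<in>UNIV. t' k *\<^sub>R v' k)"
    and a: "0 < t a"
  shows "\<exists>k. 0 < t' k \<and> v' k = v a"
proof -
  define e where "e = cross3 g 1"
  have ord: "line_order g e" unfolding e_def by (rule line_order_cross[OF assms(1)])
  obtain k where k: "0 < t' k" "e \<bullet> v' k \<le> e \<bullet> v a"
    using support_lower_neighbour[OF ord sb h sb' h' t t' g g' eq a] by blast
  obtain l where l: "0 < t' l" "- e \<bullet> v' l \<le> - e \<bullet> v a"
    using support_lower_neighbour[OF line_order_uminus[OF ord] sb h sb' h' t t' g g' eq a] by blast
  show ?thesis
  proof (cases "e \<bullet> v' k = e \<bullet> v a")
    case True
    then have "v' k = v a" using ord h h' g[OF a] g'[OF k(1)] unfolding line_order_def by blast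
    then show ?thesis using k by blast
  next
    case False
    then have "v a = v' l"
      using k l by (intro lattice_point_on_edge[OF ord sb' h' generator_in_lattice[OF sb] h g[OF a] g'[OF k(1)] g'[OF l(1)]]) auto
    then show ?thesis using l by metis
  qed
qed

text \<open>Matching the generators actually used by a common point is what yields a common face.
  Within one part the induction applies. In different parts the functional \<open>g\<close> is
  nonnegative on one cone and nonpositive on the other, so both supports lie where it
  vanishes.\<close>

lemma final_cones_support:
  assumes "gorenstein_node N u d F" "v \<in> final_cones (u, F)" "v' \<in> final_cones (u, F)"
    and "\<And>k. 0 \<le> t k" "\<And>k. 0 \<le> t' k"
    and "(\<Sum>k\<in>UNIV. t k *\<^sub>R v k) = (\<Sum>k\<in>UNIV. t' k *\<^sub>R v' k)" and "0 < t a"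
  shows "\<exists>k. 0 < t' k \<and> v' k = v a"
  using assms
proof (induction "nat (snd F)" arbitrary: u d F rule: less_induct)
  case less
  obtain e e' where sb: "smooth_basis N v e" and sb': "smooth_basis N v' e'"
    using final_cones_basis[OF less.prems(1,2)] final_cones_basis[OF less.prems(1,3)] by blast
  have h: "\<And>k. height (v k) = 1" "\<And>k. height (v' k) = 1"
    using final_cones_basis[OF less.prems(1,2)] final_cones_basis[OF less.prems(1,3)] by blast+
  show ?case
  proof (cases "F = (0, 1)")
    case True
    then have vv': "v = u" "v' = u" using less.prems final_cones_smooth by auto
    have db: "dual_bases u d" using less.prems(1) by (simp add: gorenstein_node_def)
    have "t a = t' a"
      using arg_cong[OF less.prems(6), of "\<lambda>x. d a \<bullet> x"] unfolding vv' dual_bases_coord[OF db] .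
    then show ?thesis using less.prems(7) vv' by (intro exI[of _ a]) simp
  next
    case False
    have l: "gorenstein_label F" and db: "dual_bases u d" using less.prems False by (auto simp: gorenstein_node_def)
    obtain i where i: "fst F $ i \<noteq> 0" "v \<in> final_cones (u(i := fraction_point u F), remainder_map i F)"
      using less.prems(2) final_cones_subdivide[OF False, of u] by auto
    obtain j where j: "fst F $ j \<noteq> 0" "v' \<in> final_cones (u(j := fraction_point u F), remainder_map j F)"
      using less.prems(3) final_cones_subdivide[OF False, of u] by auto
    note child = gorenstein_node_subdivide[OF less.prems(1) False]
    show ?thesis
    proof (cases "i = j")
      case True
      have "nat (snd (remainder_map i F)) < nat (snd F)" using remainder_map_gorenstein[OF l i(1)] by simp
      from less.hyps[OF this child[OF i(1)] i(2)] j(2) True less.prems(4-7) show ?thesis by simp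
    next
      case False
      define g where "g = of_int (fst F $ i) *\<^sub>R d j - of_int (fst F $ j) *\<^sub>R d i"
      have "v k \<in> face_cone (u(i := fraction_point u F)) UNIV" "v' k \<in> face_cone (u(j := fraction_point u F)) UNIV" for k
        using final_cones_basis[OF child[OF i(1)] i(2)] final_cones_basis[OF child[OF j(1)] j(2)]
          generator_in_face_cone[of k UNIV v] generator_in_face_cone[of k UNIV v'] by auto
      then have pos: "0 \<le> g \<bullet> v k" and neg: "g \<bullet> v' k \<le> 0" for k
        using subdivide_separation[OF db l, of "v k" i j] subdivide_separation[OF db l, of "v' k" j i] i j
        by (auto simp: g_def inner_diff_left)
      have "g \<bullet> u j = of_int (fst F $ i)"
        using db False by (simp add: g_def dual_bases_def inner_diff_left)
      then have "g \<noteq> 0" using i by auto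
      have sum: "(\<Sum>k\<in>UNIV. t k * (g \<bullet> v k)) = (\<Sum>k\<in>UNIV. t' k * (g \<bullet> v' k))"
        using arg_cong[OF less.prems(6), of "\<lambda>x. g \<bullet> x"] by (simp add: inner_sum_right)
      have "0 \<le> (\<Sum>k\<in>UNIV. t k * (g \<bullet> v k))" using pos less.prems(4) by (intro sum_nonneg) simp
      moreover have "(\<Sum>k\<in>UNIV. t' k * (g \<bullet> v' k)) \<le> 0"
        using neg less.prems(5) by (intro sum_nonpos) (simp add: mult_nonneg_nonpos)
      ultimately have z: "(\<Sum>k\<in>UNIV. t k * (g \<bullet> v k)) = 0" "(\<Sum>k\<in>UNIV. - (t' k * (g \<bullet> v' k))) = 0"
        using sum by (auto simp: sum_negf)
      have "t k * (g \<bullet> v k) = 0" for k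
        using z(1) pos less.prems(4) by (subst (asm) sum_nonneg_eq_0_iff) auto
      moreover have "- (t' k * (g \<bullet> v' k)) = 0" for k
        using z(2) neg less.prems(5) by (subst (asm) sum_nonneg_eq_0_iff) (auto simp: mult_nonneg_nonpos)
      ultimately have "0 < t k \<Longrightarrow> g \<bullet> v k = 0" "0 < t' k \<Longrightarrow> g \<bullet> v' k = 0" for k
        by (metis mult_eq_0_iff neg_equal_0_iff_equal less_irrefl)+
      then show ?thesis
        by (intro support_subset_on_line[OF \<open>g \<noteq> 0\<close> sb h(1) sb' h(2) less.prems(4,5) _ _ less.prems(6,7)])
    qed
  qed
qed

lemma final_cones_Int:
  assumes node: "gorenstein_node N u d F" and v: "v \<in> final_cones (u, F)" and v': "v' \<in> final_cones (u, F)"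
  shows "face_cone v J \<inter> face_cone v' J' = face_cone v {k \<in> J. \<exists>k'\<in>J'. v' k' = v k}" (is "?L = face_cone v ?I")
proof (intro equalityI subsetI)
  fix x assume "x \<in> ?L"
  then obtain t t' where t: "x = (\<Sum>i\<in>UNIV. t i *\<^sub>R v i)" "\<And>i. 0 \<le> t i" "\<And>i. i \<notin> J \<Longrightarrow> t i = 0"
    and t': "x = (\<Sum>i\<in>UNIV. t' i *\<^sub>R v' i)" "\<And>i. 0 \<le> t' i" "\<And>i. i \<notin> J' \<Longrightarrow> t' i = 0"
    unfolding face_cone_def by blast
  have "t k = 0" if "k \<notin> ?I" for k
  proof (rule ccontr)
    assume "t k \<noteq> 0"
    then have tk: "0 < t k" "k \<in> J" using t(2)[of k] t(3)[of k] by auto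
    have "(\<Sum>i\<in>UNIV. t i *\<^sub>R v i) = (\<Sum>i\<in>UNIV. t' i *\<^sub>R v' i)" using t t' by simp
    then obtain k' where k': "0 < t' k'" "v' k' = v k"
      using final_cones_support[of N u d F v v' t t' k] node v v' t(2) t'(2) tk(1) by blast
    then have "k' \<in> J'" using t'(3)[of k'] by auto
    then show False using k' tk that by blast
  qed
  then show "x \<in> face_cone v ?I" unfolding face_cone_def using t by blast
next
  fix x assume x: "x \<in> face_cone v ?I"
  have "face_cone v ?I \<subseteq> face_cone v J"
    by (intro face_cone_subset face_cone_convex_cone) (auto intro: generator_in_face_cone)
  moreover have "v k \<in> face_cone v' J'" if k: "k \<in> ?I" for k
  proof -
    obtain k' where "k' \<in> J'" "v' k' = v k" using k by auto
    then show ?thesis using generator_in_face_cone[of k' J' v'] by simp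
  qed
  then have "face_cone v ?I \<subseteq> face_cone v' J'"
    by (intro face_cone_subset face_cone_convex_cone)
  ultimately show "x \<in> ?L" using x by blast
qed

section \<open>Faces of a simplicial cone are spanned by subsets of its generators\<close>

lemma face_cone_face:
  assumes db: "dual_bases u d"
  shows "face_cone u I face_of face_cone u UNIV"
  unfolding face_of_def
proof (intro conjI ballI impI)
  show "face_cone u I \<subseteq> face_cone u UNIV"
    by (intro face_cone_subset face_cone_convex_cone) (auto intro: generator_in_face_cone)
  show "convex (face_cone u I)" using face_cone_convex_cone by (auto simp: convex_cone_def)
  fix a b x assume a: "a \<in> face_cone u UNIV" and b: "b \<in> face_cone u UNIV" and x: "x \<in> face_cone u I"
    and seg: "x \<in> open_segment a b"
  obtain t where t: "0 < t" "t < 1" "x = (1 - t) *\<^sub>R a + t *\<^sub>R b"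
    using seg by (auto simp: in_segment)
  have "d i \<bullet> a = 0 \<and> d i \<bullet> b = 0" if "i \<notin> I" for i
  proof -
    have "(1 - t) * (d i \<bullet> a) + t * (d i \<bullet> b) = 0"
      using x that t(3) face_cone_iff[OF db, of x I] by (auto simp: inner_add_right)
    moreover have "0 \<le> (1 - t) * (d i \<bullet> a)" "0 \<le> t * (d i \<bullet> b)"
      using a b t face_cone_iff[OF db] by auto
    ultimately have "(1 - t) * (d i \<bullet> a) = 0" "t * (d i \<bullet> b) = 0" by linarith+
    then show ?thesis using t by auto
  qed
  then show "a \<in> face_cone u I" "b \<in> face_cone u I"
    using a b unfolding face_cone_iff[OF db] by auto
qed

text \<open>Two segment arguments: nonnegative multiples of a point of the face stay in it, so the
  face is a convex cone; and a point with positive \<open>i\<close>-th coordinate is a midpoint,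
  which forces \<open>u i\<close> into the face.\<close>

lemma face_of_face_coneD:
  assumes db: "dual_bases u d" and f: "\<tau> face_of face_cone u UNIV" and ne: "\<tau> \<noteq> {}"
  shows "\<exists>I. \<tau> = face_cone u I"
proof -
  let ?C = "face_cone u UNIV"
  have CC: "convex_cone ?C" by (rule face_cone_convex_cone)
  have sub: "\<tau> \<subseteq> ?C" and conv: "convex \<tau>" using f by (auto simp: face_of_def)
  have face: "a \<in> \<tau> \<and> b \<in> \<tau>" if "a \<in> ?C" "b \<in> ?C" "x \<in> \<tau>" "x \<in> open_segment a b" for a b x
    using f that by (auto simp: face_of_def)
  have scale: "c *\<^sub>R x \<in> \<tau>" if x: "x \<in> \<tau>" and c: "0 \<le> c" for c x
  proof (cases "x = 0 \<or> c = 1")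
    case False
    \<comment> \<open>A second multiple of \<open>x\<close>, chosen so that \<open>x\<close> lies
      strictly between it and the multiple by \<open>c\<close>.\<close>
    define c' where "c' = (if c < 1 then 2 else 0 :: real)"
    have "c *\<^sub>R x \<in> ?C" "c' *\<^sub>R x \<in> ?C"
      using x sub CC c by (auto simp: convex_cone_iff c'_def)
    moreover have "x \<in> open_segment (c *\<^sub>R x) (c' *\<^sub>R x)"
    proof -
      define s where "s = (1 - c) / (c' - c)"
      have cc': "c' \<noteq> c" using False by (auto simp: c'_def)
      have s: "0 < s" "s < 1" using False c by (auto simp: s_def c'_def field_simps)
      have "(1 - s) * c + s * c' = c + s * (c' - c)" by (simp add: algebra_simps)
      also have "\<dots> = 1" using cc' by (simp add: s_def)
      finally have "x = (1 - s) *\<^sub>R (c *\<^sub>R x) + s *\<^sub>R (c' *\<^sub>R x)"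
        by (metis scaleR_add_left scaleR_one scaleR_scaleR)
      moreover have "c *\<^sub>R x \<noteq> c' *\<^sub>R x" using cc' False by simp
      ultimately show ?thesis using s by (auto simp: in_segment)
    qed
    ultimately show ?thesis using face x by blast
  qed (use x in auto)
  have add: "x + y \<in> \<tau>" if "x \<in> \<tau>" "y \<in> \<tau>" for x y
  proof -
    have "(1/2) *\<^sub>R x + (1/2) *\<^sub>R y \<in> \<tau>" using conv that by (auto intro!: convexD)
    then have "2 *\<^sub>R ((1/2) *\<^sub>R x + (1/2) *\<^sub>R y) \<in> \<tau>" by (rule scale) simp
    then show ?thesis by (simp add: scaleR_add_right)
  qed
  have zero: "0 \<in> \<tau>" using ne scale[of _ 0] by auto
  have cc: "convex_cone \<tau>" unfolding convex_cone_iff using add scale zero by blast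
  define I where "I = {i. u i \<in> \<tau>}"
  have "\<tau> \<subseteq> face_cone u I"
  proof
    fix x assume x: "x \<in> \<tau>"
    have nn: "0 \<le> d i \<bullet> x" for i using x sub face_cone_iff[OF db] by auto
    have "d i \<bullet> x = 0" if "i \<notin> I" for i
    proof (rule ccontr)
      assume "d i \<bullet> x \<noteq> 0"
      then have pos: "0 < d i \<bullet> x" using nn[of i] by simp
      \<comment> \<open>\<open>x\<close> is the midpoint of \<open>2 *\<^sub>R y\<close> and
        \<open>2 *\<^sub>R z\<close>. If these coincide, the open segment is empty, but then
        \<open>y\<close> is a multiple of \<open>x\<close>.\<close>
      define y where "y = (d i \<bullet> x) *\<^sub>R u i"
      define z where "z = x - y"
      have du: "d j \<bullet> u k = (if j = k then 1 else 0)" for j k using db by (simp add: dual_bases_def)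
      have yC: "2 *\<^sub>R y \<in> ?C" unfolding face_cone_iff[OF db] y_def using nn by (auto simp: du)
      have zC: "2 *\<^sub>R z \<in> ?C" unfolding face_cone_iff[OF db] z_def y_def using nn by (auto simp: du inner_diff_right)
      have "y \<in> \<tau>"
      proof (cases "y = z")
        case True
        then have "x = 2 *\<^sub>R y" by (simp add: z_def scaleR_2)
        then have "y = (1/2) *\<^sub>R x" by simp
        then show ?thesis using scale[OF x] by simp
      next
        case False
        have "x = (1 - 1/2) *\<^sub>R (2 *\<^sub>R y) + (1/2) *\<^sub>R (2 *\<^sub>R z)" by (simp add: z_def)
        then have "x \<in> open_segment (2 *\<^sub>R y) (2 *\<^sub>R z)"
          using False unfolding in_segment by (auto intro!: exI[of _ "1/2"])
        then have "2 *\<^sub>R y \<in> \<tau>" using face[OF yC zC x] by blast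
        from scale[OF this, of "1/2"] show ?thesis by simp
      qed
      from scale[OF this, of "1 / (d i \<bullet> x)"] have "u i \<in> \<tau>" using pos by (simp add: y_def)
      then show False using that by (simp add: I_def)
    qed
    then show "x \<in> face_cone u I" using nn face_cone_iff[OF db] by blast
  qed
  moreover have "face_cone u I \<subseteq> \<tau>" using cc by (intro face_cone_subset) (auto simp: I_def)
  ultimately show ?thesis by blast
qed

section \<open>Euler characteristic and discrepancies\<close>

lemma group_GL3: "group GL3"
proof (rule groupI)
  show "\<exists>y\<in>carrier GL3. y \<otimes>\<^bsub>GL3\<^esub> x = \<one>\<^bsub>GL3\<^esub>" if "x \<in> carrier GL3" for x
    using that by (auto simp: GL3_def invertible_def)
qed (auto simp: GL3_def invertible_mult matrix_mul_assoc invertible_det_nz[of "mat 1"])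

lemma diag3_mult: "diag3 x y z ** diag3 x' y' z' = diag3 (x * x') (y * y') (z * z')"
  by (simp add: vec_eq_iff matrix_matrix_mult_def diag3_def forall_3 sum_3 vector_3)

lemma diag3_one: "diag3 1 1 1 = mat 1"
  by (simp add: vec_eq_iff diag3_def mat_def forall_3 vector_3)

lemma diag3_eq_iff: "diag3 x y z = diag3 x' y' z' \<longleftrightarrow> x = x' \<and> y = y' \<and> z = z'"
  by (auto simp: vec_eq_iff diag3_def forall_3 vector_3)

lemma det_diag3: "det (diag3 x y z) = x * y * z"
  by (simp add: det_3 diag3_def vector_3)

lemma diag3_in_GL3: "x \<noteq> 0 \<Longrightarrow> y \<noteq> 0 \<Longrightarrow> z \<noteq> 0 \<Longrightarrow> diag3 x y z \<in> carrier GL3"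
  by (simp add: GL3_def invertible_det_nz det_diag3)

lemma diag3_pow: "diag3 x y z [^]\<^bsub>GL3\<^esub> (n :: nat) = diag3 (x ^ n) (y ^ n) (z ^ n)"
  by (induction n) (simp_all add: nat_pow_def GL3_def diag3_one diag3_mult mult.commute)

lemma primitive_root_nonzero:
  assumes "primitive_root_of_unity r \<epsilon>" "0 < r"
  shows "\<epsilon> \<noteq> 0"
  using assms by (auto simp: primitive_root_of_unity_def power_0_left)

lemma primitive_root_power_eq_1:
  assumes "primitive_root_of_unity r \<epsilon>" "0 < r" "\<epsilon> ^ n = 1"
  shows "r dvd n"
proof -
  have "\<epsilon> ^ n = (\<epsilon> ^ r) ^ (n div r) * \<epsilon> ^ (n mod r)"
    by (metis mult_div_mod_eq power_add power_mult)
  then have "\<epsilon> ^ (n mod r) = 1" using assms by (simp add: primitive_root_of_unity_def)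
  moreover have "n mod r < r" using assms by simp
  ultimately have "n mod r = 0" using assms by (auto simp: primitive_root_of_unity_def)
  then show ?thesis by auto
qed

text \<open>The other diagonal entries are powers of \<epsilon>, so the generator has the order of
  \<epsilon>.\<close>

lemma card_cyclic_group_type:
  assumes "primitive_root_of_unity r \<epsilon>" "0 < r"
  shows "card (cyclic_group_type \<epsilon> a2 a3) = r"
proof -
  interpret group GL3 by (rule group_GL3)
  let ?g = "diag3 \<epsilon> (\<epsilon> ^ a2) (\<epsilon> ^ a3)"
  have g: "?g \<in> carrier GL3" using primitive_root_nonzero[OF assms] by (intro diag3_in_GL3) auto
  have iff: "?g [^]\<^bsub>GL3\<^esub> n = \<one>\<^bsub>GL3\<^esub> \<longleftrightarrow> r dvd n" for n :: nat
  proof -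
    have "?g [^]\<^bsub>GL3\<^esub> n = \<one>\<^bsub>GL3\<^esub> \<longleftrightarrow> \<epsilon> ^ n = 1 \<and> (\<epsilon> ^ a2) ^ n = 1 \<and> (\<epsilon> ^ a3) ^ n = 1"
      unfolding diag3_pow by (simp add: GL3_def diag3_one[symmetric] diag3_eq_iff)
    also have "\<dots> \<longleftrightarrow> \<epsilon> ^ n = 1" by (metis mult.commute power_mult power_one)
    also have "\<dots> \<longleftrightarrow> r dvd n"
      using primitive_root_power_eq_1[OF assms] assms
      by (auto simp: primitive_root_of_unity_def power_mult elim!: dvdE)
    finally show ?thesis .
  qed
  have "ord ?g = r"
    using iff pow_eq_id[OF g] by (metis dvd_antisym dvd_refl)
  then show ?thesis using generate_pow_card[OF g] by (simp add: cyclic_group_type_def)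
qed

text \<open>The determinant of the generator gives \<open>r dvd 1 + a2 + a3\<close>, and the bounds
  on \<open>a2\<close> and \<open>a3\<close> keep this positive number below
  \<open>2 * r\<close>.\<close>

lemma SL3_exponent_sum:
  assumes "primitive_root_of_unity r \<epsilon>" "r \<ge> 2" "a2 \<le> r - 1" "a3 \<le> r - 1"
    and "cyclic_group_type \<epsilon> a2 a3 \<subseteq> SL3"
  shows "1 + a2 + a3 = r"
proof -
  have "diag3 \<epsilon> (\<epsilon> ^ a2) (\<epsilon> ^ a3) \<in> cyclic_group_type \<epsilon> a2 a3"
    unfolding cyclic_group_type_def by (rule generate.incl) simp
  then have "\<epsilon> * \<epsilon> ^ a2 * \<epsilon> ^ a3 = 1" using assms(5) by (auto simp: SL3_def det_diag3)
  then have "\<epsilon> ^ (1 + a2 + a3) = 1" by (simp add: power_add mult.assoc)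
  then have "r dvd 1 + a2 + a3" using primitive_root_power_eq_1 assms by auto
  then obtain k where k: "1 + a2 + a3 = r * k" by (auto elim: dvdE)
  have "r * k < r * 2" using k assms by linarith
  then have "k < 2" by simp
  moreover have "k \<noteq> 0" using k by (intro notI) simp
  ultimately show ?thesis using k by (cases k) auto
qed

section \<open>Euler characteristics of the charts\<close>

lemma torus_chart_domain_homeomorphic:
  "top_of_set (torus_chart_domain I) homeomorphic_space
     prod_topology (prod_topology (torus_factor (1 \<in> I)) (torus_factor (2 \<in> I))) (torus_factor (3 \<in> I))"
proof -
  define A where "A i = (if i \<in> I then UNIV else - {0 :: complex})" for i :: 3
  let ?D = "torus_chart_domain I"
  let ?E = "(A 1 \<times> A 2) \<times> A 3"
  let ?f = "\<lambda>z :: 3 \<Rightarrow> complex. ((z 1, z 2), z 3)"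
  let ?g = "\<lambda>p (i :: 3). if i = 1 then fst (fst p) else if i = 2 then snd (fst p) else snd p :: complex"
  have D: "z \<in> ?D \<longleftrightarrow> (\<forall>i. z i \<in> A i)" for z
    by (auto simp: torus_chart_domain_def A_def)
  have "homeomorphic_maps (top_of_set ?D) (top_of_set ?E) ?f ?g"
    unfolding homeomorphic_maps_def
  proof (intro conjI ballI)
    have "continuous_on ?D ?f"
      by (intro continuous_intros continuous_on_subset[OF continuous_on_product_coordinates subset_UNIV])
    then show "continuous_map (top_of_set ?D) (top_of_set ?E) ?f" using D by auto
    have "continuous_on ?E ?g"
    proof (rule continuous_on_coordinatewise_then_product)
      fix i
      show "continuous_on ?E (\<lambda>p. ?g p i)"
        by (cases "i = 1"; cases "i = 2"; simp) (intro continuous_intros)+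
    qed
    moreover have "?g p \<in> ?D" if "p \<in> ?E" for p
      using that exhaust_3 by (auto simp: D forall_3)
    ultimately show "continuous_map (top_of_set ?E) (top_of_set ?D) ?g" by (auto simp: Pi_iff)
    show "?g (?f z) = z" for z :: "3 \<Rightarrow> complex" using exhaust_3 by (auto simp: fun_eq_iff)
    show "?f (?g p) = p" for p by simp
  qed
  moreover have "top_of_set ?E = prod_topology (prod_topology (torus_factor (1 \<in> I)) (torus_factor (2 \<in> I))) (torus_factor (3 \<in> I))"
    by (simp add: torus_factor_def A_def)
  ultimately show ?thesis unfolding homeomorphic_space_def by (intro exI) (simp only:)
qed

lemma has_euler_characteristic_affine_toric:
  assumes "smooth_basis N u d"
  shows "has_euler_characteristic (affine_toric N (face_cone u I)) (if I = UNIV then 1 else 0)"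
proof -
  have "(1 \<in> I \<and> 2 \<in> I \<and> 3 \<in> I) \<longleftrightarrow> I = UNIV"
    using exhaust_3 by (auto simp: set_eq_iff forall_3)
  moreover
  have "affine_toric N (face_cone u I) homeomorphic_space
      prod_topology (prod_topology (torus_factor (1 \<in> I)) (torus_factor (2 \<in> I))) (torus_factor (3 \<in> I))"
  proof (rule homeomorphic_space_trans[OF _ torus_chart_domain_homeomorphic])
    show "affine_toric N (face_cone u I) homeomorphic_space top_of_set (torus_chart_domain I)"
      unfolding homeomorphic_space_def by (intro exI) (rule homeomorphic_maps_chart[OF assms])
  qed
  then have "has_euler_characteristic (affine_toric N (face_cone u I)) (if 1 \<in> I \<and> 2 \<in> I \<and> 3 \<in> I then 1 else 0)"
    by (rule has_euler_characteristic_homeomorphic[OF _ has_euler_characteristic_factors3])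
  ultimately show ?thesis by (simp only:)
qed

lemma gorenstein_node_initial:
  assumes "1 + a2 + a3 = r" "r \<ge> 2"
  shows "gorenstein_node (N_lattice r a2 a3) (\<lambda>i. axis i 1) (\<lambda>i. axis i 1) (initial_fraction r a2 a3)"
proof -
  have "height (axis i 1) = 1" for i :: 3
    using exhaust_3[of i] by (auto simp: height_def axis_def)
  moreover have "gorenstein_label (initial_fraction r a2 a3)"
    using assms by (auto simp: gorenstein_label_def initial_fraction_def vector_3)
  moreover have "N_lattice r a2 a3 = lattice_span (\<lambda>i. axis i 1) (fraction_point (\<lambda>i. axis i 1) (initial_fraction r a2 a3))"
  proof -
    have "(\<forall>i. z $ i \<in> \<int>) \<longleftrightarrow> (\<exists>k :: 3 \<Rightarrow> int. z = (\<Sum>i\<in>UNIV. of_int (k i) *\<^sub>R axis i 1))" for z :: "real ^ 3"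
    proof
      assume "\<forall>i. z $ i \<in> \<int>"
      then have "z $ i = of_int \<lfloor>z $ i\<rfloor>" for i by (metis Ints_cases floor_of_int)
      then have "z = (\<Sum>i\<in>UNIV. of_int \<lfloor>z $ i\<rfloor> *\<^sub>R axis i 1)"
        using dual_bases_expand[OF dual_bases_axis, of z] by (simp add: inner_axis')
      then show "\<exists>k :: 3 \<Rightarrow> int. z = (\<Sum>i\<in>UNIV. of_int (k i) *\<^sub>R axis i 1)"
        by (rule exI[of _ "\<lambda>i. \<lfloor>z $ i\<rfloor>"])
    next
      assume "\<exists>k :: 3 \<Rightarrow> int. z = (\<Sum>i\<in>UNIV. of_int (k i) *\<^sub>R axis i 1)"
      then show "\<forall>i. z $ i \<in> \<int>"
        using dual_bases_coord[OF dual_bases_axis] by (auto simp: inner_axis')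
    qed
    then show ?thesis unfolding N_lattice_def lattice_span_def by auto
  qed
  ultimately show ?thesis using dual_bases_axis by (simp add: gorenstein_node_def)
qed

section \<open>The fan of a Gorenstein node\<close>

context
  fixes N u d F \<Sigma>
  assumes node: "gorenstein_node N u d F"
    and \<Sigma>: "\<Sigma> = {\<tau>. \<tau> \<noteq> {} \<and> (\<exists>v \<in> final_cones (u, F). \<tau> face_of cone_gen v)}"
begin

lemma gorenstein_fan_eq: "\<Sigma> = {face_cone v I | v I. v \<in> final_cones (u, F)}"
proof (intro equalityI subsetI)
  fix \<tau> assume "\<tau> \<in> \<Sigma>"
  then obtain v where v: "\<tau> \<noteq> {}" "v \<in> final_cones (u, F)" "\<tau> face_of face_cone v UNIV"
    by (auto simp: \<Sigma> cone_gen_eq_face_cone)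
  obtain e where "smooth_basis N v e" using final_cones_basis[OF node v(2)] by blast
  then have "dual_bases v e" by (simp add: smooth_basis_def)
  then show "\<tau> \<in> {face_cone v I | v I. v \<in> final_cones (u, F)}" using face_of_face_coneD v by blast
next
  fix \<tau> assume "\<tau> \<in> {face_cone v I | v I. v \<in> final_cones (u, F)}"
  then obtain v I where v: "v \<in> final_cones (u, F)" "\<tau> = face_cone v I" by blast
  obtain e where "smooth_basis N v e" using final_cones_basis[OF node v(1)] by blast
  then have "\<tau> face_of face_cone v UNIV" using v face_cone_face by (auto simp: smooth_basis_def)
  moreover have "\<tau> \<noteq> {}" using face_cone_convex_cone[of v I] v(2) by (auto simp: convex_cone_def)
  ultimately show "\<tau> \<in> \<Sigma>" using v by (auto simp: \<Sigma> cone_gen_eq_face_cone)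
qed

lemma smooth_fan_gorenstein: "smooth_fan N \<Sigma>"
proof
  fix \<sigma> assume "\<sigma> \<in> \<Sigma>"
  then obtain v J where v: "v \<in> final_cones (u, F)" "\<sigma> = face_cone v J" unfolding gorenstein_fan_eq by blast
  obtain e where e: "smooth_basis N v e" using final_cones_basis[OF node v(1)] by blast
  have "\<exists>I\<subseteq>J. \<sigma> \<inter> \<sigma>' = face_cone v I" if \<sigma>': "\<sigma>' \<in> \<Sigma>" for \<sigma>'
  proof -
    obtain v' J' where v': "v' \<in> final_cones (u, F)" "\<sigma>' = face_cone v' J'" using \<sigma>' unfolding gorenstein_fan_eq by blast
    have "\<sigma> \<inter> \<sigma>' = face_cone v {k \<in> J. \<exists>k'\<in>J'. v' k' = v k}"
      unfolding v(2) v'(2) by (rule final_cones_Int[OF node v(1) v'(1)])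
    then show ?thesis by (intro exI[of _ "{k \<in> J. \<exists>k'\<in>J'. v' k' = v k}"]) simp
  qed
  then show "\<exists>u d J. smooth_basis N u d \<and> \<sigma> = face_cone u J \<and> (\<forall>\<sigma>'\<in>\<Sigma>. \<exists>I\<subseteq>J. \<sigma> \<inter> \<sigma>' = face_cone u I)"
    using e v(2) by (intro exI[of _ v] exI[of _ e] exI[of _ J]) simp
next
  fix \<sigma> \<sigma>' assume "\<sigma> \<in> \<Sigma>" "\<sigma>' \<in> \<Sigma>"
  then obtain v J v' J' where "v \<in> final_cones (u, F)" "\<sigma> = face_cone v J" "v' \<in> final_cones (u, F)" "\<sigma>' = face_cone v' J'"
    unfolding gorenstein_fan_eq by blast
  then have "\<sigma> \<inter> \<sigma>' = face_cone v {k \<in> J. \<exists>k'\<in>J'. v' k' = v k}" "v \<in> final_cones (u, F)"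
    using final_cones_Int[OF node] by auto
  then show "\<sigma> \<inter> \<sigma>' \<in> \<Sigma>" unfolding gorenstein_fan_eq by (intro CollectI exI conjI)
qed

lemma has_euler_characteristic_gorenstein_fan:
  "has_euler_characteristic (toric_variety N \<Sigma>) (snd F)"
proof -
  interpret smooth_fan N \<Sigma> by (rule smooth_fan_gorenstein)
  let ?Y = "toric_variety N \<Sigma>"
  let ?L = "final_cones (u, F)"
  let ?K = "cone_gen ` ?L"
  \<comment> \<open>Charts of proper faces: they have Euler characteristic 0, are closed under
    intersection, and include all overlaps of charts of distinct maximal cones.\<close>
  define \<G> where "\<G> = {chart_image (face_cone v I) | v I. v \<in> ?L \<and> I \<noteq> UNIV}"
  have in\<Sigma>: "face_cone v I \<in> \<Sigma>" if "v \<in> ?L" for v I using that unfolding gorenstein_fan_eq by blast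
  have chart: "openin ?Y (chart_image (face_cone v I)) \<and>
      has_euler_characteristic (subtopology ?Y (chart_image (face_cone v I))) (if I = UNIV then 1 else 0)"
    if v: "v \<in> ?L" for v I
  proof
    show "openin ?Y (chart_image (face_cone v I))" by (rule openin_chart_image[OF in\<Sigma>[OF v]])
    obtain e where "smooth_basis N v e" using final_cones_basis[OF node v] by blast
    then have "has_euler_characteristic (affine_toric N (face_cone v I)) (if I = UNIV then 1 else 0)"
      by (rule has_euler_characteristic_affine_toric)
    then show "has_euler_characteristic (subtopology ?Y (chart_image (face_cone v I))) (if I = UNIV then 1 else 0)"
      by (rule has_euler_characteristic_homeomorphic[OF chart_image_homeomorphic[OF in\<Sigma>[OF v]]])
  qed
  have "has_euler_characteristic (subtopology ?Y (\<Union>\<sigma>\<in>?K. chart_image \<sigma>)) (int (card ?K))"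
  proof (rule has_euler_characteristic_cover)
    show "openin ?Y U \<and> has_euler_characteristic (subtopology ?Y U) 0" if U: "U \<in> \<G>" for U
    proof -
      obtain v I where "U = chart_image (face_cone v I)" "v \<in> ?L" "I \<noteq> UNIV" using U by (auto simp: \<G>_def)
      then show ?thesis using chart[of v I] by simp
    qed
    show "U \<inter> V \<in> \<G>" if U: "U \<in> \<G>" and V: "V \<in> \<G>" for U V
    proof -
      obtain v I where v: "U = chart_image (face_cone v I)" "v \<in> ?L" "I \<noteq> UNIV" using U by (auto simp: \<G>_def)
      obtain v' I' where v': "V = chart_image (face_cone v' I')" "v' \<in> ?L" "I' \<noteq> UNIV" using V by (auto simp: \<G>_def)
      have "U \<inter> V = chart_image (face_cone v {k \<in> I. \<exists>k'\<in>I'. v' k' = v k})"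
        unfolding v(1) v'(1) chart_image_Int[OF in\<Sigma>[OF v(2)] in\<Sigma>[OF v'(2)]] final_cones_Int[OF node v(2) v'(2)] ..
      moreover have "{k \<in> I. \<exists>k'\<in>I'. v' k' = v k} \<noteq> UNIV" using v(3) by auto
      ultimately show ?thesis unfolding \<G>_def using v(2) by (intro CollectI exI conjI)
    qed
    show "finite ?K" using card_final_cones[OF node] by simp
    show "openin ?Y (chart_image \<sigma>) \<and> has_euler_characteristic (subtopology ?Y (chart_image \<sigma>)) 1" if \<sigma>: "\<sigma> \<in> ?K" for \<sigma>
    proof -
      obtain v where "v \<in> ?L" "\<sigma> = face_cone v UNIV" using \<sigma> by (auto simp: cone_gen_eq_face_cone)
      then show ?thesis using chart[of v UNIV] by simp
    qed
    show "chart_image \<sigma> \<inter> chart_image \<sigma>' \<in> \<G>" if \<sigma>: "\<sigma> \<in> ?K" and \<sigma>': "\<sigma>' \<in> ?K" and ne: "\<sigma> \<noteq> \<sigma>'" for \<sigma> \<sigma>'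
    proof -
      obtain v where v: "v \<in> ?L" "\<sigma> = face_cone v UNIV" using \<sigma> by (auto simp: cone_gen_eq_face_cone)
      obtain v' where v': "v' \<in> ?L" "\<sigma>' = face_cone v' UNIV" using \<sigma>' by (auto simp: cone_gen_eq_face_cone)
      let ?I = "{k \<in> UNIV. \<exists>k'\<in>UNIV. v' k' = v k}"
      have "chart_image \<sigma> \<inter> chart_image \<sigma>' = chart_image (face_cone v ?I)"
        unfolding v(2) v'(2) chart_image_Int[OF in\<Sigma>[OF v(1)] in\<Sigma>[OF v'(1)]] final_cones_Int[OF node v(1) v'(1)] ..
      \<comment> \<open>Sharing all three generators would make the two cones equal.\<close>
      moreover have "?I \<noteq> UNIV"
      proof
        assume "?I = UNIV"
        then have sub: "range v \<subseteq> range v'" by (auto simp: set_eq_iff) (metis rangeI)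
        have inj: "inj w" if w: "w \<in> ?L" for w
        proof -
          obtain e where "smooth_basis N w e" using final_cones_basis[OF node w] by blast
          then have "e i \<bullet> w j = (if i = j then 1 else 0)" for i j by (auto simp: smooth_basis_def dual_bases_def)
          then show ?thesis by (intro injI) (metis zero_neq_one)
        qed
        have "card (range v) = card (range v')" using inj[OF v(1)] inj[OF v'(1)] by (simp add: card_image)
        then have "range v = range v'" using sub by (intro card_subset_eq) auto
        then have "cone_gen v = cone_gen v'" by (simp add: cone_gen_def)
        then show False using ne v v' by (simp add: cone_gen_eq_face_cone)
      qed
      ultimately show ?thesis unfolding \<G>_def using v(1) by (intro CollectI exI conjI)
    qed
  qed
  moreover have "(\<Union>\<sigma>\<in>?K. chart_image \<sigma>) = topspace ?Y"
    unfolding topspace_toric_variety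
  proof (intro equalityI subsetI)
    fix P assume "P \<in> (\<Union>\<sigma>\<in>?K. chart_image \<sigma>)"
    then show "P \<in> (\<Union>\<sigma>\<in>\<Sigma>. chart_image \<sigma>)" using in\<Sigma> by (auto simp: cone_gen_eq_face_cone)
  next
    fix P assume "P \<in> (\<Union>\<sigma>\<in>\<Sigma>. chart_image \<sigma>)"
    then obtain v I where v: "v \<in> ?L" "P \<in> chart_image (face_cone v I)" unfolding gorenstein_fan_eq by blast
    \<comment> \<open>The chart of a face is contained in that of its maximal cone, so the maximal
      charts cover the variety.\<close>
    have "face_cone v I \<subseteq> face_cone v UNIV"
      by (intro face_cone_subset face_cone_convex_cone) (auto intro: generator_in_face_cone)
    then have "chart_image (face_cone v I) \<inter> chart_image (face_cone v UNIV) = chart_image (face_cone v I)"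
      using chart_image_Int[OF in\<Sigma>[OF v(1), of I] in\<Sigma>[OF v(1), of UNIV]] by (simp add: inf.absorb1)
    then show "P \<in> (\<Union>\<sigma>\<in>?K. chart_image \<sigma>)" using v by (auto simp: cone_gen_eq_face_cone)
  qed
  moreover have "int (card ?K) = snd F"
    using card_final_cones[OF node] node by (auto simp: gorenstein_node_def gorenstein_label_def)
  ultimately show ?thesis by simp
qed

text \<open>Two generators in \<open>I\<close> would be independent and give dimension at least 2,
  while an empty \<open>I\<close> gives dimension 0.\<close>

lemma ray_gorenstein_fan:
  assumes "\<tau> \<in> rays \<Sigma>"
  shows "\<exists>v a. v \<in> final_cones (u, F) \<and> \<tau> = face_cone v {a}"
proof -
  obtain v I where v: "v \<in> final_cones (u, F)" and \<tau>: "\<tau> = face_cone v I" and dim: "dim (face_cone v I) = 1"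
    using assms unfolding rays_def gorenstein_fan_eq by auto
  obtain e where "smooth_basis N v e" using final_cones_basis[OF node v] by blast
  then have e: "e i \<bullet> v j = (if i = j then 1 else 0)" for i j by (auto simp: smooth_basis_def dual_bases_def)
  have "I \<noteq> {}"
  proof
    assume "I = {}"
    then have "face_cone v I \<subseteq> {0}" by (auto simp: face_cone_def)
    then show False using dim dim_subset[of "face_cone v I" "{0}"] by simp
  qed
  then obtain a where a: "a \<in> I" by blast
  have "b = a" if b: "b \<in> I" for b
  proof (rule ccontr)
    assume ab: "b \<noteq> a"
    then have "v a \<noteq> v b" using e[of a a] e[of a b] by auto
    have "v a \<noteq> 0" using e[of a a] by auto
    have "v b \<notin> span {v a}"
      using e[of b b] e[of b a] ab by (auto simp: span_singleton)
    then have "independent {v b, v a}"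
      using \<open>v a \<noteq> 0\<close> by (simp add: independent_insert)
    moreover have "{v b, v a} \<subseteq> face_cone v I" using a b generator_in_face_cone by auto
    ultimately have "card {v b, v a} \<le> dim (face_cone v I)"
      by (metis dim_eq_card_independent dim_subset)
    then show False using dim \<open>v a \<noteq> v b\<close> by simp
  qed
  then have "I = {a}" using a by blast
  then show ?thesis using v \<tau> by blast
qed

text \<open>A generator belongs to a lattice basis, hence is the primitive element of its ray, and
  its height is 1.\<close>

lemma crepant_gorenstein_fan:
  assumes "0 < r"
  shows "crepant r N \<Sigma>"
  unfolding crepant_def
proof
  fix \<tau> assume "\<tau> \<in> rays \<Sigma>"
  then obtain v a where v: "v \<in> final_cones (u, F)" and \<tau>: "\<tau> = face_cone v {a}"
    using ray_gorenstein_fan by blast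
  obtain e where sb: "smooth_basis N v e" and h: "height (v a) = 1" using final_cones_basis[OF node v] by blast
  have db: "dual_bases v e" using sb by (simp add: smooth_basis_def)
  then have e: "e i \<bullet> v j = (if i = j then 1 else 0)" for i j by (simp add: dual_bases_def)
  have N: "N \<inter> \<tau> = {real k *\<^sub>R v a | k :: nat. True}"
  proof (intro equalityI subsetI)
    fix x assume x: "x \<in> N \<inter> \<tau>"
    then have "e a \<bullet> x \<in> \<int>" "0 \<le> e a \<bullet> x" "\<And>i. i \<noteq> a \<Longrightarrow> e i \<bullet> x = 0"
      using smooth_basis_iff[OF sb] face_cone_iff[OF db] unfolding \<tau> by auto
    then obtain k :: nat where k: "e a \<bullet> x = real k" by (auto elim!: Ints_cases) (metis of_int_of_nat_eq zero_le_imp_eq_int)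
    have "x = (\<Sum>i\<in>UNIV. (e i \<bullet> x) *\<^sub>R v i)" by (rule dual_bases_expand[OF db])
    also have "\<dots> = (\<Sum>i\<in>UNIV. if i = a then real k *\<^sub>R v a else 0)"
      using k \<open>\<And>i. i \<noteq> a \<Longrightarrow> e i \<bullet> x = 0\<close> by (intro sum.cong) auto
    finally have "x = real k *\<^sub>R v a" by simp
    then show "x \<in> {real k *\<^sub>R v a | k :: nat. True}" by blast
  next
    fix x assume "x \<in> {real k *\<^sub>R v a | k :: nat. True}"
    then obtain k :: nat where "x = real k *\<^sub>R v a" by blast
    then show "x \<in> N \<inter> \<tau>"
      using smooth_basis_iff[OF sb, of x] face_cone_iff[OF db, of x] unfolding \<tau> by (auto simp: e)
  qed
  have va: "v a \<noteq> 0" using e[of a a] by auto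
  have "primitive_element N \<tau> = v a"
    unfolding primitive_element_def
  proof (rule the_equality)
    show "v a \<noteq> 0 \<and> N \<inter> \<tau> = {real k *\<^sub>R v a | k :: nat. True}" using va N by blast
    \<comment> \<open>Two such elements are natural multiples of each other, so both factors are
      1.\<close>
    fix y assume y: "y \<noteq> 0 \<and> N \<inter> \<tau> = {real k *\<^sub>R y | k :: nat. True}"
    then have eq: "{real k *\<^sub>R v a | k :: nat. True} = {real k *\<^sub>R y | k :: nat. True}" using N by simp
    have "real 1 *\<^sub>R v a \<in> {real k *\<^sub>R v a | k :: nat. True}" by blast
    then obtain k where k: "v a = real k *\<^sub>R y" unfolding eq by auto
    have "real 1 *\<^sub>R y \<in> {real k *\<^sub>R y | k :: nat. True}" by blast
    then obtain l where l: "y = real l *\<^sub>R v a" unfolding eq[symmetric] by auto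
    have "real (k * l) *\<^sub>R v a = 1 *\<^sub>R v a" using k l by (metis of_nat_mult scaleR_one scaleR_scaleR)
    then have "real (k * l) = 1" using va scaleR_cancel_right by blast
    then have "k * l = 1" using of_nat_eq_1_iff by blast
    then have "l = 1" by simp
    then show "y = v a" using l by simp
  qed
  then show "discrepancy r N \<tau> = 0"
    using h assms by (simp add: discrepancy_def Let_def height_def flip: distrib_left)
qed

end

theorem corollary1p5:
  fixes r a2 a3 :: nat and \<epsilon> :: complex
  assumes "r \<ge> 2" and "a2 \<le> r - 1" and "a3 \<le> r - 1"
    and "primitive_root_of_unity r \<epsilon>"
    and "cyclic_group_type \<epsilon> a2 a3 \<subseteq> SL3"
  shows "crepant r (N_lattice r a2 a3) (fujiki_oka_fan r a2 a3) \<and>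
         has_euler_characteristic (fujiki_oka_resolution r a2 a3)
           (int (card (cyclic_group_type \<epsilon> a2 a3)))"
proof
  have sum: "1 + a2 + a3 = r" using SL3_exponent_sum assms by blast
  note node = gorenstein_node_initial[OF sum assms(1)]
  have \<Sigma>: "fujiki_oka_fan r a2 a3 = {\<tau>. \<tau> \<noteq> {} \<and>
      (\<exists>v \<in> final_cones (\<lambda>i. axis i 1, initial_fraction r a2 a3). \<tau> face_of cone_gen v)}"
    unfolding fujiki_oka_fan_def fujiki_oka_cones_eq final_cones_def by auto
  show "crepant r (N_lattice r a2 a3) (fujiki_oka_fan r a2 a3)"
    using assms(1) by (intro crepant_gorenstein_fan[OF node \<Sigma>]) simp
  have "card (cyclic_group_type \<epsilon> a2 a3) = r" using card_cyclic_group_type assms by simp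
  then show "has_euler_characteristic (fujiki_oka_resolution r a2 a3) (int (card (cyclic_group_type \<epsilon> a2 a3)))"
    using has_euler_characteristic_gorenstein_fan[OF node \<Sigma>]
    by (simp add: fujiki_oka_resolution_def initial_fraction_def)
qed

end
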